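(* Let $\mathbb{G}$ be a stratified group whose first stratum has dimension $N\geq 3$, let $\gamma\in\mathbb{R}$, let $X=\sum_{j=1}^{N}a_jX_j$ with $a_1,\ldots,a_N\in\mathbb{R}$, and let $\mathcal{L}_X=-\sum_{j=1}^{N}X_j^2-\gamma X$, $b_X=\frac12\big(\sum_{j=1}^N a_j^2\big)^{1/2}$, and $\mu_X$ be as in the context. (1) Let $\delta\in\mathbb{R}$ with $-N/2\leq\delta\leq-1$. Then for all complex-valued $f\in C_0^\infty(\mathbb{G}\backslash\{x'=0\})$ we have $$\left\|\frac{\mathcal{L}_{X} f}{|x'|^{\delta}}\right\|^{2}_{L^{2}(\mathbb{G},\mu_{X})}\geq\left(\frac{(N-2\delta-4)(N+2\delta)}{4}\right)^{2}\left\|\frac{f}{|x'|^{\delta+2}}\right\|^{2}_{L^{2}(\mathbb{G},\mu_{X})}+\gamma^{2}b_{X}^{2}\frac{(N-2\delta-2)(N+2\delta-2)}{2}\left\|\frac{f}{|x'|^{\delta+1}}\right\|^{2}_{L^{2}(\mathbb{G},\mu_{X})}+\gamma^{4}b_{X}^{4}\left\|\frac{f}{|x'|^{\delta}}\right\|^{2}_{L^{2}(\mathbb{G},\mu_{X})}.$$ If $(N+2\delta)(N+2\delta-2)\neq0$, then the constants in this inequality are sharp in the sense that there is a sequence of nonzero functions along which equality is attained in the limit (the quotient of the left-hand side by the right-hand side tends to $1$). (2) If $N>4$ (the case $\delta=0$), then for all complex-valued $f\in C_0^\infty(\mathbb{G}\backslash\{x'=0\})$ we have $$\left\|\mathcal{L}_{X}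 f\right\|^{2}_{L^{2}(\mathbb{G},\mu_{X})}\geq\left(\frac{N(N-4)}{4}\right)^{2}\left\|\frac{f}{|x'|^{2}}\right\|^{2}_{L^{2}(\mathbb{G},\mu_{X})}+\gamma^{2}b_{X}^{2}\frac{(N-2)^{2}}{2}\left\|\frac{f}{|x'|}\right\|^{2}_{L^{2}(\mathbb{G},\mu_{X})}+\gamma^{4}b_{X}^{4}\|f\|^{2}_{L^{2}(\mathbb{G},\mu_{X})},$$ and the constants are sharp in the same sense: there is a sequence of nonzero functions along which the quotient of the left-hand side by the right-hand side tends to $1$.
   Context: A stratified group (homogeneous Carnot group) is a Lie group $\mathbb{G}=(\mathbb{R}^n,\circ)$ such that: (i) there are natural numbers $N=N_1,N_2,\ldots,N_r$ with $N_1+\cdots+N_r=n$, and, writing $x=(x',x^{(2)},\ldots,x^{(r)})\in\mathbb{R}^{N}\times\mathbb{R}^{N_2}\times\cdots\times\mathbb{R}^{N_r}$, for every $\lambda>0$ the dilation $\delta_\lambda(x)=(\lambda x',\lambda^2x^{(2)},\ldots,\lambda^r x^{(r)})$ is an automorphism of $\mathbb{G}$; (ii) the left-invariant vector fields $X_1,\ldots,X_N$ on $\mathbb{G}$ with $X_k(0)=\frac{\partial}{\partial x_k}\big|_0$, $k=1,\ldots,N$, satisfy $\mathrm{rank}(\mathrm{Lie}\{X_1,\ldots,X_N\})=n$, i.e. their iterated commutators span the Lie algebra of $\mathbb{G}$. The number $N$ is the dimension of the first stratum. The Lebesgue measure $dx$ on $\mathbb{R}^n$ is the Haar measure $\mu$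 of $\mathbb{G}$. $|x'|$ denotes the Euclidean norm of $x'\in\mathbb{R}^N$. The measure $\mu_X$ is $d\mu_X=\chi\,dx$, where $\chi:\mathbb{G}\to(0,\infty)$ is the positive character of $\mathbb{G}$ (continuous homomorphism into the multiplicative group of positive reals) with $X_k\chi=\gamma a_k\chi$ for $k=1,\ldots,N$; explicitly $\chi(x)=\exp\big(\gamma\sum_{k=1}^N a_kx'_k\big)$. With this choice $\mathcal{L}_X$ is symmetric on $L^2(\mathbb{G},\mu_X)$. $C_0^\infty$ denotes smooth compactly supported functions, and $\mathbb{G}\backslash\{x'=0\}$ is the open set of points with $x'\neq0$. *)

theory Defs
  imports "HOL-Analysis.Analysis" "HOL-Algebra.Group"
begin

section \<open>Smooth functions and test functions\<close>

text \<open>\<open>C\<^sup>k\<close> regularity, used for open \<open>S\<close> only: all directional derivatives of order less than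
  \<open>k\<close> exist and are differentiable, those of order \<open>k\<close> are continuous.\<close>

primrec Ck_on :: "nat \<Rightarrow> 'a set \<Rightarrow> ('a::real_normed_vector \<Rightarrow> 'b::real_normed_vector) \<Rightarrow> bool" where
  "Ck_on 0 S f \<longleftrightarrow> continuous_on S f"
| "Ck_on (Suc k) S f \<longleftrightarrow>
     (\<forall>x\<in>S. f differentiable (at x)) \<and> (\<forall>v. Ck_on k S (\<lambda>x. frechet_derivative f (at x) v))"

definition smooth_on :: "'a set \<Rightarrow> ('a::real_normed_vector \<Rightarrow> 'b::real_normed_vector) \<Rightarrow> bool" where
  "smooth_on S f \<longleftrightarrow> (\<forall>k. Ck_on k S f)"

text \<open>\<open>C\<^sub>0\<^sup>\<infinity>(\<Omega>)\<close>, its elements being extended by zero to the whole space.\<close>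

definition test_functions :: "'a set \<Rightarrow> ('a::real_normed_vector \<Rightarrow> complex) set" where
  "test_functions \<Omega> =
     {f. smooth_on UNIV f \<and> compact (closure {x. f x \<noteq> 0}) \<and> closure {x. f x \<noteq> 0} \<subseteq> \<Omega>}"

section \<open>Vector fields\<close>

text \<open>A vector field on a vector space is given by its coefficient map \<open>V :: 'a \<Rightarrow> 'a\<close>.\<close>

definition apply_field :: "('a::real_normed_vector \<Rightarrow> 'a) \<Rightarrow> ('a \<Rightarrow> 'b::real_normed_vector) \<Rightarrow> 'a \<Rightarrow> 'b" where
  "apply_field V f x = frechet_derivative f (at x) (V x)"

definition lie_bracket :: "('a::real_normed_vector \<Rightarrow> 'a) \<Rightarrow> ('a \<Rightarrow> 'a) \<Rightarrow> 'a \<Rightarrow> 'a" where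
  "lie_bracket V W x = apply_field V W x - apply_field W V x"

inductive_set lie_hull :: "('a::real_normed_vector \<Rightarrow> 'a) set \<Rightarrow> ('a \<Rightarrow> 'a) set"
  for S :: "('a \<Rightarrow> 'a) set" where
  generator: "V \<in> S \<Longrightarrow> V \<in> lie_hull S"
| zero: "(\<lambda>_. 0) \<in> lie_hull S"
| add: "V \<in> lie_hull S \<Longrightarrow> W \<in> lie_hull S \<Longrightarrow> (\<lambda>x. V x + W x) \<in> lie_hull S"
| scale: "V \<in> lie_hull S \<Longrightarrow> (\<lambda>x. c *\<^sub>R V x) \<in> lie_hull S"
| bracket: "V \<in> lie_hull S \<Longrightarrow> W \<in> lie_hull S \<Longrightarrow> lie_bracket V W \<in> lie_hull S"

definition left_invariant :: "('a::real_normed_vector) monoid \<Rightarrow> ('a \<Rightarrow> 'a) \<Rightarrow> bool" where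
  "left_invariant G V \<longleftrightarrow>
     (\<forall>a x. frechet_derivative (\<lambda>y. a \<otimes>\<^bsub>G\<^esub> y) (at x) (V x) = V (a \<otimes>\<^bsub>G\<^esub> x))"

section \<open>Stratified groups\<close>

text \<open>The decomposition of \<open>\<real>\<^sup>n\<close> into strata is encoded by \<open>wt :: 'n \<Rightarrow> nat\<close>: coordinate \<open>i\<close>
  belongs to \<open>x\<^sup>(\<^sup>j\<^sup>)\<close> iff \<open>wt i = j\<close>, so that \<open>N\<^sub>j = card {i. wt i = j}\<close> and \<open>r\<close> is the largest value
  of \<open>wt\<close>.\<close>

definition dilation :: "('n \<Rightarrow> nat) \<Rightarrow> real \<Rightarrow> real^'n \<Rightarrow> real^'n" where
  "dilation wt l x = (\<chi> i. l ^ wt i * x $ i)"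

text \<open>Only the fields \<open>X k\<close> with \<open>wt k = 1\<close> are meaningful. The rank of a family of
  vector fields is the dimension of the span of its values, required at every point.\<close>

locale stratified_group =
  fixes G :: "(real^'n) monoid"
    and wt :: "'n \<Rightarrow> nat"
    and X :: "'n \<Rightarrow> real^'n \<Rightarrow> real^'n"
  assumes group: "group G"
    and carrier: "carrier G = UNIV"
    and smooth_mult: "smooth_on UNIV (\<lambda>(x, y). x \<otimes>\<^bsub>G\<^esub> y)"
    and smooth_inv: "smooth_on UNIV (\<lambda>x. inv\<^bsub>G\<^esub> x)"
    and wt_pos: "\<And>i. wt i \<ge> 1"
    and dilation_iso: "\<And>l. l > 0 \<Longrightarrow> dilation wt l \<in> iso G G"
    and left_invariant_X: "\<And>k. wt k = 1 \<Longrightarrow> left_invariant G (X k)"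
    and X_zero: "\<And>k. wt k = 1 \<Longrightarrow> X k 0 = axis k 1"
    and rank_lie_hull: "\<And>x. dim ((\<lambda>V. V x) ` lie_hull (X ` {k. wt k = 1})) = CARD('n)"
begin

text \<open>The point \<open>0\<close> at which the fields \<open>X k\<close> are prescribed is the neutral element.\<close>

lemma one_eq_zero: "\<one>\<^bsub>G\<^esub> = 0"
proof -
  interpret G: group G by (rule group)
  have "dilation wt 2 \<in> hom G G"
    using dilation_iso[of 2] by (simp add: iso_def)
  then have "dilation wt 2 \<one>\<^bsub>G\<^esub> = \<one>\<^bsub>G\<^esub>"
    using hom_one[OF _ group group] by blast
  then have "2 ^ wt i * \<one>\<^bsub>G\<^esub> $ i = \<one>\<^bsub>G\<^esub> $ i" for i
    by (simp add: dilation_def vec_eq_iff)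
  moreover have "(2::real) ^ wt i \<noteq> 1" for i
    using wt_pos[of i] one_less_power[of "2::real" "wt i"] by force
  ultimately show ?thesis
    by (simp add: vec_eq_iff)
qed

end

text \<open>\<open>|x'|\<close>\<close>

definition hnorm :: "('n \<Rightarrow> nat) \<Rightarrow> real^'n \<Rightarrow> real" where
  "hnorm wt x = L2_set (\<lambda>i. x $ i) {i. wt i = 1}"

section \<open>The sub-Laplacian with drift\<close>

definition drift :: "('n::finite \<Rightarrow> nat) \<Rightarrow> ('n \<Rightarrow> real^'n \<Rightarrow> real^'n) \<Rightarrow> ('n \<Rightarrow> real) \<Rightarrow> real^'n \<Rightarrow> real^'n" where
  "drift wt X a x = (\<Sum>j | wt j = 1. a j *\<^sub>R X j x)"

definition drift_sublaplacian ::
  "('n::finite \<Rightarrow> nat) \<Rightarrow> ('n \<Rightarrow> real^'n \<Rightarrow> real^'n) \<Rightarrow> real \<Rightarrow> ('n \<Rightarrow> real) \<Rightarrow>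
     (real^'n \<Rightarrow> complex) \<Rightarrow> real^'n \<Rightarrow> complex" where
  "drift_sublaplacian wt X \<gamma> a f x =
     - (\<Sum>j | wt j = 1. apply_field (X j) (apply_field (X j) f) x)
     - \<gamma> *\<^sub>R apply_field (drift wt X a) f x"

definition b_X :: "('n::finite \<Rightarrow> nat) \<Rightarrow> ('n \<Rightarrow> real) \<Rightarrow> real" where
  "b_X wt a = sqrt (\<Sum>j | wt j = 1. (a j)\<^sup>2) / 2"

definition character :: "('n::finite \<Rightarrow> nat) \<Rightarrow> real \<Rightarrow> ('n \<Rightarrow> real) \<Rightarrow> real^'n \<Rightarrow> real" where
  "character wt \<gamma> a x = exp (\<gamma> * (\<Sum>k | wt k = 1. a k * x $ k))"

definition mu_X :: "('n::finite \<Rightarrow> nat) \<Rightarrow> real \<Rightarrow> ('n \<Rightarrow> real) \<Rightarrow> (real^'n) measure" where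
  "mu_X wt \<gamma> a = density lborel (\<lambda>x. ennreal (character wt \<gamma> a x))"

text \<open>As usual for the Bochner integral, this is junk (zero) for functions that are not
  square integrable. It is applied below only to continuous functions of compact support.\<close>

definition L2_norm :: "'a measure \<Rightarrow> ('a \<Rightarrow> complex) \<Rightarrow> real" where
  "L2_norm M f = sqrt (LINT x|M. (cmod (f x))\<^sup>2)"

text \<open>There are nonzero functions in \<open>T\<close> along which \<open>lhs / rhs\<close> tends to \<open>1\<close>.\<close>

definition equality_in_limit ::
  "('a \<Rightarrow> complex) set \<Rightarrow> (('a \<Rightarrow> complex) \<Rightarrow> real) \<Rightarrow> (('a \<Rightarrow> complex) \<Rightarrow> real) \<Rightarrow> bool" where
  "equality_in_limit T lhs rhs \<longleftrightarrow>
     (\<exists>F :: nat \<Rightarrow> 'a \<Rightarrow> complex.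
        (\<forall>m. F m \<in> T \<and> F m \<noteq> (\<lambda>_. 0)) \<and> (\<lambda>m. lhs (F m) / rhs (F m)) \<longlonglongrightarrow> 1)"

end

theory Submission
  imports Defs "HOL-Real_Asymp.Real_Asymp"
begin

text \<open>
  The drift is removed by a substitution. Put \<open>f = half_char * g\<close>, where \<open>half_char\<close> is the character
  to the power \<open>- 1 / 2\<close>. Then \<open>\<L>\<^sub>X f = half_char * (L g + c g)\<close> with \<open>L = - \<Sum>j. X\<^sub>j\<^sup>2\<close> and
  \<open>c = \<gamma>\<^sup>2 b\<^sub>X\<^sup>2\<close> (lemma \<open>drift_sublaplacian_half_char\<close>), and all norms become norms of \<open>g\<close> with
  respect to Lebesgue measure. The group structure enters as follows: left invariance makes
  the fields \<open>X\<^sub>j\<close> smooth, and their components are homogeneous, which forces the fields to act on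
  functions of \<open>x'\<close> as the coordinate derivatives and to be free of divergence (locale
  \<open>horizontal_frame\<close>).

  Expand \<open>|L g + c g|\<^sup>2\<close>. Its last term is the last term of the claim. The mixed term
  \<open>2 c (L g \<bullet> g)\<close> is handled by a weighted Hardy inequality, which holds pointwise up to a divergence,
  because the remainder is a sum of squares (\<open>hardy_pointwise\<close>). The first term is a weighted
  Rellich inequality; it follows from the Hardy inequality with a different weight, again by
  completing a square (\<open>rellich_integral\<close>). In this last step the constant
  \<open>A = (N - 2\<delta> - 4) (N + 2\<delta>) / 4\<close> has to be nonnegative, which the range of \<open>\<delta>\<close> guarantees.

  For the limit statement, functions concentrated near \<open>x' = 0\<close> suffice: there the term with
  the most singular weight dominates both sides, so only the Rellich constant \<open>A\<^sup>2\<close> must be attained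
  asymptotically. The function \<open>|x'| powr (- (N - 2\<delta> - 4) / 2)\<close> attains it formally, and truncating
  it on a long logarithmic scale costs a bounded amount while the main term grows with the length of
  the scale (\<open>near_optimizers\<close>). The integrals are compared on logarithmic shells, which all have
  equal mass by a scaling in \<open>x'\<close>. The two parts of the theorem are the instances of
  \<open>hardy_rellich_drift\<close> for \<open>\<delta> \<le> -1\<close> and for \<open>\<delta> = 0\<close>.
\<close>

section \<open>Calculus of \<open>C\<^sup>k\<close> functions\<close>

lemma frechet_derivative_eqI: "(f has_derivative f') (at x) \<Longrightarrow> frechet_derivative f (at x) = f'"
  by (metis frechet_derivative_at)

lemma differentiable_transform_open:
  assumes "open S" "x \<in> S" "\<And>x. x \<in> S \<Longrightarrow> f x = g x" "f differentiable at x"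
  shows "g differentiable at x"
  using assms by (meson differentiable_def has_derivative_transform_within_open)

lemma Ck_on_cong:
  assumes "open S" "Ck_on k S f" "\<And>x. x \<in> S \<Longrightarrow> f x = g x"
  shows "Ck_on k S g"
  using assms(2,3)
proof (induction k arbitrary: f g)
  case 0
  then show ?case by (simp cong: continuous_on_cong)
next
  case (Suc k)
  have d: "f differentiable at x" if "x \<in> S" for x using Suc.prems that by simp
  have "g differentiable at x" if "x \<in> S" for x
    using differentiable_transform_open[OF assms(1) that Suc.prems(2) d[OF that]] by simp
  moreover have "Ck_on k S (\<lambda>x. frechet_derivative g (at x) v)" for v
  proof (rule Suc.IH)
    show "Ck_on k S (\<lambda>x. frechet_derivative f (at x) v)" using Suc.prems by simp
    show "frechet_derivative f (at x) v = frechet_derivative g (at x) v" if "x \<in> S" for x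
      using frechet_derivative_transform_within_open[OF d[OF that] assms(1) that] Suc.prems(2) by metis
  qed
  ultimately show ?case by simp
qed

lemma Ck_on_Suc_D: "Ck_on (Suc k) S f \<Longrightarrow> Ck_on k S f"
proof (induction k arbitrary: f)
  case 0
  then show ?case
    by (auto intro!: continuous_at_imp_continuous_on differentiable_imp_continuous_within)
next
  case (Suc k)
  then show ?case by (metis Ck_on.simps(2))
qed

lemma Ck_on_continuous: "Ck_on k S f \<Longrightarrow> continuous_on S f"
  by (induction k) (use Ck_on_Suc_D in \<open>auto simp del: Ck_on.simps(2)\<close>)

lemma Ck_on_subset: "Ck_on k S f \<Longrightarrow> T \<subseteq> S \<Longrightarrow> Ck_on k T f"
  by (induction k arbitrary: f) (auto intro: continuous_on_subset)

lemma Ck_on_Un: "open S \<Longrightarrow> open T \<Longrightarrow> Ck_on k S f \<Longrightarrow> Ck_on k T f \<Longrightarrow> Ck_on k (S \<union> T) f"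
  by (induction k arbitrary: f) (auto intro: continuous_on_open_Un)

lemma Ck_on_const [simp, intro]: "Ck_on k S (\<lambda>x. c)"
  by (induction k arbitrary: c) auto

lemma Ck_on_bounded_linear: "bounded_linear L \<Longrightarrow> Ck_on k S L"
proof (cases k)
  case (Suc j)
  assume L: "bounded_linear L"
  have "frechet_derivative L (at x) = L" for x
    by (rule frechet_derivative_eqI[OF bounded_linear_imp_has_derivative[OF L]])
  then show ?thesis using L Suc by (auto intro: bounded_linear_imp_differentiable)
qed (auto intro: linear_continuous_on)

lemma Ck_on_add:
  assumes "Ck_on k S f" "Ck_on k S g" "open S"
  shows "Ck_on k S (\<lambda>x. f x + g x)"
  using assms(1,2)
proof (induction k arbitrary: f g)
  case 0
  then show ?case by (simp add: continuous_on_add)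
next
  case (Suc k)
  have "frechet_derivative (\<lambda>x. f x + g x) (at x) =
      (\<lambda>v. frechet_derivative f (at x) v + frechet_derivative g (at x) v)" if "x \<in> S" for x
    by (rule frechet_derivative_eqI, intro has_derivative_add)
      (use Suc.prems that in \<open>auto simp flip: frechet_derivative_works\<close>)
  moreover have "Ck_on k S (\<lambda>x. frechet_derivative f (at x) v + frechet_derivative g (at x) v)" for v
    using Suc by simp
  ultimately have "Ck_on k S (\<lambda>x. frechet_derivative (\<lambda>x. f x + g x) (at x) v)" for v
    by (intro Ck_on_cong[OF assms(3), where g = "\<lambda>x. frechet_derivative (\<lambda>x. f x + g x) (at x) v"]) auto
  then show ?case using Suc.prems by auto
qed

lemma Ck_on_bilinear:
  assumes B: "bounded_bilinear B" and S: "open S"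
  assumes "Ck_on k S f" "Ck_on k S g"
  shows "Ck_on k S (\<lambda>x. B (f x) (g x))"
  using assms(3,4)
proof (induction k arbitrary: f g)
  case 0
  then show ?case by (simp add: bounded_bilinear.continuous_on[OF B])
next
  case (Suc k)
  have der: "((\<lambda>x. B (f x) (g x)) has_derivative
      (\<lambda>v. B (f x) (frechet_derivative g (at x) v) + B (frechet_derivative f (at x) v) (g x))) (at x)"
    if "x \<in> S" for x
    by (intro bounded_bilinear.FDERIV[OF B])
      (use Suc.prems that in \<open>auto simp flip: frechet_derivative_works\<close>)
  have "Ck_on k S (\<lambda>x. B (f x) (frechet_derivative g (at x) v) + B (frechet_derivative f (at x) v) (g x))" for v
    using Suc.prems Ck_on_Suc_D[OF Suc.prems(1)] Ck_on_Suc_D[OF Suc.prems(2)]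
    by (intro Ck_on_add S Suc.IH) simp_all
  then have "Ck_on k S (\<lambda>x. frechet_derivative (\<lambda>x. B (f x) (g x)) (at x) v)" for v
    by (rule Ck_on_cong[OF S]) (simp add: frechet_derivative_eqI[OF der])
  then show ?case using der by (auto simp: differentiable_def)
qed

lemmas Ck_on_mult = Ck_on_bilinear[OF bounded_bilinear_mult]
lemmas Ck_on_scaleR = Ck_on_bilinear[OF bounded_bilinear_scaleR]
lemmas Ck_on_inner = Ck_on_bilinear[OF bounded_bilinear_inner]

lemma Ck_on_linear_image:
  assumes "bounded_linear L" "open S" "Ck_on k S f"
  shows "Ck_on k S (\<lambda>x. L (f x))"
proof -
  have "bounded_bilinear (\<lambda>r x. r *\<^sub>R L x)"
    using bounded_bilinear.comp[OF bounded_bilinear_scaleR bounded_linear_ident assms(1)] .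
  from Ck_on_bilinear[OF this assms(2), of k "\<lambda>_. 1" f] assms(3) show ?thesis by simp
qed

lemma Ck_on_minus: "open S \<Longrightarrow> Ck_on k S f \<Longrightarrow> Ck_on k S (\<lambda>x. - f x)"
  by (rule Ck_on_linear_image[OF bounded_linear_minus[OF bounded_linear_ident]])

lemma Ck_on_diff: "open S \<Longrightarrow> Ck_on k S f \<Longrightarrow> Ck_on k S g \<Longrightarrow> Ck_on k S (\<lambda>x. f x - g x)"
  using Ck_on_add[of k S f "\<lambda>x. - g x"] Ck_on_minus[of S k g] by simp

lemma Ck_on_sum: "open S \<Longrightarrow> (\<And>i. i \<in> I \<Longrightarrow> Ck_on k S (f i)) \<Longrightarrow> Ck_on k S (\<lambda>x. \<Sum>i\<in>I. f i x)"
  by (induction I rule: infinite_finite_induct) (auto intro!: Ck_on_add)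

lemma Ck_on_power: "open S \<Longrightarrow> Ck_on k S f \<Longrightarrow> Ck_on k S (\<lambda>x. f x ^ n :: real)"
  by (induction n) (auto intro!: Ck_on_mult)

lemma Ck_on_precompose_linear:
  assumes "bounded_linear L" "Ck_on k UNIV f"
  shows "Ck_on k UNIV (\<lambda>x. f (L x))"
  using assms(2)
proof (induction k arbitrary: f)
  case 0
  then have "continuous_on UNIV f" by simp
  from continuous_on_compose2[OF this linear_continuous_on[OF assms(1)]] show ?case by simp
next
  case (Suc k)
  have der: "((\<lambda>x. f (L x)) has_derivative (\<lambda>v. frechet_derivative f (at (L x)) (L v))) (at x)" for x
  proof -
    have "(f has_derivative frechet_derivative f (at (L x))) (at (L x))"
      using Suc.prems by (auto simp flip: frechet_derivative_works)
    from has_derivative_compose[OF bounded_linear_imp_has_derivative[OF assms(1)] this]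
    show ?thesis .
  qed
  have "Ck_on k UNIV (\<lambda>x. frechet_derivative f (at (L x)) (L v))" for v
    using Suc.IH[of "\<lambda>x. frechet_derivative f (at x) (L v)"] Suc.prems by simp
  then show ?case using der
    by (auto simp: differentiable_def frechet_derivative_eqI[OF der])
qed

lemma Ck_on_compose_real:
  fixes h :: "real \<Rightarrow> real" and q :: "'a::real_normed_vector \<Rightarrow> real"
  assumes S: "open S" and "Ck_on k T h" "Ck_on k S q" "q ` S \<subseteq> T"
  shows "Ck_on k S (\<lambda>x. h (q x))"
  using assms(2,3)
proof (induction k arbitrary: h)
  case 0
  then have "continuous_on T h" "continuous_on S q" by simp_all
  from continuous_on_compose2[OF this assms(4)] show ?case by simp
next
  case (Suc k)
  let ?h' = "\<lambda>t. frechet_derivative h (at t) 1"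
  have der: "((\<lambda>x. h (q x)) has_derivative (\<lambda>v. frechet_derivative q (at x) v * ?h' (q x))) (at x)"
    if x: "x \<in> S" for x
  proof -
    have h: "(h has_derivative frechet_derivative h (at (q x))) (at (q x))"
      using Suc.prems(1) assms(4) x by (auto simp flip: frechet_derivative_works)
    have q: "(q has_derivative frechet_derivative q (at x)) (at x)"
      using Suc.prems(2) x by (auto simp flip: frechet_derivative_works)
    have "frechet_derivative h (at (q x)) r = r * ?h' (q x)" for r
      using linear_scale[OF has_derivative_linear[OF h], of r 1] by simp
    then show ?thesis
      by (rule has_derivative_eq_rhs[OF has_derivative_compose[OF q h] ext])
  qed
  have c: "Ck_on k S (\<lambda>x. frechet_derivative q (at x) v * ?h' (q x))" for v
  proof (rule Ck_on_mult[OF S])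
    show "Ck_on k S (\<lambda>x. frechet_derivative q (at x) v)" using Suc.prems by simp
    show "Ck_on k S (\<lambda>x. ?h' (q x))"
      using Suc.IH[of ?h'] Suc.prems(1) Ck_on_Suc_D[OF Suc.prems(2)] by simp
  qed
  have "Ck_on k S (\<lambda>x. frechet_derivative (\<lambda>x. h (q x)) (at x) v)" for v
    by (rule Ck_on_cong[OF S c[of v]]) (simp add: frechet_derivative_eqI[OF der])
  then show ?case using der by (auto simp: differentiable_def)
qed

text \<open>A function of one variable is usually known through its derivative; this turns such knowledge
  into the recursive form of \<^const>\<open>Ck_on\<close>, and the smoothness of \<open>exp\<close>, \<open>ln\<close>, powers and the flat
  function is obtained from it by induction.\<close>

lemma Ck_on_real_derivI:
  fixes h :: "real \<Rightarrow> real"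
  assumes "open S" "\<And>t. t \<in> S \<Longrightarrow> (h has_real_derivative h' t) (at t)" "Ck_on k S h'"
  shows "Ck_on (Suc k) S h"
proof -
  have der: "(h has_derivative (\<lambda>v. v * h' t)) (at t)" if "t \<in> S" for t
    using assms(2)[OF that] by (simp add: has_field_derivative_def mult_commute_abs)
  have "Ck_on k S (\<lambda>t. frechet_derivative h (at t) v)" for v
    by (rule Ck_on_cong[OF assms(1) Ck_on_mult[OF assms(1) Ck_on_const[of _ _ v] assms(3)]])
      (simp add: frechet_derivative_eqI[OF der])
  then show ?thesis using der by (auto simp: differentiable_def)
qed

lemma Ck_on_exp: "Ck_on k UNIV (exp :: real \<Rightarrow> real)"
proof (induction k)
  case (Suc k)
  show ?case by (rule Ck_on_real_derivI[OF _ _ Suc]) (auto intro: DERIV_exp)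
qed (auto intro!: continuous_intros)

lemma Ck_on_powr: "Ck_on k {0<..} (\<lambda>t::real. t powr a)"
proof (induction k arbitrary: a)
  case 0
  then show ?case by (auto intro!: continuous_intros)
next
  case (Suc k)
  show ?case
    by (rule Ck_on_real_derivI[where h' = "\<lambda>t. a * t powr (a - 1)"])
      (auto intro!: Ck_on_mult Suc derivative_eq_intros)
qed

lemma Ck_on_ln: "Ck_on k {0<..} (ln :: real \<Rightarrow> real)"
proof (cases k)
  case 0
  then show ?thesis by (auto intro!: continuous_intros)
next
  case (Suc j)
  have "Ck_on (Suc j) {0<..} (ln :: real \<Rightarrow> real)"
    by (rule Ck_on_real_derivI[OF _ _ Ck_on_powr[of _ "-1"]])
      (auto intro!: derivative_eq_intros simp: powr_minus divide_simps)
  then show ?thesis using Suc by simp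
qed

text \<open>The weights are singular on the centre \<open>x' = 0\<close>, so all functions below are first handled
  away from it; the support condition then makes them smooth everywhere, because \<open>S\<close> and the
  complement of \<open>K\<close> cover the space.\<close>

lemma Ck_on_zero_extend:
  assumes "open S" "closed K" "K \<subseteq> S" "Ck_on k S f" "\<And>x. x \<notin> K \<Longrightarrow> f x = 0"
  shows "Ck_on k UNIV f"
proof -
  have "open (- K)" using assms(2) by auto
  have "Ck_on k (- K) f"
    by (rule Ck_on_cong[OF \<open>open (- K)\<close> Ck_on_const[of _ _ 0]]) (use assms in auto)
  moreover have "S \<union> - K = UNIV" using assms(3) by auto
  ultimately show ?thesis using Ck_on_Un[OF assms(1) \<open>open (- K)\<close> assms(4)] by simp
qed

section \<open>Differentiation along a vector field\<close>

lemma apply_field_eqI: "(f has_derivative f') (at x) \<Longrightarrow> apply_field V f x = f' (V x)"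
  by (simp add: apply_field_def frechet_derivative_eqI)

lemma apply_field_cong:
  assumes "open S" "x \<in> S" "\<And>y. y \<in> S \<Longrightarrow> f y = g y" "f differentiable at x"
  shows "apply_field V f x = apply_field V g x"
  unfolding apply_field_def using frechet_derivative_transform_within_open[OF assms(4,1,2)] assms(3) by metis

lemma apply_field_zero:
  assumes "open S" "x \<in> S" "\<And>y. y \<in> S \<Longrightarrow> f y = 0"
  shows "apply_field V f x = 0"
  using apply_field_cong[OF assms(1,2), of "\<lambda>_. 0" f V] assms(3) by (simp add: apply_field_def)

lemma apply_field_const [simp]: "apply_field V (\<lambda>_. c) x = 0"
  by (simp add: apply_field_def)

lemma apply_field_bilinear:
  assumes "bounded_bilinear B" "f differentiable at x" "g differentiable at x"
  shows "apply_field V (\<lambda>x. B (f x) (g x)) x = B (f x) (apply_field V g x) + B (apply_field V f x) (g x)"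
  using bounded_bilinear.FDERIV[OF assms(1)] assms(2,3)
  by (subst apply_field_eqI) (auto simp: apply_field_def frechet_derivative_works)

lemmas apply_field_mult = apply_field_bilinear[OF bounded_bilinear_mult]
lemmas apply_field_scaleR = apply_field_bilinear[OF bounded_bilinear_scaleR]
lemmas apply_field_inner = apply_field_bilinear[OF bounded_bilinear_inner]

lemma apply_field_add:
  assumes "f differentiable at x" "g differentiable at x"
  shows "apply_field V (\<lambda>x. f x + g x) x = apply_field V f x + apply_field V g x"
  using assms by (subst apply_field_eqI[OF has_derivative_add])
    (auto simp: apply_field_def frechet_derivative_works)

lemma apply_field_linear_image:
  assumes "bounded_linear L" "f differentiable at x"
  shows "apply_field V (\<lambda>x. L (f x)) x = L (apply_field V f x)"
  using assms by (subst apply_field_eqI[OF bounded_linear.has_derivative[OF assms(1)]])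
    (auto simp: apply_field_def frechet_derivative_works)

lemma apply_field_bounded_linear: "bounded_linear L \<Longrightarrow> apply_field V L x = L (V x)"
  by (rule apply_field_eqI) (rule bounded_linear_imp_has_derivative)

lemma apply_field_minus:
  "f differentiable at x \<Longrightarrow> apply_field V (\<lambda>x. - f x) x = - apply_field V f x"
  by (rule apply_field_linear_image[OF bounded_linear_minus[OF bounded_linear_ident]])

lemma apply_field_diff:
  "f differentiable at x \<Longrightarrow> g differentiable at x \<Longrightarrow>
    apply_field V (\<lambda>x. f x - g x) x = apply_field V f x - apply_field V g x"
  using apply_field_add[of f x "\<lambda>x. - g x"] by (simp add: apply_field_minus differentiable_minus)

lemma apply_field_sum:
  assumes "\<And>i. i \<in> I \<Longrightarrow> f i differentiable at x"
  shows "apply_field V (\<lambda>x. \<Sum>i\<in>I. f i x) x = (\<Sum>i\<in>I. apply_field V (f i) x)"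
  using assms
  by (subst apply_field_eqI[OF has_derivative_sum]) (auto simp: apply_field_def frechet_derivative_works)

lemma apply_field_compose_real:
  fixes h :: "real \<Rightarrow> real"
  assumes "q differentiable at x" "(h has_real_derivative h') (at (q x))"
  shows "apply_field V (\<lambda>x. h (q x)) x = h' * apply_field V q x"
proof -
  have "(q has_derivative frechet_derivative q (at x)) (at x)"
    using assms(1) by (simp flip: frechet_derivative_works)
  from has_derivative_compose[OF this assms(2)[unfolded has_field_derivative_def]]
  show ?thesis by (simp add: apply_field_eqI) (simp add: apply_field_def)
qed

lemma differentiable_compose_real:
  fixes h :: "real \<Rightarrow> real"
  assumes "q differentiable at x" "(h has_real_derivative h') (at (q x))"
  shows "(\<lambda>x. h (q x)) differentiable at x"
  using assms by (metis differentiable_compose field_differentiable_def field_differentiable_imp_differentiable)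

lemma apply_field_Basis:
  fixes f :: "'a::euclidean_space \<Rightarrow> 'b::real_normed_vector"
  assumes "f differentiable at x"
  shows "apply_field V f x = (\<Sum>i\<in>Basis. (V x \<bullet> i) *\<^sub>R frechet_derivative f (at x) i)"
proof -
  have lin: "linear (frechet_derivative f (at x))"
    using assms by (simp add: linear_frechet_derivative)
  show ?thesis unfolding apply_field_def
    by (subst euclidean_representation[of "V x", symmetric])
      (simp add: linear_sum[OF lin] linear_scale[OF lin])
qed

text \<open>Expanding in a basis reduces a variable direction to finitely many constant ones.\<close>

lemma Ck_on_apply_field:
  fixes f :: "'a::euclidean_space \<Rightarrow> 'b::real_normed_vector"
  assumes S: "open S" and "Ck_on (Suc k) S f" "Ck_on k S V"
  shows "Ck_on k S (apply_field V f)"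
proof -
  have "Ck_on k S (\<lambda>x. \<Sum>i\<in>Basis. (V x \<bullet> i) *\<^sub>R frechet_derivative f (at x) i)"
    using assms by (intro Ck_on_sum Ck_on_scaleR Ck_on_inner) auto
  then show ?thesis
    by (rule Ck_on_cong[OF S]) (use assms(2) apply_field_Basis[of f _ V] in auto)
qed

section \<open>Horizontal vector fields\<close>

text \<open>The facts on the fields from which the inequalities are derived. The second assumption says that the
  fields differentiate functions of \<open>x'\<close> like the coordinate derivatives of \<open>\<real>\<^sup>N\<close>. The third is a
  strong form of vanishing divergence: every summand of the divergence is zero.\<close>

locale horizontal_frame =
  fixes wt :: "'n::finite \<Rightarrow> nat" and X :: "'n \<Rightarrow> real^'n \<Rightarrow> real^'n"
  assumes Ck_on_X: "wt j = 1 \<Longrightarrow> Ck_on k UNIV (X j)"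
    and X_first_stratum: "wt j = 1 \<Longrightarrow> wt i = 1 \<Longrightarrow> X j x $ i = (if i = j then 1 else 0)"
    and X_divergence: "wt j = 1 \<Longrightarrow> frechet_derivative (\<lambda>x. X j x $ i) (at x) (axis i 1) = 0"

lemma bounded_linear_dilation: "bounded_linear (dilation wt l)"
  unfolding linear_conv_bounded_linear[symmetric]
  by (rule linearI) (auto simp: dilation_def vec_eq_iff algebra_simps)

lemma tendsto_dilation_zero:
  assumes "\<And>i. wt i \<ge> 1"
  shows "((\<lambda>l. dilation wt l x) \<longlongrightarrow> 0) (at_right 0)"
proof (rule vec_tendstoI)
  fix i
  have "((\<lambda>l::real. l ^ wt i * x $ i) \<longlongrightarrow> 0 ^ wt i * x $ i) (at_right 0)"
    by (intro tendsto_intros)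
  with assms[of i] show "((\<lambda>l. dilation wt l x $ i) \<longlongrightarrow> 0 $ i) (at_right 0)"
    by (simp add: dilation_def zero_power)
qed

context stratified_group
begin

abbreviation mult_map :: "(real^'n) \<times> (real^'n) \<Rightarrow> real^'n" where
  "mult_map \<equiv> (\<lambda>(x, y). x \<otimes>\<^bsub>G\<^esub> y)"

lemma Ck_on_mult_map: "Ck_on k UNIV mult_map"
  using smooth_mult by (simp add: smooth_on_def)

lemma mult_map_has_derivative:
  "(mult_map has_derivative frechet_derivative mult_map (at p)) (at p)"
  using Ck_on_mult_map[of 1] by (cases p) (simp flip: frechet_derivative_works)

lemma left_translation_has_derivative:
  "((\<lambda>y. x \<otimes>\<^bsub>G\<^esub> y) has_derivative (\<lambda>v. frechet_derivative mult_map (at (x, y)) (0, v))) (at y)"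
proof -
  have "((\<lambda>y. (x, y)) has_derivative (\<lambda>v. (0, v))) (at y)"
    by (intro has_derivative_Pair has_derivative_const has_derivative_ident)
  from has_derivative_compose[OF this mult_map_has_derivative] show ?thesis by simp
qed

text \<open>Left invariance at the neutral element expresses the field through the group law, hence it is as
  smooth as the multiplication.\<close>

lemma X_eq:
  assumes "wt k = 1"
  shows "X k x = frechet_derivative mult_map (at (x, 0)) (0, axis k 1)"
proof -
  interpret group G by (rule group)
  have "frechet_derivative (\<lambda>y. x \<otimes>\<^bsub>G\<^esub> y) (at 0) (X k 0) = X k (x \<otimes>\<^bsub>G\<^esub> 0)"
    using left_invariant_X[OF assms] unfolding left_invariant_def by blast
  moreover have "x \<otimes>\<^bsub>G\<^esub> 0 = x"
    using r_one[of x] by (simp add: carrier one_eq_zero)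
  ultimately show ?thesis
    by (simp add: X_zero[OF assms] frechet_derivative_eqI[OF left_translation_has_derivative])
qed

lemma Ck_on_frame: "wt j = 1 \<Longrightarrow> Ck_on k UNIV (X j)"
proof -
  assume j: "wt j = 1"
  have "Ck_on k UNIV (\<lambda>p. frechet_derivative mult_map (at p) (0, axis j 1))"
    using Ck_on_mult_map[of "Suc k"] by simp
  from Ck_on_precompose_linear[OF bounded_linear_Pair[OF bounded_linear_ident bounded_linear_zero] this]
  have "Ck_on k UNIV (\<lambda>x. frechet_derivative mult_map (at (x, 0)) (0, axis j 1))" .
  then show ?thesis
    by (rule Ck_on_cong[OF open_UNIV]) (simp add: X_eq[OF j])
qed

text \<open>Both sides are the derivative at the neutral element of \<open>y \<mapsto> \<delta>\<^sub>l (x \<circ> y) = \<delta>\<^sub>l x \<circ> \<delta>\<^sub>l y\<close> in a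
  direction of the first stratum, on which the dilation is multiplication by \<open>l\<close>.\<close>

lemma dilation_X:
  assumes "wt k = 1" "l > 0"
  shows "dilation wt l (X k x) = l *\<^sub>R X k (dilation wt l x)"
proof -
  let ?D = "dilation wt l"
  have hom: "?D (x \<otimes>\<^bsub>G\<^esub> y) = ?D x \<otimes>\<^bsub>G\<^esub> ?D y" for y
    using dilation_iso[OF assms(2)] by (auto simp: iso_def hom_def carrier)
  have D0: "?D 0 = 0" by (simp add: dilation_def vec_eq_iff)
  have De: "?D (axis k 1) = l *\<^sub>R axis k 1"
    using assms(1) by (auto simp: dilation_def vec_eq_iff axis_def)
  have D: "(?D has_derivative ?D) F" for F
    by (rule bounded_linear_imp_has_derivative[OF bounded_linear_dilation])
  have "((\<lambda>y. ?D (x \<otimes>\<^bsub>G\<^esub> y)) has_derivative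
      (\<lambda>v. ?D (frechet_derivative mult_map (at (x, 0)) (0, v)))) (at 0)"
    by (rule has_derivative_compose[OF left_translation_has_derivative D])
  moreover have "((\<lambda>y. ?D (x \<otimes>\<^bsub>G\<^esub> y)) has_derivative
      (\<lambda>v. frechet_derivative mult_map (at (?D x, 0)) (0, ?D v))) (at 0)"
    unfolding hom
    using has_derivative_compose[OF D left_translation_has_derivative[of "?D x" "?D 0"]]
    by (simp add: D0)
  ultimately have "?D (frechet_derivative mult_map (at (x, 0)) (0, axis k 1)) =
      frechet_derivative mult_map (at (?D x, 0)) (0, ?D (axis k 1))"
    using has_derivative_unique by metis
  also have "(0, ?D (axis k 1)) = l *\<^sub>R (0, axis k 1)" by (simp add: De)
  also have "frechet_derivative mult_map (at (?D x, 0)) (l *\<^sub>R (0, axis k 1)) =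
      l *\<^sub>R frechet_derivative mult_map (at (?D x, 0)) (0, axis k 1)"
    by (rule linear_scale[OF has_derivative_linear[OF mult_map_has_derivative]])
  finally show ?thesis by (simp add: X_eq[OF assms(1)])
qed

lemma X_homogeneous:
  assumes "wt k = 1" "l > 0"
  shows "l * X k (dilation wt l x) $ i = l ^ wt i * X k x $ i"
  using arg_cong[OF dilation_X[OF assms], of "\<lambda>v. v $ i" x] by (simp add: dilation_def)

text \<open>For \<open>wt i = 1\<close> the component is homogeneous of degree \<open>0\<close>; being continuous at the origin, it is
  constant.\<close>

lemma X_first_stratum_component:
  assumes "wt k = 1" "wt i = 1"
  shows "X k x $ i = (if i = k then 1 else 0)"
proof -
  have "isCont (X k) 0"
    using Ck_on_continuous[OF Ck_on_frame[OF assms(1), of 0]] by (simp add: continuous_on_eq_continuous_at)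
  from isCont_tendsto_compose[OF this tendsto_dilation_zero[of wt x, OF wt_pos]]
  have "((\<lambda>l. X k (dilation wt l x) $ i) \<longlongrightarrow> X k 0 $ i) (at_right 0)"
    by (rule tendsto_vec_nth)
  moreover have "\<forall>\<^sub>F l in at_right 0. X k (dilation wt l x) $ i = X k x $ i"
    using eventually_at_right_less[of "0::real"]
    by eventually_elim (use X_homogeneous[OF assms(1), of _ x i] assms(2) in auto)
  ultimately have "((\<lambda>l::real. X k x $ i) \<longlongrightarrow> X k 0 $ i) (at_right 0)"
    by (rule Lim_transform_eventually)
  then have "X k x $ i = X k 0 $ i"
    by (simp add: tendsto_const_iff)
  then show ?thesis by (auto simp: X_zero[OF assms(1)] axis_def)
qed

text \<open>The \<open>i\<close>-th component has degree \<open>wt i - 1\<close>, so its derivative in the \<open>i\<close>-th direction would be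
  homogeneous of degree \<open>-1\<close>; a function of negative degree that is continuous at the origin
  vanishes.\<close>

lemma X_divergence_component:
  assumes "wt k = 1"
  shows "frechet_derivative (\<lambda>x. X k x $ i) (at x) (axis i 1) = 0"
proof -
  let ?f = "\<lambda>x. X k x $ i"
  let ?d = "\<lambda>x. frechet_derivative ?f (at x) (axis i 1)"
  have C1: "Ck_on 1 UNIV ?f"
    by (rule Ck_on_linear_image[OF bounded_linear_vec_nth open_UNIV Ck_on_frame[OF assms]])
  then have der: "(?f has_derivative frechet_derivative ?f (at x)) (at x)" for x
    by (auto simp flip: frechet_derivative_works)
  have scale: "l * ?d (dilation wt l x) = ?d x" if "l > 0" for l
  proof -
    let ?D = "dilation wt l"
    have De: "?D (axis i 1) = l ^ wt i *\<^sub>R axis i 1"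
      by (auto simp: dilation_def vec_eq_iff axis_def)
    have "((\<lambda>x. l * ?f (?D x)) has_derivative (\<lambda>v. l * frechet_derivative ?f (at (?D x)) (?D v))) (at x)"
      by (intro has_derivative_mult_right has_derivative_compose[OF
            bounded_linear_imp_has_derivative[OF bounded_linear_dilation] der])
    moreover have "((\<lambda>x. l * ?f (?D x)) has_derivative (\<lambda>v. l ^ wt i * frechet_derivative ?f (at x) v)) (at x)"
      unfolding X_homogeneous[OF assms that] by (intro has_derivative_mult_right der)
    ultimately have "l * frechet_derivative ?f (at (?D x)) (?D (axis i 1)) = l ^ wt i * ?d x"
      using has_derivative_unique by metis
    moreover have "frechet_derivative ?f (at (?D x)) (?D (axis i 1)) = l ^ wt i * ?d (?D x)"
      unfolding De using linear_scale[OF has_derivative_linear[OF der]] by simp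
    ultimately show ?thesis using that by simp
  qed
  have "continuous_on UNIV ?d" using C1 by simp
  then have "isCont ?d 0" by (simp add: continuous_on_eq_continuous_at)
  from isCont_tendsto_compose[OF this tendsto_dilation_zero[of wt x, OF wt_pos]]
  have "((\<lambda>l. l * ?d (dilation wt l x)) \<longlongrightarrow> 0 * ?d 0) (at_right 0)"
    by (intro tendsto_mult tendsto_ident_at)
  moreover have "\<forall>\<^sub>F l in at_right 0. l * ?d (dilation wt l x) = ?d x"
    using eventually_at_right_less[of "0::real"] by eventually_elim (rule scale)
  ultimately have "((\<lambda>l::real. ?d x) \<longlongrightarrow> 0 * ?d 0) (at_right 0)"
    by (rule Lim_transform_eventually)
  then show ?thesis by (simp add: tendsto_const_iff)
qed

lemma horizontal_frame: "horizontal_frame wt X"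
  by unfold_locales (auto simp: X_first_stratum_component X_divergence_component
      intro: Ck_on_frame simp del: Ck_on.simps)

end

section \<open>Integration by parts\<close>

lemma integrable_compact_support:
  fixes f :: "'a::euclidean_space \<Rightarrow> 'b::{banach, second_countable_topology}"
  assumes "continuous_on UNIV f" "compact K" "\<And>x. x \<notin> K \<Longrightarrow> f x = 0"
  shows "integrable lborel f"
proof -
  have "(\<lambda>x. indicator K x *\<^sub>R f x) = f"
    using assms(3) by (auto simp: indicator_def)
  with borel_integrable_compact[OF assms(2) continuous_on_subset[OF assms(1)]] show ?thesis by simp
qed

lemma lborel_integral_translate:
  fixes f :: "'a::euclidean_space \<Rightarrow> 'b::{banach, second_countable_topology}"
  assumes [measurable]: "f \<in> borel_measurable borel"
  shows "(LINT x|lborel. f (c + x)) = (LINT x|lborel. f x)"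
proof -
  have "(LINT x|lborel. f (c + x)) = (LINT x|distr lborel borel ((+) c). f x)"
    by (subst integral_distr) auto
  then show ?thesis by (simp add: lborel_distr_plus)
qed

text \<open>The difference quotients have integral \<open>0\<close> by translation invariance of Lebesgue measure, and they
  converge dominatedly because the derivative is bounded with compact support.\<close>

lemma integral_directional_derivative:
  fixes f :: "'a::euclidean_space \<Rightarrow> real"
  assumes C1: "Ck_on 1 UNIV f" and K: "compact K" "\<And>x. x \<notin> K \<Longrightarrow> f x = 0"
  shows "(LINT x|lborel. frechet_derivative f (at x) v) = 0"
proof -
  let ?D = "\<lambda>x. frechet_derivative f (at x) v"
  have der: "(f has_derivative frechet_derivative f (at x)) (at x)" for x
    using C1 by (auto simp flip: frechet_derivative_works)
  have contf: "continuous_on UNIV f" by (rule Ck_on_continuous[OF C1])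
  have contD: "continuous_on UNIV ?D" using C1 by simp
  have [measurable]: "f \<in> borel_measurable borel" "?D \<in> borel_measurable borel"
    using contf contD by (auto intro: borel_measurable_continuous_onI)
  have D0: "?D x = 0" if "x \<notin> K" for x
    using apply_field_zero[of "- K" x f "\<lambda>_. v"] K that compact_imp_closed[OF K(1)]
    by (auto simp: apply_field_def)
  obtain L where L: "\<And>x. \<bar>?D x\<bar> \<le> L" "L \<ge> 0"
  proof -
    have "bounded (?D ` K)"
      by (intro compact_imp_bounded compact_continuous_image continuous_on_subset[OF contD] K) auto
    then obtain B where "\<forall>y\<in>?D ` K. norm y \<le> B" by (auto simp: bounded_iff)
    then have "\<bar>?D x\<bar> \<le> max B 0" for x using D0[of x] by (cases "x \<in> K") auto
    then show ?thesis by (intro that[of "max B 0"]) auto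
  qed
  obtain R where R: "\<And>x. x \<in> K \<Longrightarrow> norm x \<le> R"
    using compact_imp_bounded[OF K(1)] by (auto simp: bounded_iff)
  define t where "t n = 1 / real (Suc n)" for n
  have t: "0 < t n" "t n \<le> 1" for n by (auto simp: t_def)
  define s where "s n x = (f (t n *\<^sub>R v + x) - f x) / t n" for n x
  have ray: "((\<lambda>r. f (r *\<^sub>R v + x)) has_real_derivative ?D (r *\<^sub>R v + x)) (at r)" for r x
  proof -
    have "((\<lambda>r. r *\<^sub>R v + x) has_derivative (\<lambda>h. h *\<^sub>R v)) (at r)"
      by (auto intro!: derivative_eq_intros)
    from has_derivative_compose[OF this der] show ?thesis
      by (simp add: has_field_derivative_def linear_scale[OF has_derivative_linear[OF der]] mult_commute_abs)
  qed
  have bound: "\<bar>s n x\<bar> \<le> L" for n x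
  proof -
    obtain z where "f (t n *\<^sub>R v + x) - f (0 *\<^sub>R v + x) = (t n - 0) * ?D (z *\<^sub>R v + x)"
      using MVT2[OF t(1)[of n], of "\<lambda>r. f (r *\<^sub>R v + x)" "\<lambda>r. ?D (r *\<^sub>R v + x)"] ray by blast
    then have "s n x = ?D (z *\<^sub>R v + x)" using t(1)[of n] by (simp add: s_def)
    then show ?thesis using L by simp
  qed
  have "(\<lambda>n. LINT x|lborel. s n x) \<longlonglongrightarrow> (LINT x|lborel. ?D x)"
  proof (rule integral_dominated_convergence)
    show "integrable lborel (\<lambda>x::'a. L * indicator (cball 0 (R + norm v)) x)"
      using emeasure_bounded_finite[OF bounded_cball, of "0::'a" "R + norm v"]
      by (intro integrable_mult_right integrable_real_indicator) auto
    show "s n \<in> borel_measurable lborel" for n unfolding s_def by measurable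
    have lim: "(\<lambda>n. s n x) \<longlonglongrightarrow> ?D x" for x
    proof -
      have "((\<lambda>h. (f (h *\<^sub>R v + x) - f x) / h) \<longlongrightarrow> ?D x) (at 0)"
        using ray[where r = 0 and x = x] by (simp add: DERIV_def)
      moreover have "filterlim t (at 0) sequentially"
        unfolding filterlim_at using LIMSEQ_inverse_real_of_nat
        by (auto simp: t_def[abs_def] inverse_eq_divide)
      ultimately show ?thesis
        unfolding s_def by (rule filterlim_compose)
    qed
    then show "AE x in lborel. (\<lambda>n. s n x) \<longlonglongrightarrow> ?D x" by simp
    have "s n x = 0" if "x \<notin> cball 0 (R + norm v)" for n x
    proof -
      have "x \<notin> K"
      proof
        assume "x \<in> K"
        from R[OF this] that show False using norm_ge_zero[of v] by simp
      qed
      moreover have "t n *\<^sub>R v + x \<notin> K"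
      proof
        assume "t n *\<^sub>R v + x \<in> K"
        then have "norm (t n *\<^sub>R v + x) \<le> R" by (rule R)
        moreover have "norm x \<le> norm (t n *\<^sub>R v + x) + norm (t n *\<^sub>R v)"
          using norm_triangle_ineq4[of "t n *\<^sub>R v + x" "t n *\<^sub>R v"] by simp
        moreover have "norm (t n *\<^sub>R v) \<le> norm v"
          using t[of n] by (simp add: mult_left_le_one_le)
        ultimately show False using that by simp
      qed
      ultimately show ?thesis by (simp add: s_def K(2))
    qed
    then have "norm (s n x) \<le> L * indicator (cball 0 (R + norm v)) x" for n x
      using bound[of n x] by (cases "x \<in> cball 0 (R + norm v)") auto
    then show "AE x in lborel. norm (s n x) \<le> L * indicator (cball 0 (R + norm v)) x" for n by simp
  qed simp
  moreover have "(LINT x|lborel. s n x) = 0" for n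
  proof -
    have int: "integrable lborel f" by (rule integrable_compact_support[OF contf K])
    have "integrable lborel (\<lambda>x. f (t n *\<^sub>R v + x))"
    proof (rule integrable_compact_support)
      show "continuous_on UNIV (\<lambda>x. f (t n *\<^sub>R v + x))"
        by (rule continuous_on_compose2[OF contf]) (auto intro!: continuous_intros)
      show "compact ((+) (- (t n *\<^sub>R v)) ` K)" by (rule compact_translation[OF K(1)])
      show "f (t n *\<^sub>R v + x) = 0" if "x \<notin> (+) (- (t n *\<^sub>R v)) ` K" for x
      proof (rule K(2), rule notI)
        assume "t n *\<^sub>R v + x \<in> K"
        then have "- (t n *\<^sub>R v) + (t n *\<^sub>R v + x) \<in> (+) (- (t n *\<^sub>R v)) ` K" by (rule imageI)
        with that show False by simp
      qed
    qed
    then show ?thesis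
      using int by (simp add: s_def Bochner_Integration.integral_diff lborel_integral_translate)
  qed
  ultimately show ?thesis by (simp add: LIMSEQ_const_iff)
qed

text \<open>Since each component of the field is constant along its own coordinate, the field can be moved
  inside the coordinate derivatives, and each of these integrates to \<open>0\<close>.\<close>

lemma (in horizontal_frame) integral_X:
  fixes f :: "real^'n \<Rightarrow> real"
  assumes j: "wt j = 1" and S: "open S" "compact K" "K \<subseteq> S"
    and f: "Ck_on 1 S f" "\<And>x. x \<notin> K \<Longrightarrow> f x = 0"
  shows "integrable lborel (apply_field (X j) f)" "(LINT x|lborel. apply_field (X j) f x) = 0"
proof -
  have C1: "Ck_on 1 UNIV f"
    by (rule Ck_on_zero_extend[OF S(1) compact_imp_closed[OF S(2)] S(3) f])
  have diff: "f differentiable at x" for x using C1 by simp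
  define u where "u i x = X j x $ i * f x" for i x
  have CX: "Ck_on 1 UNIV (\<lambda>x. X j x $ i)" for i
    by (rule Ck_on_linear_image[OF bounded_linear_vec_nth open_UNIV Ck_on_X[OF j]])
  have u: "Ck_on 1 UNIV (u i)" "\<And>x. x \<notin> K \<Longrightarrow> u i x = 0" for i
    using Ck_on_mult[OF open_UNIV CX[of i] C1] f(2) by (auto simp: u_def[abs_def] simp del: Ck_on.simps One_nat_def)
  have eq: "apply_field (X j) f x = (\<Sum>i\<in>UNIV. frechet_derivative (u i) (at x) (axis i 1))" for x
  proof -
    have "frechet_derivative (u i) (at x) (axis i 1) = X j x $ i * frechet_derivative f (at x) (axis i 1)" for i
    proof -
      have "(\<lambda>x. X j x $ i) differentiable at x" using CX by simp
      from apply_field_mult[OF this diff, of "\<lambda>_. axis i 1"] X_divergence[OF j]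
      show ?thesis by (simp add: apply_field_def u_def[abs_def])
    qed
    moreover have "apply_field (X j) f x = (\<Sum>i\<in>UNIV. X j x $ i * frechet_derivative f (at x) (axis i 1))"
    proof -
      have lin: "linear (frechet_derivative f (at x))" by (rule linear_frechet_derivative[OF diff])
      have "X j x = (\<Sum>i\<in>UNIV. X j x $ i *\<^sub>R axis i 1)"
        by (simp add: vec_eq_iff axis_def if_distrib cong: if_cong)
      then have "apply_field (X j) f x = frechet_derivative f (at x) (\<Sum>i\<in>UNIV. X j x $ i *\<^sub>R axis i 1)"
        unfolding apply_field_def by (rule arg_cong)
      then show ?thesis by (simp add: linear_sum[OF lin] linear_scale[OF lin])
    qed
    ultimately show ?thesis by simp
  qed
  have int: "integrable lborel (\<lambda>x. frechet_derivative (u i) (at x) (axis i 1))" for i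
  proof (rule integrable_compact_support[OF _ S(2)])
    show "continuous_on UNIV (\<lambda>x. frechet_derivative (u i) (at x) (axis i 1))" using u(1)[of i] by simp
    show "frechet_derivative (u i) (at x) (axis i 1) = 0" if "x \<notin> K" for x
      using apply_field_zero[of "- K" x "u i" "\<lambda>_. axis i 1"] u(2) that compact_imp_closed[OF S(2)]
      by (auto simp: apply_field_def)
  qed
  show "integrable lborel (apply_field (X j) f)"
    unfolding eq using int by (intro Bochner_Integration.integrable_sum) auto
  show "(LINT x|lborel. apply_field (X j) f x) = 0"
    unfolding eq using int integral_directional_derivative[OF u(1) S(2) u(2)]
    by (subst Bochner_Integration.integral_sum) auto
qed

section \<open>Weighted Hardy and Rellich inequalities\<close>

lemma norm_add_scaleR_power2:
  fixes u v :: "'a::real_inner"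
  shows "(norm (u + t *\<^sub>R v))\<^sup>2 = u \<bullet> u + 2 * t * (u \<bullet> v) + t\<^sup>2 * (v \<bullet> v)"
  unfolding power2_norm_eq_inner
  by (simp add: inner_add_left inner_add_right inner_commute power2_eq_square algebra_simps)

lemma apply_field_linear_comb:
  fixes p q :: "'a::real_normed_vector \<Rightarrow> real"
  assumes "p differentiable at x" "q differentiable at x"
  shows "apply_field V (\<lambda>x. a * p x + b * q x) x = a * apply_field V p x + b * apply_field V q x"
  using assms by (simp add: apply_field_add apply_field_mult differentiable_mult)

context horizontal_frame
begin

text \<open>The weights are written as powers of \<open>rho\<close>, the square of \<open>|x'|\<close>, because this is a polynomial.\<close>

definition rho :: "real^'n \<Rightarrow> real" where
  "rho x = (\<Sum>j | wt j = 1. (x $ j)\<^sup>2)"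

definition punctured :: "(real^'n) set" where
  "punctured = {x. rho x > 0}"

definition hdim :: real where
  "hdim = real (card {j. wt j = 1})"

definition sublap :: "(real^'n \<Rightarrow> 'b::real_normed_vector) \<Rightarrow> real^'n \<Rightarrow> 'b" where
  "sublap g x = - (\<Sum>j | wt j = 1. apply_field (X j) (apply_field (X j) g) x)"

lemma rho_nonneg: "rho x \<ge> 0"
  by (simp add: rho_def sum_nonneg)

lemma hnorm_eq: "hnorm wt x = sqrt (rho x)"
  by (simp add: hnorm_def L2_set_def rho_def)

lemma punctured_eq: "punctured = {x. hnorm wt x \<noteq> 0}"
  using rho_nonneg by (auto simp: punctured_def hnorm_eq less_le)

lemma Ck_on_nth: "open S \<Longrightarrow> Ck_on k S (\<lambda>x::real^'n. x $ j)"
  by (rule Ck_on_bounded_linear) (rule bounded_linear_vec_nth)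

lemma Ck_on_rho: "Ck_on k UNIV rho"
  unfolding rho_def[abs_def] by (intro Ck_on_sum Ck_on_power Ck_on_nth open_UNIV)

lemma open_punctured: "open punctured"
proof -
  have "continuous_on UNIV rho" using Ck_on_continuous[OF Ck_on_rho] .
  then show ?thesis unfolding punctured_def by (intro open_Collect_less) (auto intro: continuous_on_const)
qed

lemma Ck_on_rho_powr: "Ck_on k punctured (\<lambda>x. rho x powr s)"
  by (rule Ck_on_compose_real[OF open_punctured Ck_on_powr Ck_on_subset[OF Ck_on_rho]]) (auto simp: punctured_def)

lemma apply_field_nth: "apply_field V (\<lambda>x::real^'n. x $ j) x = V x $ j"
  by (rule apply_field_bounded_linear[OF bounded_linear_vec_nth])

lemma nth_differentiable: "(\<lambda>x::real^'n. x $ j) differentiable F"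
  by (rule bounded_linear_imp_differentiable[OF bounded_linear_vec_nth])

lemma apply_field_X_nth:
  "wt j = 1 \<Longrightarrow> wt i = 1 \<Longrightarrow> apply_field (X j) (\<lambda>x. x $ i) x = (if i = j then 1 else 0)"
  by (simp add: apply_field_nth X_first_stratum)

lemma rho_differentiable: "rho differentiable at x"
  using Ck_on_rho[of 1] by simp

lemma apply_field_X_rho: "wt j = 1 \<Longrightarrow> apply_field (X j) rho x = 2 * x $ j"
proof -
  assume j: "wt j = 1"
  have "apply_field (X j) (\<lambda>x. (x $ i)\<^sup>2) x = 2 * x $ i * (if i = j then 1 else 0)" if "wt i = 1" for i
  proof -
    have "((\<lambda>t. t\<^sup>2) has_real_derivative 2 * x $ i) (at (x $ i))"
      by (auto intro!: derivative_eq_intros)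
    from apply_field_compose_real[OF nth_differentiable this, of "X j"]
    show ?thesis by (simp only: apply_field_X_nth[OF j that])
  qed
  then have "apply_field (X j) rho x = (\<Sum>i | wt i = 1. 2 * x $ i * (if i = j then 1 else 0))"
    unfolding rho_def[abs_def] 
    by (subst apply_field_sum) (auto intro!: differentiable_power nth_differentiable)
  also have "\<dots> = 2 * x $ j"
    using j by (simp add: if_distrib sum.delta cong: if_cong)
  finally show ?thesis .
qed

lemma rho_powr_differentiable: "x \<in> punctured \<Longrightarrow> (\<lambda>x. rho x powr s) differentiable at x"
  using Ck_on_rho_powr[of 1] by simp

lemma apply_field_X_rho_powr:
  assumes "wt j = 1" "x \<in> punctured"
  shows "apply_field (X j) (\<lambda>x. rho x powr s) x = 2 * s * x $ j * rho x powr (s - 1)"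
proof -
  have "((\<lambda>t. t powr s) has_real_derivative s * rho x powr (s - 1)) (at (rho x))"
    using assms(2) by (auto simp: punctured_def intro!: derivative_eq_intros)
  from apply_field_compose_real[OF rho_differentiable this, of "X j"]
  show ?thesis by (simp add: apply_field_X_rho[OF assms(1)])
qed

text \<open>The vector field whose divergence is split off in the weighted Hardy inequality: the first part
  comes from integrating \<open>L g \<bullet> g\<close> by parts, the second is a multiple of \<open>x' |g|\<^sup>2\<close> and trades the
  mixed terms \<open>x\<^sub>j (X\<^sub>j g \<bullet> g)\<close> for multiples of \<open>|g|\<^sup>2\<close>.\<close>

definition hardy_flux :: "real \<Rightarrow> (real^'n \<Rightarrow> 'b::real_inner) \<Rightarrow> 'n \<Rightarrow> real^'n \<Rightarrow> real" where
  "hardy_flux s g j x = - (apply_field (X j) g x \<bullet> g x) * rho x powr (- s)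
     - (hdim - 2) / 2 * (x $ j * (g x \<bullet> g x) * rho x powr (- s - 1))"

lemma apply_field_hardy_flux:
  fixes g :: "real^'n \<Rightarrow> 'b::real_inner" and s :: real
  assumes j: "wt j = 1" and x: "x \<in> punctured"
    and g: "g differentiable at x" "apply_field (X j) g differentiable at x"
  defines "P \<equiv> rho x powr (- s - 1)"
  shows "apply_field (X j) (hardy_flux s g j) x =
     - (apply_field (X j) (apply_field (X j) g) x \<bullet> g x) * (rho x * P)
     - (apply_field (X j) g x \<bullet> apply_field (X j) g x) * (rho x * P)
     + 2 * s * x $ j * (apply_field (X j) g x \<bullet> g x) * P
     - (hdim - 2) / 2 * ((g x \<bullet> g x) * P + 2 * x $ j * (apply_field (X j) g x \<bullet> g x) * P
          - 2 * (s + 1) * (x $ j)\<^sup>2 * (g x \<bullet> g x) * (P / rho x))"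
proof -
  have r: "rho x > 0" using x by (simp add: punctured_def)
  have "- 2 - s = (- s - 1) - 1" "- s = (- s - 1) + 1" by simp_all
  then have P: "rho x powr (- s) = rho x * P" "rho x powr (- 2 - s) = P / rho x"
    using r powr_add[of "rho x" "- s - 1" 1] powr_diff[of "rho x" "- s - 1" 1]
    by (simp_all only: P_def powr_one mult.commute less_imp_le)
  note d = g rho_powr_differentiable[OF x] nth_differentiable
  have d2: "(\<lambda>x. apply_field (X j) g x \<bullet> g x) differentiable at x"
    "(\<lambda>x. g x \<bullet> g x) differentiable at x"
    using bounded_bilinear.FDERIV[OF bounded_bilinear_inner] g unfolding differentiable_def by blast+
  have gg: "apply_field (X j) (\<lambda>x. g x \<bullet> g x) x = 2 * (apply_field (X j) g x \<bullet> g x)"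
    by (subst apply_field_inner) (simp_all add: d inner_commute)
  have xg: "apply_field (X j) (\<lambda>x. x $ j * (g x \<bullet> g x)) x
      = x $ j * (2 * (apply_field (X j) g x \<bullet> g x)) + (g x \<bullet> g x)"
    by (subst apply_field_mult) (simp_all add: d d2 gg apply_field_X_nth[OF j j])
  have 1: "apply_field (X j) (\<lambda>x. (apply_field (X j) g x \<bullet> g x) * rho x powr (- s)) x =
      (apply_field (X j) g x \<bullet> g x) * (2 * (-s) * x $ j * P)
      + (apply_field (X j) g x \<bullet> apply_field (X j) g x + apply_field (X j) (apply_field (X j) g) x \<bullet> g x) * (rho x * P)"
    by (subst apply_field_mult)
      (simp_all add: d d2 apply_field_X_rho_powr[OF j x] apply_field_inner P P_def[symmetric])
  have 2: "apply_field (X j) (\<lambda>x. x $ j * (g x \<bullet> g x) * rho x powr (- s - 1)) x =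
      x $ j * (g x \<bullet> g x) * (2 * (- s - 1) * x $ j * (P / rho x))
      + (x $ j * (2 * (apply_field (X j) g x \<bullet> g x)) + (g x \<bullet> g x)) * P"
    by (subst apply_field_mult)
      (simp_all add: d d2 apply_field_X_rho_powr[OF j x] xg P P_def[symmetric] differentiable_mult)
  have eq: "hardy_flux s g j = (\<lambda>x. (-1) * ((apply_field (X j) g x \<bullet> g x) * rho x powr (- s))
      + (- ((hdim - 2) / 2)) * (x $ j * (g x \<bullet> g x) * rho x powr (- s - 1)))"
    by (simp add: hardy_flux_def[abs_def])
  have "apply_field (X j) (hardy_flux s g j) x =
      (-1) * apply_field (X j) (\<lambda>x. (apply_field (X j) g x \<bullet> g x) * rho x powr (- s)) x
      + (- ((hdim - 2) / 2)) * apply_field (X j) (\<lambda>x. x $ j * (g x \<bullet> g x) * rho x powr (- s - 1)) x"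
    unfolding eq
    by (rule apply_field_linear_comb[OF differentiable_mult[OF d2(1) d(3)]
          differentiable_mult[OF differentiable_mult[OF d(4) d2(2)] d(3)]])
  then show ?thesis unfolding 1 2 by (simp add: algebra_simps power2_eq_square)
qed

text \<open>With \<open>\<kappa> = (N - 2s - 2) / 2\<close> the difference of the two sides is
  \<open>rho powr (- s) * (\<Sum>j. |X\<^sub>j g + \<kappa> (x\<^sub>j / rho) g|\<^sup>2)\<close>. The square is the one that vanishes for
  \<open>g = |x'| powr (- \<kappa>)\<close>, and this choice of \<open>\<kappa>\<close> maximises the constant.\<close>

lemma hardy_pointwise:
  fixes g :: "real^'n \<Rightarrow> 'b::real_inner"
  assumes x: "x \<in> punctured"
    and g: "g differentiable at x" "\<And>j. wt j = 1 \<Longrightarrow> apply_field (X j) g differentiable at x"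
  shows "(sublap g x \<bullet> g x) * rho x powr (- s) \<ge>
    (\<Sum>j | wt j = 1. apply_field (X j) (hardy_flux s g j) x)
    + (hdim - 2 * s - 2) * (hdim + 2 * s - 2) / 4 * ((norm (g x))\<^sup>2 * rho x powr (- (s + 1)))"
proof -
  define P where "P = rho x powr (- s - 1)"
  define \<kappa> where "\<kappa> = (hdim - 2 * s - 2) / 2"
  define a where "a j = apply_field (X j) g x" for j
  define b where "b j = apply_field (X j) (apply_field (X j) g) x" for j
  let ?G = "g x \<bullet> g x"
  have r: "rho x > 0" using x by (simp add: punctured_def)
  have P: "rho x powr (- s) = rho x * P" "P > 0" "rho x powr (- (s + 1)) = P"
    using r powr_add[of "rho x" 1 "-s-1"] by (simp_all add: P_def)
  have pt: "- (b j \<bullet> g x) * (rho x * P) - apply_field (X j) (hardy_flux s g j) x \<ge>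
      (hdim - 2) / 2 * ?G * P - (\<kappa>\<^sup>2 + (hdim - 2) * (s + 1)) * (x $ j)\<^sup>2 * (?G * P / rho x)"
    if j: "wt j = 1" for j
  proof -
    have "0 \<le> rho x * P * (norm (a j + (\<kappa> * x $ j / rho x) *\<^sub>R g x))\<^sup>2"
      using r P by simp
    also have "\<dots> = rho x * P * (a j \<bullet> a j) + 2 * \<kappa> * x $ j * (a j \<bullet> g x) * P
        + \<kappa>\<^sup>2 * (x $ j)\<^sup>2 * (?G * P / rho x)"
    proof -
      have "(norm (a j + t *\<^sub>R g x))\<^sup>2 = a j \<bullet> a j + 2 * t * (a j \<bullet> g x) + t\<^sup>2 * ?G" for t
        by (rule norm_add_scaleR_power2)
      then show ?thesis using r by (simp add: field_simps power2_eq_square)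
    qed
    also have "\<dots> = - (b j \<bullet> g x) * (rho x * P) - apply_field (X j) (hardy_flux s g j) x
        - ((hdim - 2) / 2 * ?G * P - (\<kappa>\<^sup>2 + (hdim - 2) * (s + 1)) * (x $ j)\<^sup>2 * (?G * P / rho x))"
    proof -
      define Q where "Q = P / rho x"
      have Q: "?G * P / rho x = ?G * Q" by (simp add: Q_def)
      show ?thesis
        unfolding apply_field_hardy_flux[OF j x g(1) g(2)[OF j]] a_def[symmetric] b_def[symmetric]
          P_def[symmetric] Q_def[symmetric] Q \<kappa>_def
        by (simp add: field_simps power2_eq_square)
    qed
    finally show ?thesis by simp
  qed
  have "(\<Sum>j | wt j = 1. (hdim - 2) / 2 * ?G * P - (\<kappa>\<^sup>2 + (hdim - 2) * (s + 1)) * (x $ j)\<^sup>2 * (?G * P / rho x))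
     \<le> (\<Sum>j | wt j = 1. - (b j \<bullet> g x) * (rho x * P) - apply_field (X j) (hardy_flux s g j) x)"
    by (rule sum_mono) (use pt in auto)
  also have "\<dots> = (sublap g x \<bullet> g x) * rho x powr (- s) - (\<Sum>j | wt j = 1. apply_field (X j) (hardy_flux s g j) x)"
    by (simp add: sum_subtractf sublap_def b_def inner_sum_left P sum_distrib_right sum_negf)
  finally have "(\<Sum>j | wt j = 1. (hdim - 2) / 2 * ?G * P - (\<kappa>\<^sup>2 + (hdim - 2) * (s + 1)) * (x $ j)\<^sup>2 * (?G * P / rho x))
     \<le> (sublap g x \<bullet> g x) * rho x powr (- s) - (\<Sum>j | wt j = 1. apply_field (X j) (hardy_flux s g j) x)" .
  moreover have "(\<Sum>j | wt j = 1. (hdim - 2) / 2 * ?G * P - (\<kappa>\<^sup>2 + (hdim - 2) * (s + 1)) * (x $ j)\<^sup>2 * (?G * P / rho x))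
     = hdim * ((hdim - 2) / 2 * ?G * P) - (\<kappa>\<^sup>2 + (hdim - 2) * (s + 1)) * rho x * (?G * P / rho x)"
  proof -
    have "(\<Sum>j | wt j = 1. k - C * (x $ j)\<^sup>2 * W) = hdim * k - C * rho x * W" for k C W
      by (simp add: sum_subtractf hdim_def rho_def sum_distrib_left sum_distrib_right)
    then show ?thesis .
  qed
  moreover have "\<dots> = (hdim - 2 * s - 2) * (hdim + 2 * s - 2) / 4 * (?G * P)"
    using r by (simp add: \<kappa>_def field_simps power2_eq_square)
  ultimately show ?thesis unfolding P power2_norm_eq_inner by linarith
qed

lemma integrable_weighted:
  fixes f :: "real^'n \<Rightarrow> real"
  assumes "compact K" "K \<subseteq> punctured" "continuous_on punctured f" "\<And>x. x \<notin> K \<Longrightarrow> f x = 0"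
  shows "integrable lborel f"
proof -
  have "Ck_on 0 UNIV f"
    by (rule Ck_on_zero_extend[OF open_punctured compact_imp_closed[OF assms(1)] assms(2)]) (use assms in auto)
  then show ?thesis using integrable_compact_support[OF _ assms(1), of f] assms(4) by simp
qed

lemma sublap_eq_0:
  assumes "closed K" "\<And>x. x \<notin> K \<Longrightarrow> g x = 0" "x \<notin> K"
  shows "apply_field V g x = 0" "apply_field W (apply_field V g) x = 0" "sublap g x = 0"
proof -
  have 1: "apply_field V g x = 0" if "x \<notin> K" for x and V :: "real^'n \<Rightarrow> real^'n"
    using apply_field_zero[of "- K" x g] assms that by auto
  have 2: "apply_field W (apply_field V g) x = 0" if "x \<notin> K" for x and V W :: "real^'n \<Rightarrow> real^'n"
    using apply_field_zero[of "- K" x "apply_field V g" W] assms(1) that 1 by auto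
  show "apply_field V g x = 0" "apply_field W (apply_field V g) x = 0" "sublap g x = 0"
    using 1 2 assms(3) by (simp_all add: sublap_def)
qed

lemma Ck_on_X_apply: "wt j = 1 \<Longrightarrow> Ck_on (Suc k) UNIV g \<Longrightarrow> Ck_on k UNIV (apply_field (X j) g)"
  by (rule Ck_on_apply_field[OF open_UNIV _ Ck_on_X])

lemma Ck_on_sublap: "Ck_on (Suc (Suc k)) UNIV g \<Longrightarrow> Ck_on k UNIV (sublap g)"
  unfolding sublap_def[abs_def]
  by (intro Ck_on_minus Ck_on_sum Ck_on_X_apply open_UNIV) (auto simp del: Ck_on.simps)

lemma hardy_integral:
  fixes g :: "real^'n \<Rightarrow> 'b::real_inner"
  assumes K: "compact K" "K \<subseteq> punctured" and g: "Ck_on 2 UNIV g" "\<And>x. x \<notin> K \<Longrightarrow> g x = 0"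
  shows "integrable lborel (\<lambda>x. (sublap g x \<bullet> g x) * rho x powr (- s))"
    and "(LINT x|lborel. (sublap g x \<bullet> g x) * rho x powr (- s)) \<ge>
      (hdim - 2 * s - 2) * (hdim + 2 * s - 2) / 4 * (LINT x|lborel. (norm (g x))\<^sup>2 * rho x powr (- (s + 1)))"
proof -
  have g2: "Ck_on (Suc (Suc 0)) UNIV g" using g(1) by (simp only: numeral_2_eq_2)
  have gU: "Ck_on 1 punctured g"
    using Ck_on_subset[OF Ck_on_Suc_D[OF g2]] by (simp del: Ck_on.simps)
  have aU: "Ck_on 1 punctured (apply_field (X j) g)" if "wt j = 1" for j
    using Ck_on_subset[OF Ck_on_X_apply[OF that g2]] by (simp del: Ck_on.simps)
  have LU: "Ck_on 0 punctured (sublap g)"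
    using Ck_on_subset[OF Ck_on_sublap[OF g2]] by (simp del: Ck_on.simps)
  let ?F = "\<lambda>x. (sublap g x \<bullet> g x) * rho x powr (- s)"
  let ?R = "\<lambda>x. (norm (g x))\<^sup>2 * rho x powr (- (s + 1))"
  let ?D = "\<lambda>j x. apply_field (X j) (hardy_flux s g j) x"
  have intF: "integrable lborel ?F"
    by (rule integrable_weighted[OF K])
      (use g(2) Ck_on_continuous[OF gU] Ck_on_continuous[OF LU] Ck_on_continuous[OF Ck_on_rho_powr]
       in \<open>auto intro!: continuous_on_mult continuous_on_inner\<close>)
  have intR: "integrable lborel ?R"
    by (rule integrable_weighted[OF K])
      (use g(2) Ck_on_continuous[OF gU] Ck_on_continuous[OF Ck_on_rho_powr]
       in \<open>auto intro!: continuous_on_mult continuous_on_power continuous_on_norm\<close>)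
  have D: "integrable lborel (?D j)" "(LINT x|lborel. ?D j x) = 0" if j: "wt j = 1" for j
  proof -
    have "Ck_on 1 punctured (hardy_flux s g j)"
      unfolding hardy_flux_def[abs_def]
      by (intro Ck_on_diff Ck_on_mult Ck_on_minus Ck_on_inner open_punctured aU[OF j] gU Ck_on_rho_powr
          Ck_on_const Ck_on_nth)
    moreover have "hardy_flux s g j x = 0" if "x \<notin> K" for x
      using g(2)[OF that] by (simp add: hardy_flux_def)
    ultimately show "integrable lborel (?D j)" "(LINT x|lborel. ?D j x) = 0"
      using integral_X[OF j open_punctured K] by blast+
  qed
  have pt: "(\<Sum>j | wt j = 1. ?D j x) + (hdim - 2 * s - 2) * (hdim + 2 * s - 2) / 4 * ?R x \<le> ?F x" for x
  proof (cases "x \<in> punctured")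
    case True
    show ?thesis
      by (rule hardy_pointwise[OF True])
        (use True gU aU in auto)
  next
    case False
    then have "x \<notin> K" using K by auto
    have 0: "?D j x = 0" if "wt j = 1" for j
      by (rule sublap_eq_0(1)[OF compact_imp_closed[OF K(1)] _ \<open>x \<notin> K\<close>])
         (simp add: hardy_flux_def g(2))
    show ?thesis using 0 g(2)[OF \<open>x \<notin> K\<close>] by simp
  qed
  have "(LINT x|lborel. (\<Sum>j | wt j = 1. ?D j x) + (hdim - 2 * s - 2) * (hdim + 2 * s - 2) / 4 * ?R x) \<le> (LINT x|lborel. ?F x)"
    by (intro integral_mono Bochner_Integration.integrable_add Bochner_Integration.integrable_sum
        integrable_mult_right intF intR D(1) pt) auto
  also have "(LINT x|lborel. (\<Sum>j | wt j = 1. ?D j x) + (hdim - 2 * s - 2) * (hdim + 2 * s - 2) / 4 * ?R x) =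
      (hdim - 2 * s - 2) * (hdim + 2 * s - 2) / 4 * (LINT x|lborel. ?R x)"
    by (subst Bochner_Integration.integral_add)
      (auto intro!: Bochner_Integration.integrable_sum integrable_mult_right intR D(1) simp: D simp del: minus_add_distrib)
  finally show "(LINT x|lborel. ?F x) \<ge> (hdim - 2 * s - 2) * (hdim + 2 * s - 2) / 4 * (LINT x|lborel. ?R x)" .
  show "integrable lborel ?F" by (rule intF)
qed

lemma integrable_norm_weighted:
  fixes h :: "real^'n \<Rightarrow> 'b::real_inner"
  assumes "compact K" "K \<subseteq> punctured" "continuous_on UNIV h" "\<And>x. x \<notin> K \<Longrightarrow> h x = 0"
  shows "integrable lborel (\<lambda>x. (norm (h x))\<^sup>2 * rho x powr s)"
  by (rule integrable_weighted[OF assms(1,2)])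
    (use assms(4) continuous_on_subset[OF assms(3), of punctured] Ck_on_continuous[OF Ck_on_rho_powr]
     in \<open>auto intro!: continuous_on_mult continuous_on_power continuous_on_norm\<close>)

text \<open>Expanding \<open>|L g + c g|\<^sup>2\<close> leaves three terms. For the first, \<open>|L g - (A / rho) g|\<^sup>2 \<ge> 0\<close> gives
  \<open>|L g|\<^sup>2 \<ge> 2 A (L g \<bullet> g) / rho - A\<^sup>2 |g|\<^sup>2 / rho\<^sup>2\<close>; then the Hardy
  inequality is applied twice, with the exponents \<open>\<delta> + 1\<close> and \<open>\<delta>\<close>. In the first application
  it is multiplied by \<open>2 A\<close>, whence the sign condition on \<open>(N - 2\<delta> - 4) (N + 2\<delta>)\<close>.\<close>

lemma rellich_integral:
  fixes g :: "real^'n \<Rightarrow> 'b::real_inner"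
  assumes K: "compact K" "K \<subseteq> punctured" and g: "Ck_on 2 UNIV g" "\<And>x. x \<notin> K \<Longrightarrow> g x = 0"
    and "c \<ge> 0" "(hdim - 2 * \<delta> - 4) * (hdim + 2 * \<delta>) \<ge> 0"
  defines "I \<equiv> \<lambda>s. LINT x|lborel. (norm (g x))\<^sup>2 * rho x powr (- s)"
  shows "(LINT x|lborel. (norm (sublap g x + c *\<^sub>R g x))\<^sup>2 * rho x powr (- \<delta>)) \<ge>
    ((hdim - 2 * \<delta> - 4) * (hdim + 2 * \<delta>) / 4)\<^sup>2 * I (\<delta> + 2)
    + c * ((hdim - 2 * \<delta> - 2) * (hdim + 2 * \<delta> - 2) / 2) * I (\<delta> + 1) + c\<^sup>2 * I \<delta>"
proof -
  define A where "A = (hdim - 2 * \<delta> - 4) * (hdim + 2 * \<delta>) / 4"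
  define M where "M s = (LINT x|lborel. (sublap g x \<bullet> g x) * rho x powr (- s))" for s
  have A: "A \<ge> 0" using assms by (simp add: A_def)
  have g2: "Ck_on (Suc (Suc 0)) UNIV g" using g(1) by (simp only: numeral_2_eq_2)
  have cg: "continuous_on UNIV g" "continuous_on UNIV (sublap g)"
    using Ck_on_continuous[OF g2] Ck_on_continuous[OF Ck_on_sublap[OF g2]] by auto
  have L0: "sublap g x = 0" if "x \<notin> K" for x
    by (rule sublap_eq_0(3)[OF compact_imp_closed[OF K(1)] g(2) that])
  note int = integrable_norm_weighted[OF K cg(1) g(2)] hardy_integral(1)[OF K g]
  note int4 = int(1)[of "- (\<delta> + 2)"] int(1)[of "- \<delta>"] int(2)[of "\<delta> + 1"] int(2)[of \<delta>]
  have intL: "integrable lborel (\<lambda>x. (norm (sublap g x + c *\<^sub>R g x))\<^sup>2 * rho x powr (- \<delta>))"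
    by (rule integrable_norm_weighted[OF K]) (use cg L0 g(2) in \<open>auto intro!: continuous_intros\<close>)
  let ?l = "\<lambda>x. 2 * A * ((sublap g x \<bullet> g x) * rho x powr (- (\<delta> + 1)))
      - A\<^sup>2 * ((norm (g x))\<^sup>2 * rho x powr (- (\<delta> + 2)))
      + 2 * c * ((sublap g x \<bullet> g x) * rho x powr (- \<delta>))
      + c\<^sup>2 * ((norm (g x))\<^sup>2 * rho x powr (- \<delta>))"
  have pt: "?l x \<le> (norm (sublap g x + c *\<^sub>R g x))\<^sup>2 * rho x powr (- \<delta>)" for x
  proof (cases "x \<in> punctured")
    case True
    then have r: "rho x > 0" by (simp add: punctured_def)
    define P where "P = rho x powr (- \<delta>)"
    have P: "rho x powr (- (\<delta> + 1)) = P / rho x" "rho x powr (- (\<delta> + 2)) = P / (rho x)\<^sup>2" "P > 0"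
      using r powr_add[of "rho x" "-\<delta>" "-1"] powr_add[of "rho x" "-\<delta>" "-2"]
      by (simp_all add: P_def powr_minus field_simps)
    \<comment> \<open>Completing the square with the constant that Hardy's inequality returns below.\<close>
    have "0 \<le> P * (norm (sublap g x - (A / rho x) *\<^sub>R g x))\<^sup>2" using P by simp
    also have "\<dots> = (norm (sublap g x + c *\<^sub>R g x))\<^sup>2 * P - ?l x"
    proof -
      have e: "(norm (sublap g x + t *\<^sub>R g x))\<^sup>2
          = sublap g x \<bullet> sublap g x + 2 * t * (sublap g x \<bullet> g x) + t\<^sup>2 * (g x \<bullet> g x)" for t
        by (rule norm_add_scaleR_power2)
      have e': "sublap g x - (A / rho x) *\<^sub>R g x = sublap g x + (- (A / rho x)) *\<^sub>R g x" by simp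
      show ?thesis
        unfolding P P_def[symmetric] e' e power2_norm_eq_inner[of "g x"] using r
        by (simp add: field_simps power2_eq_square)
    qed
    finally show ?thesis by (simp add: P_def)
  next
    case False
    then have "x \<notin> K" using K by auto
    then show ?thesis using g(2)[of x] by simp
  qed
  have "(LINT x|lborel. ?l x) \<le> (LINT x|lborel. (norm (sublap g x + c *\<^sub>R g x))\<^sup>2 * rho x powr (- \<delta>))"
    by (rule integral_mono[OF _ intL pt]) (use int4 in simp)
  also have "(LINT x|lborel. ?l x) = 2 * A * M (\<delta> + 1) - A\<^sup>2 * I (\<delta> + 2) + 2 * c * M \<delta> + c\<^sup>2 * I \<delta>"
    using int4 by (simp add: M_def I_def)
  finally have 1: "2 * A * M (\<delta> + 1) - A\<^sup>2 * I (\<delta> + 2) + 2 * c * M \<delta> + c\<^sup>2 * I \<delta>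
    \<le> (LINT x|lborel. (norm (sublap g x + c *\<^sub>R g x))\<^sup>2 * rho x powr (- \<delta>))" .
  have "M (\<delta> + 1) \<ge> (hdim - 2 * (\<delta> + 1) - 2) * (hdim + 2 * (\<delta> + 1) - 2) / 4 * I (\<delta> + 1 + 1)"
    unfolding M_def I_def by (rule hardy_integral(2)[OF K g])
  then have "M (\<delta> + 1) \<ge> A * I (\<delta> + 2)" by (simp add: A_def algebra_simps)
  from mult_left_mono[OF this, of "2 * A"] A have 2: "2 * A * M (\<delta> + 1) \<ge> 2 * A\<^sup>2 * I (\<delta> + 2)"
    by (simp add: power2_eq_square algebra_simps)
  have "M \<delta> \<ge> (hdim - 2 * \<delta> - 2) * (hdim + 2 * \<delta> - 2) / 4 * I (\<delta> + 1)"
    unfolding M_def I_def by (rule hardy_integral(2)[OF K g])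
  from mult_left_mono[OF this, of "2 * c"] assms(5)
  have 3: "2 * c * M \<delta> \<ge> c * ((hdim - 2 * \<delta> - 2) * (hdim + 2 * \<delta> - 2) / 2) * I (\<delta> + 1)" by (simp add: mult_ac)
  show ?thesis using 1 2 3 unfolding A_def[symmetric] by linarith
qed

end

section \<open>Removing the drift\<close>

context horizontal_frame
begin

text \<open>The reciprocal of the square root of the character, so that multiplication by it is an isometry from
  \<open>L\<^sup>2\<close> of Lebesgue measure onto \<open>L\<^sup>2\<close> of \<^const>\<open>mu_X\<close>.\<close>

definition half_char :: "real \<Rightarrow> ('n \<Rightarrow> real) \<Rightarrow> real^'n \<Rightarrow> real" where
  "half_char \<gamma> a x = exp (- (\<gamma> / 2) * (\<Sum>k | wt k = 1. a k * x $ k))"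

lemma half_char_pos: "half_char \<gamma> a x > 0"
  by (simp add: half_char_def)

lemma half_char_minus: "half_char \<gamma> a x * half_char (- \<gamma>) a x = 1"
  by (simp add: half_char_def exp_add[symmetric])

lemma character_half_char: "character wt \<gamma> a x * (half_char \<gamma> a x)\<^sup>2 = 1"
  by (simp add: character_def half_char_def power2_eq_square exp_add[symmetric])

lemma Ck_on_half_char: "Ck_on k UNIV (half_char \<gamma> a)"
  unfolding half_char_def[abs_def]
  by (rule Ck_on_compose_real[OF open_UNIV Ck_on_exp])
    (intro Ck_on_mult Ck_on_sum Ck_on_nth Ck_on_const open_UNIV, simp)

lemma apply_field_X_half_char:
  assumes j: "wt j = 1"
  shows "apply_field (X j) (half_char \<gamma> a) x = - (\<gamma> * a j / 2) * half_char \<gamma> a x"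
proof -
  let ?q = "\<lambda>x::real^'n. - (\<gamma> / 2) * (\<Sum>k | wt k = 1. a k * x $ k)"
  have d: "?q differentiable at x"
    by (intro differentiable_mult differentiable_sum ballI differentiable_const nth_differentiable) simp
  have "apply_field (X j) (\<lambda>x. \<Sum>k | wt k = 1. a k * x $ k) x = (\<Sum>k | wt k = 1. a k * (if k = j then 1 else 0))"
    by (subst apply_field_sum)
      (auto simp: apply_field_mult nth_differentiable differentiable_mult apply_field_X_nth[OF j] intro!: sum.cong)
  also have "\<dots> = a j" using j by (simp add: if_distrib sum.delta cong: if_cong)
  finally have "apply_field (X j) ?q x = - (\<gamma> / 2) * a j"
    using apply_field_mult[OF differentiable_const differentiable_sum, of "{k. wt k = 1}"
        "\<lambda>k x. a k * x $ k" x "X j" "- (\<gamma> / 2)"]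
    by (simp add: differentiable_mult nth_differentiable)
  with apply_field_compose_real[OF d DERIV_exp, of "X j"]
  show ?thesis by (simp add: half_char_def[abs_def])
qed

lemma apply_field_half_char_scaleR:
  fixes g :: "real^'n \<Rightarrow> 'b::real_normed_vector"
  assumes j: "wt j = 1" and g: "g differentiable at x"
  shows "apply_field (X j) (\<lambda>x. half_char \<gamma> a x *\<^sub>R g x) x =
    half_char \<gamma> a x *\<^sub>R (apply_field (X j) g x - (\<gamma> * a j / 2) *\<^sub>R g x)"
proof -
  have "half_char \<gamma> a differentiable at x" using Ck_on_half_char[of 1] by simp
  from apply_field_scaleR[OF this g, of "X j"] show ?thesis
    by (simp add: apply_field_X_half_char[OF j] algebra_simps)
qed

lemma apply_field_drift:
  assumes "f differentiable at x"
  shows "apply_field (drift wt X a) f x = (\<Sum>j | wt j = 1. a j *\<^sub>R apply_field (X j) f x)"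
proof -
  have lin: "linear (frechet_derivative f (at x))" by (rule linear_frechet_derivative[OF assms])
  show ?thesis unfolding apply_field_def drift_def
    by (simp add: linear_sum[OF lin] linear_scale[OF lin])
qed

text \<open>Conjugation replaces \<open>X\<^sub>j\<close> by \<open>X\<^sub>j - k\<^sub>j\<close> with \<open>k\<^sub>j = \<gamma> a\<^sub>j / 2\<close>. This value is the one for which the first
  order terms of \<open>- \<Sum>j. (X\<^sub>j - k\<^sub>j)\<^sup>2\<close> and of the drift cancel, and what remains of order zero is
  \<open>\<Sum>j. k\<^sub>j\<^sup>2 = \<gamma>\<^sup>2 b\<^sub>X\<^sup>2\<close>.\<close>

lemma drift_sublaplacian_half_char:
  fixes g :: "real^'n \<Rightarrow> complex"
  assumes g: "Ck_on 2 UNIV g"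
  shows "drift_sublaplacian wt X \<gamma> a (\<lambda>x. half_char \<gamma> a x *\<^sub>R g x) x =
    half_char \<gamma> a x *\<^sub>R (sublap g x + (\<gamma>\<^sup>2 * (b_X wt a)\<^sup>2) *\<^sub>R g x)"
proof -
  let ?E = "half_char \<gamma> a" and ?H = "{j. wt j = 1}"
  let ?f = "\<lambda>x. ?E x *\<^sub>R g x"
  define k where "k j = \<gamma> * a j / 2" for j
  have g2: "Ck_on (Suc (Suc 0)) UNIV g" using g by (simp only: numeral_2_eq_2)
  have dg: "g differentiable at x" for x using g2 by simp
  have dX: "apply_field (X j) g differentiable at x" if "wt j = 1" for j x
    using Ck_on_X_apply[OF that g2] by simp
  have dE: "?E differentiable at x" for x using Ck_on_half_char[of 1] by simp
  have 1: "apply_field (X j) ?f = (\<lambda>x. ?E x *\<^sub>R (apply_field (X j) g x - k j *\<^sub>R g x))" if "wt j = 1" for j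
    by (rule ext) (simp only: apply_field_half_char_scaleR[OF that dg] k_def)
  have 2: "apply_field (X j) (apply_field (X j) ?f) x =
      ?E x *\<^sub>R (apply_field (X j) (apply_field (X j) g) x - (2 * k j) *\<^sub>R apply_field (X j) g x + (k j)\<^sup>2 *\<^sub>R g x)"
    if j: "wt j = 1" for j
  proof -
    have "apply_field (X j) (\<lambda>x. apply_field (X j) g x - k j *\<^sub>R g x) x =
        apply_field (X j) (apply_field (X j) g) x - k j *\<^sub>R apply_field (X j) g x"
      by (subst apply_field_diff[OF dX[OF j] differentiable_scaleR[OF differentiable_const dg]])
        (simp only: apply_field_linear_image[OF bounded_linear_scaleR_right dg])
    moreover have "(\<lambda>x. apply_field (X j) g x - k j *\<^sub>R g x) differentiable at x"
      by (intro differentiable_diff differentiable_scaleR differentiable_const dg dX[OF j])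
    ultimately have "apply_field (X j) (apply_field (X j) ?f) x =
        ?E x *\<^sub>R (apply_field (X j) (apply_field (X j) g) x - k j *\<^sub>R apply_field (X j) g x
          - k j *\<^sub>R (apply_field (X j) g x - k j *\<^sub>R g x))"
      unfolding 1[OF j] by (simp only: apply_field_half_char_scaleR[OF j, of _ x \<gamma> a, folded k_def])
    also have "apply_field (X j) (apply_field (X j) g) x - k j *\<^sub>R apply_field (X j) g x
          - k j *\<^sub>R (apply_field (X j) g x - k j *\<^sub>R g x) =
        apply_field (X j) (apply_field (X j) g) x - (2 * k j) *\<^sub>R apply_field (X j) g x + (k j)\<^sup>2 *\<^sub>R g x"
      by (simp add: scaleR_conv_of_real algebra_simps power2_eq_square)
    finally show ?thesis .
  qed
  have df: "?f differentiable at x" by (intro differentiable_scaleR dE dg)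
  have "\<gamma> *\<^sub>R apply_field (drift wt X a) ?f x = (\<Sum>j\<in>?H. ?E x *\<^sub>R ((2 * k j) *\<^sub>R (apply_field (X j) g x - k j *\<^sub>R g x)))"
    unfolding apply_field_drift[OF df] scaleR_sum_right
    by (intro sum.cong) (auto simp: 1 k_def algebra_simps)
  moreover have "(\<Sum>j\<in>?H. apply_field (X j) (apply_field (X j) ?f) x) =
     (\<Sum>j\<in>?H. ?E x *\<^sub>R (apply_field (X j) (apply_field (X j) g) x - (2 * k j) *\<^sub>R apply_field (X j) g x + (k j)\<^sup>2 *\<^sub>R g x))"
    by (intro sum.cong) (auto simp: 2)
  ultimately have "drift_sublaplacian wt X \<gamma> a ?f x =
     - (\<Sum>j\<in>?H. ?E x *\<^sub>R (apply_field (X j) (apply_field (X j) g) x - (2 * k j) *\<^sub>R apply_field (X j) g x + (k j)\<^sup>2 *\<^sub>R g x))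
     - (\<Sum>j\<in>?H. ?E x *\<^sub>R ((2 * k j) *\<^sub>R (apply_field (X j) g x - k j *\<^sub>R g x)))"
    by (simp add: drift_sublaplacian_def)
  also have "\<dots> = (\<Sum>j\<in>?H. ?E x *\<^sub>R (- apply_field (X j) (apply_field (X j) g) x + (k j)\<^sup>2 *\<^sub>R g x))"
    unfolding sum_negf[symmetric] sum_subtractf[symmetric]
    by (intro sum.cong refl) (simp add: scaleR_conv_of_real algebra_simps power2_eq_square)
  also have "\<dots> = ?E x *\<^sub>R (sublap g x + (\<Sum>j\<in>?H. (k j)\<^sup>2) *\<^sub>R g x)"
    by (simp add: scaleR_sum_right[symmetric] sum.distrib sum_negf sum_subtractf sublap_def scaleR_sum_left)
  also have "(\<Sum>j\<in>?H. (k j)\<^sup>2) = \<gamma>\<^sup>2 * (b_X wt a)\<^sup>2"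
    by (simp add: b_X_def k_def power_divide power_mult_distrib sum_nonneg sum_divide_distrib[symmetric]
        sum_distrib_left[symmetric])
  finally show ?thesis .
qed

lemma L2_norm_half_char:
  fixes h :: "real^'n \<Rightarrow> complex"
  assumes h: "continuous_on UNIV h" "\<And>x. x \<notin> punctured \<Longrightarrow> h x = 0"
    and w: "w \<in> borel_measurable borel" "\<And>x. x \<in> punctured \<Longrightarrow> w x = hnorm wt x powr t"
  shows "(L2_norm (mu_X wt \<gamma> a) (\<lambda>x. (half_char \<gamma> a x *\<^sub>R h x) /\<^sub>R w x))\<^sup>2
    = (LINT x|lborel. (norm (h x))\<^sup>2 * rho x powr (- t))"
proof -
  have [measurable]: "h \<in> borel_measurable borel" "half_char \<gamma> a \<in> borel_measurable borel"
    "w \<in> borel_measurable borel"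
    using h w Ck_on_continuous[OF Ck_on_half_char] by (auto intro: borel_measurable_continuous_onI)
  have [measurable]: "character wt \<gamma> a \<in> borel_measurable borel"
    unfolding character_def[abs_def] by (intro borel_measurable_continuous_onI continuous_intros)
  let ?F = "\<lambda>x. (cmod ((half_char \<gamma> a x *\<^sub>R h x) /\<^sub>R w x))\<^sup>2"
  have "(L2_norm (mu_X wt \<gamma> a) (\<lambda>x. (half_char \<gamma> a x *\<^sub>R h x) /\<^sub>R w x))\<^sup>2 = (LINT x|mu_X wt \<gamma> a. ?F x)"
    by (simp add: L2_norm_def)
  also have "\<dots> = (LINT x|lborel. character wt \<gamma> a x *\<^sub>R ?F x)"
    unfolding mu_X_def by (subst integral_density) (auto simp: character_def)
  also have "\<dots> = (LINT x|lborel. (norm (h x))\<^sup>2 * rho x powr (- t))"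
  proof (intro Bochner_Integration.integral_cong refl)
    fix x
    show "character wt \<gamma> a x *\<^sub>R ?F x = (norm (h x))\<^sup>2 * rho x powr (- t)"
    proof (cases "x \<in> punctured")
      case True
      then have r: "rho x > 0" by (simp add: punctured_def)
      have "(w x)\<^sup>2 = rho x powr t"
        using r unfolding w(2)[OF True] hnorm_eq
        by (simp add: power2_eq_square powr_mult[symmetric])
      then have "?F x = (half_char \<gamma> a x)\<^sup>2 * ((norm (h x))\<^sup>2 * rho x powr (- t))"
        by (simp add: power_mult_distrib power_inverse powr_minus)
      then have "character wt \<gamma> a x *\<^sub>R ?F x
          = (character wt \<gamma> a x * (half_char \<gamma> a x)\<^sup>2) * ((norm (h x))\<^sup>2 * rho x powr (- t))"
        by (simp only: real_scaleR_def mult.assoc)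
      then show ?thesis by (simp only: character_half_char mult_1)
    next
      case False
      then show ?thesis using h(2)[of x] by simp
    qed
  qed
  finally show ?thesis .
qed

text \<open>The condition on test functions with some compact set in place of the closed support, and for any
  target space, so that real trial functions can be used.\<close>

definition admissible :: "(real^'n \<Rightarrow> 'b::real_normed_vector) \<Rightarrow> bool" where
  "admissible g \<longleftrightarrow> smooth_on UNIV g \<and> (\<exists>K. compact K \<and> K \<subseteq> punctured \<and> (\<forall>x. x \<notin> K \<longrightarrow> g x = 0))"

lemma admissibleE:
  assumes "admissible g"
  obtains K where "compact K" "K \<subseteq> punctured" "\<And>x. x \<notin> K \<Longrightarrow> g x = 0" "\<And>k. Ck_on k UNIV g"
  using assms unfolding admissible_def smooth_on_def by blast

lemma test_functions_eq: "test_functions punctured = {f. admissible f}"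
proof -
  have "smooth_on UNIV f \<and> compact (closure {x. f x \<noteq> 0}) \<and> closure {x. f x \<noteq> 0} \<subseteq> punctured \<longleftrightarrow> admissible f" for f
  proof
    assume "smooth_on UNIV f \<and> compact (closure {x. f x \<noteq> 0}) \<and> closure {x. f x \<noteq> 0} \<subseteq> punctured"
    then show "admissible f"
      using closure_subset[of "{x. f x \<noteq> 0}"] unfolding admissible_def
      by (intro conjI exI[of _ "closure {x. f x \<noteq> 0}"]) auto
  next
    assume "admissible f"
    then obtain K where K: "smooth_on UNIV f" "compact K" "K \<subseteq> punctured" "\<And>x. x \<notin> K \<Longrightarrow> f x = 0"
      by (auto simp: admissible_def)
    then have "closure {x. f x \<noteq> 0} \<subseteq> K"
      by (intro closure_minimal compact_imp_closed) auto
    then show "smooth_on UNIV f \<and> compact (closure {x. f x \<noteq> 0}) \<and> closure {x. f x \<noteq> 0} \<subseteq> punctured"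
      using K compact_Int_closed[OF K(2) closed_closure[of "{x. f x \<noteq> 0}"]] by (auto simp: Int_absorb1)
  qed
  then show ?thesis by (auto simp: test_functions_def)
qed

lemma admissible_half_char:
  assumes "admissible g"
  shows "admissible (\<lambda>x. half_char \<gamma> a x *\<^sub>R g x)"
proof -
  obtain K where K: "compact K" "K \<subseteq> punctured" "\<And>x. x \<notin> K \<Longrightarrow> g x = 0" "\<And>k. Ck_on k UNIV g"
    using admissibleE[OF assms] by blast
  then show ?thesis
    unfolding admissible_def smooth_on_def
    by (intro conjI allI exI[of _ K] Ck_on_scaleR open_UNIV Ck_on_half_char) auto
qed

lemma half_char_scaleR_inverse:
  fixes v :: "'b::real_vector"
  shows "half_char \<gamma> a x *\<^sub>R (half_char (- \<gamma>) a x *\<^sub>R v) = v"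
  unfolding scaleR_scaleR half_char_minus by simp

definition moment :: "(real^'n \<Rightarrow> 'b::real_normed_vector) \<Rightarrow> real \<Rightarrow> real" where
  "moment g s = (LINT x|lborel. (norm (g x))\<^sup>2 * rho x powr (- s))"

lemma L2_norm_test_function:
  fixes g :: "real^'n \<Rightarrow> complex"
  assumes g: "admissible g"
    and w: "w \<in> borel_measurable borel" "\<And>x. x \<in> punctured \<Longrightarrow> w x = hnorm wt x powr t"
  shows "(L2_norm (mu_X wt \<gamma> a) (\<lambda>x. (half_char \<gamma> a x *\<^sub>R g x) /\<^sub>R w x))\<^sup>2 = moment g t"
    and "(L2_norm (mu_X wt \<gamma> a) (\<lambda>x. drift_sublaplacian wt X \<gamma> a (\<lambda>x. half_char \<gamma> a x *\<^sub>R g x) x /\<^sub>R w x))\<^sup>2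
      = moment (\<lambda>x. sublap g x + (\<gamma>\<^sup>2 * (b_X wt a)\<^sup>2) *\<^sub>R g x) t"
proof -
  obtain K where K: "compact K" "K \<subseteq> punctured" "\<And>x. x \<notin> K \<Longrightarrow> g x = 0" "\<And>k. Ck_on k UNIV g"
    using admissibleE[OF g] by blast
  show "(L2_norm (mu_X wt \<gamma> a) (\<lambda>x. (half_char \<gamma> a x *\<^sub>R g x) /\<^sub>R w x))\<^sup>2 = moment g t"
    unfolding moment_def by (rule L2_norm_half_char) (use K Ck_on_continuous[OF K(4)] w in auto)
  have L0: "sublap g x = 0" if "x \<notin> punctured" for x
    by (rule sublap_eq_0(3)[OF compact_imp_closed[OF K(1)] K(3)]) (use that K in auto)
  have "continuous_on UNIV (\<lambda>x. sublap g x + (\<gamma>\<^sup>2 * (b_X wt a)\<^sup>2) *\<^sub>R g x)"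
    using Ck_on_continuous[OF K(4)] Ck_on_continuous[OF Ck_on_sublap[OF K(4)]]
    by (auto intro!: continuous_intros)
  then show "(L2_norm (mu_X wt \<gamma> a) (\<lambda>x. drift_sublaplacian wt X \<gamma> a (\<lambda>x. half_char \<gamma> a x *\<^sub>R g x) x /\<^sub>R w x))\<^sup>2
      = moment (\<lambda>x. sublap g x + (\<gamma>\<^sup>2 * (b_X wt a)\<^sup>2) *\<^sub>R g x) t"
    unfolding moment_def drift_sublaplacian_half_char[OF K(4)]
    by (rule L2_norm_half_char) (use K L0 w in auto)
qed

end

section \<open>A smooth step function\<close>

text \<open>The quotients by \<open>t ^ n\<close> are included because the resulting family is closed under
  differentiation, so a single induction shows that all of its members are smooth.\<close>

definition flat :: "nat \<Rightarrow> real \<Rightarrow> real" where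
  "flat n t = (if t > 0 then exp (- (1 / t)) / t ^ n else 0)"

lemma flat_tendsto_0: "(flat n \<longlongrightarrow> 0) (at 0)"
proof -
  have "((\<lambda>x::real. x ^ n / exp x) \<longlongrightarrow> 0) at_top"
    by (rule tendsto_power_div_exp_0)
  from filterlim_compose[OF this filterlim_inverse_at_top_right]
  have "((\<lambda>t::real. inverse t ^ n / exp (inverse t)) \<longlongrightarrow> 0) (at_right 0)" .
  moreover have "\<forall>\<^sub>F t in at_right 0. inverse t ^ n / exp (inverse t) = flat n t"
    using eventually_at_right_less[of "0::real"]
    by eventually_elim (simp add: flat_def exp_minus divide_inverse power_inverse)
  ultimately have R: "(flat n \<longlongrightarrow> 0) (at_right 0)"
    by (rule Lim_transform_eventually)
  have "\<forall>\<^sub>F t in at_left 0. 0 = flat n t"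
    by (auto simp: eventually_at_filter flat_def)
  from Lim_transform_eventually[OF tendsto_const this] have L: "(flat n \<longlongrightarrow> 0) (at_left 0)" .
  show ?thesis using L R by (simp add: filterlim_split_at)
qed

lemma flat_has_derivative:
  "(flat n has_real_derivative (flat (n + 2) t - real n * flat (n + 1) t)) (at t)"
proof -
  consider "t > 0" | "t < 0" | "t = 0" by linarith
  then show ?thesis
  proof cases
    case 1
    have "((\<lambda>t. exp (- (1 / t)) / t ^ n) has_real_derivative
        (exp (- (1 / t)) * (1 / t\<^sup>2) * t ^ n - exp (- (1 / t)) * (real n * t ^ (n - 1))) / (t ^ n * t ^ n)) (at t)"
      using 1 by (auto intro!: derivative_eq_intros simp: power2_eq_square)
    moreover have "(exp (- (1 / t)) * (1 / t\<^sup>2) * t ^ n - exp (- (1 / t)) * (real n * t ^ (n - 1))) / (t ^ n * t ^ n)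
        = flat (n + 2) t - real n * flat (n + 1) t"
      using 1 by (cases n) (auto simp: flat_def field_simps power2_eq_square)
    ultimately have "((\<lambda>t. exp (- (1 / t)) / t ^ n) has_real_derivative flat (n + 2) t - real n * flat (n + 1) t) (at t)"
      by simp
    then show ?thesis
      by (rule has_field_derivative_transform_within_open[where S = "{0<..}"]) (use 1 in \<open>auto simp: flat_def\<close>)
  next
    case 2
    have "((\<lambda>t. 0) has_real_derivative flat (n + 2) t - real n * flat (n + 1) t) (at t)"
      using 2 by (simp add: flat_def)
    then show ?thesis
      by (rule has_field_derivative_transform_within_open[where S = "{..<0}"]) (use 2 in \<open>auto simp: flat_def\<close>)
  next
    case 3
    have "\<forall>\<^sub>F h in at 0. flat (Suc n) h = (flat n (0 + h) - flat n 0) / h"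
      by (auto simp: flat_def eventually_at_filter)
    from Lim_transform_eventually[OF flat_tendsto_0 this] show ?thesis
      using 3 by (simp add: DERIV_def flat_def)
  qed
qed

lemma Ck_on_flat: "Ck_on k UNIV (flat n)"
proof (induction k arbitrary: n)
  case 0
  show ?case using DERIV_isCont[OF flat_has_derivative] by (simp add: continuous_on_eq_continuous_at)
next
  case (Suc k)
  show ?case
    by (rule Ck_on_real_derivI[OF open_UNIV flat_has_derivative])
      (intro Ck_on_diff Ck_on_mult Ck_on_const Suc open_UNIV)
qed

text \<open>The denominator is written as a power in order to obtain smoothness from that of \<open>powr\<close>.\<close>

definition smooth_step :: "real \<Rightarrow> real" where
  "smooth_step t = flat 0 t * (flat 0 t + flat 0 (1 - t)) powr (-1)"

lemma smooth_step_denom: "flat 0 t + flat 0 (1 - t) > 0"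
  by (auto simp: flat_def add_pos_pos)

lemma smooth_step_eq: "smooth_step t = flat 0 t / (flat 0 t + flat 0 (1 - t))"
  using smooth_step_denom[of t] by (simp add: smooth_step_def powr_minus divide_inverse)

lemma smooth_step_0: "t \<le> 0 \<Longrightarrow> smooth_step t = 0"
  by (simp add: smooth_step_def flat_def)

lemma smooth_step_1: "t \<ge> 1 \<Longrightarrow> smooth_step t = 1"
  by (simp add: smooth_step_eq flat_def)

lemma smooth_step_bounds: "0 \<le> smooth_step t" "smooth_step t \<le> 1"
proof -
  have "flat 0 s \<ge> 0" for s by (simp add: flat_def)
  then show "0 \<le> smooth_step t" "smooth_step t \<le> 1"
    using smooth_step_denom[of t] by (auto simp: smooth_step_eq)
qed

lemma Ck_on_affine: "Ck_on k UNIV (\<lambda>t::real. c + d * t)"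
  by (intro Ck_on_add Ck_on_mult Ck_on_const Ck_on_bounded_linear bounded_linear_ident open_UNIV)

lemma Ck_on_smooth_step: "Ck_on k UNIV smooth_step"
proof -
  have "Ck_on k UNIV (\<lambda>t. flat 0 (1 - t))"
    using Ck_on_compose_real[OF open_UNIV Ck_on_flat[of k 0] Ck_on_affine[of k 1 "-1"]] by simp
  then have "Ck_on k UNIV (\<lambda>t. flat 0 t + flat 0 (1 - t))"
    by (intro Ck_on_add Ck_on_flat open_UNIV)
  from Ck_on_compose_real[OF open_UNIV Ck_on_powr this]
  have "Ck_on k UNIV (\<lambda>t. (flat 0 t + flat 0 (1 - t)) powr (-1))"
    using smooth_step_denom by blast
  from Ck_on_mult[OF open_UNIV Ck_on_flat this] show ?thesis
    by (simp add: smooth_step_def[abs_def])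
qed

lemma Ck_on_real_derivE:
  fixes h :: "real \<Rightarrow> real"
  assumes "\<And>k. Ck_on k UNIV h"
  obtains h' where "\<And>t. (h has_real_derivative h' t) (at t)" "\<And>k. Ck_on k UNIV h'"
proof
  let ?h' = "\<lambda>t. frechet_derivative h (at t) 1"
  show "Ck_on k UNIV ?h'" for k using assms[of "Suc k"] by simp
  show "(h has_real_derivative ?h' t) (at t)" for t
  proof -
    have h: "(h has_derivative frechet_derivative h (at t)) (at t)"
      using assms[of 1] by (auto simp flip: frechet_derivative_works)
    have "frechet_derivative h (at t) r = ?h' t * r" for r
      using linear_scale[OF has_derivative_linear[OF h], of r 1] by simp
    then have "frechet_derivative h (at t) = (\<lambda>r. ?h' t * r)" by (rule ext)
    with h show ?thesis unfolding has_field_derivative_def by metis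
  qed
qed

text \<open>The two end points are included; there the value follows by continuity.\<close>

lemma derivative_zero_of_const_tails:
  fixes h h' :: "real \<Rightarrow> real"
  assumes h: "\<And>t. (h has_real_derivative h' t) (at t)" and c: "continuous_on UNIV h'"
    and "\<And>t. t \<le> 0 \<Longrightarrow> h t = u" "\<And>t. t \<ge> 1 \<Longrightarrow> h t = v" "t \<le> 0 \<or> t \<ge> 1"
  shows "h' t = 0"
proof -
  have L: "h' t = 0" if "t < 0" for t
  proof -
    have "(h has_real_derivative 0) (at t)"
      by (rule has_field_derivative_transform_within_open[OF DERIV_const[of u], where S = "{..<0}"])
        (use that assms(3) in auto)
    from DERIV_unique[OF h this] show ?thesis .
  qed
  have R: "h' t = 0" if "t > 1" for t
  proof -
    have "(h has_real_derivative 0) (at t)"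
      by (rule has_field_derivative_transform_within_open[OF DERIV_const[of v], where S = "{1<..}"])
        (use that assms(4) in auto)
    from DERIV_unique[OF h this] show ?thesis .
  qed
  have "h' t = 0" if "t \<in> closure {..<0}" for t
    by (rule continuous_constant_on_closure[OF continuous_on_subset[OF c] _ that]) (use L in auto)
  moreover have "h' t = 0" if "t \<in> closure {1<..}" for t
    by (rule continuous_constant_on_closure[OF continuous_on_subset[OF c] _ that]) (use R in auto)
  ultimately show ?thesis using assms(5) by auto
qed

lemma bounded_of_zero_tails:
  fixes h :: "real \<Rightarrow> real"
  assumes "continuous_on UNIV h" "\<And>t. t \<le> 0 \<or> t \<ge> 1 \<Longrightarrow> h t = 0"
  obtains M where "\<And>t. \<bar>h t\<bar> \<le> M"
proof -
  have "bounded (h ` {0..1})"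
    by (intro compact_imp_bounded compact_continuous_image continuous_on_subset[OF assms(1)]) auto
  then obtain B where "\<forall>y\<in>h ` {0..1}. norm y \<le> B" unfolding bounded_iff by blast
  then have B: "\<bar>h t\<bar> \<le> B" if "t \<in> {0..1}" for t using that by simp
  have "\<bar>h t\<bar> \<le> max B 0" for t
    using B[of t] assms(2)[of t] by (cases "t \<in> {0..1}") auto
  then show ?thesis by (rule that)
qed

lemma smooth_step_derivatives:
  obtains s1 s2 :: "real \<Rightarrow> real" and M where
    "\<And>t. (smooth_step has_real_derivative s1 t) (at t)"
    "\<And>t. (s1 has_real_derivative s2 t) (at t)"
    "\<And>t. t \<le> 0 \<or> t \<ge> 1 \<Longrightarrow> s1 t = 0" "\<And>t. t \<le> 0 \<or> t \<ge> 1 \<Longrightarrow> s2 t = 0"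
    "\<And>t. \<bar>s1 t\<bar> \<le> M" "\<And>t. \<bar>s2 t\<bar> \<le> M"
proof -
  obtain s1 where s1: "\<And>t. (smooth_step has_real_derivative s1 t) (at t)" "\<And>k. Ck_on k UNIV s1"
    using Ck_on_real_derivE[OF Ck_on_smooth_step] by blast
  obtain s2 where s2: "\<And>t. (s1 has_real_derivative s2 t) (at t)" "\<And>k. Ck_on k UNIV s2"
    using Ck_on_real_derivE[OF s1(2)] by blast
  have z1: "s1 t = 0" if "t \<le> 0 \<or> t \<ge> 1" for t
    by (rule derivative_zero_of_const_tails[OF s1(1) Ck_on_continuous[OF s1(2)] smooth_step_0 smooth_step_1 that])
  have z2: "s2 t = 0" if "t \<le> 0 \<or> t \<ge> 1" for t
    by (rule derivative_zero_of_const_tails[OF s2(1) Ck_on_continuous[OF s2(2)] _ _ that]) (use z1 in auto)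
  obtain M1 where M1: "\<And>t. \<bar>s1 t\<bar> \<le> M1"
    using bounded_of_zero_tails[OF Ck_on_continuous[OF s1(2)] z1] by blast
  obtain M2 where M2: "\<And>t. \<bar>s2 t\<bar> \<le> M2"
    using bounded_of_zero_tails[OF Ck_on_continuous[OF s2(2)] z2] by blast
  show ?thesis
    by (rule that[OF s1(1) s2(1) z1 z2, of "max M1 M2"])
      (use M1 M2 in \<open>auto simp: le_max_iff_disj\<close>)
qed

section \<open>Shells around the singular set\<close>

text \<open>A special case of the affine change of variables, with the scaling factors indexed by
  coordinates instead of basis vectors.\<close>

lemma lborel_integral_diagonal:
  fixes f :: "real^'n \<Rightarrow> real"
  assumes [measurable]: "f \<in> borel_measurable borel" and c: "\<And>i. c i \<noteq> 0"
  shows "(LINT x|lborel. f x) = (\<Prod>i\<in>UNIV. \<bar>c i\<bar>) * (LINT x|lborel. f (\<chi> i. c i * x $ i))"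
proof -
  define d :: "real^'n \<Rightarrow> real" where "d b = c (THE i. b = axis i 1)" for b
  have d: "d (axis i 1) = c i" for i
    unfolding d_def by (rule arg_cong[of _ _ c]) (auto simp: axis_eq_axis)
  have B: "(Basis :: (real^'n) set) = (\<lambda>i. axis i 1) ` UNIV"
    by (auto simp: Basis_vec_def)
  have inj: "inj (\<lambda>i::'n. axis i (1::real))"
    by (auto simp: inj_on_def axis_eq_axis)
  let ?T = "\<lambda>x. 0 + (\<Sum>j\<in>Basis. (d j * (x \<bullet> j)) *\<^sub>R j) :: real^'n"
  have T: "?T x = (\<chi> i. c i * x $ i)" for x
  proof -
    have "?T x = (\<Sum>i\<in>UNIV. (d (axis i 1) * (x \<bullet> axis i 1)) *\<^sub>R axis i 1)"
      unfolding B by (simp only: add_0_left sum.reindex[OF inj] o_def)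
    also have "\<dots> = (\<chi> i. c i * x $ i)"
      unfolding d inner_axis by (simp add: vec_eq_iff axis_def if_distrib cong: if_cong)
    finally show ?thesis .
  qed
  have p: "(\<Prod>j\<in>Basis. \<bar>d j\<bar>) = (\<Prod>i\<in>UNIV. \<bar>c i\<bar>)"
    unfolding B by (simp add: prod.reindex[OF inj] d)
  have "lborel = density (distr lborel borel ?T) (\<lambda>_. ennreal (\<Prod>j\<in>Basis. \<bar>d j\<bar>))"
    by (rule lborel_affine_euclidean) (auto simp: B d c)
  then have L: "lborel = density (distr lborel borel (\<lambda>x. \<chi> i. c i * x $ i)) (\<lambda>_. ennreal (\<Prod>i\<in>UNIV. \<bar>c i\<bar>))"
    unfolding T p .
  have [measurable]: "(\<lambda>x::real^'n. \<chi> i. c i * x $ i) \<in> borel \<rightarrow>\<^sub>M borel"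
    by (intro borel_measurable_continuous_onI continuous_intros)
  have "(LINT x|lborel. f x) = (LINT x|density (distr lborel borel (\<lambda>x. \<chi> i. c i * x $ i)) (\<lambda>_. ennreal (\<Prod>i\<in>UNIV. \<bar>c i\<bar>)). f x)"
    by (subst L) (rule refl)
  also have "\<dots> = (\<Prod>i\<in>UNIV. \<bar>c i\<bar>) * (LINT x|lborel. f (\<chi> i. c i * x $ i))"
    by (subst integral_density) (auto simp: integral_distr intro!: prod_nonneg)
  finally show ?thesis .
qed

context horizontal_frame
begin

definition vert_sq :: "real^'n \<Rightarrow> real" where
  "vert_sq x = (\<Sum>j | wt j \<noteq> 1. (x $ j)\<^sup>2)"

lemma norm_eq_rho_vert_sq: "(norm x)\<^sup>2 = rho x + vert_sq x"
proof -
  have "(norm x)\<^sup>2 = (\<Sum>j\<in>UNIV. (x $ j)\<^sup>2)"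
    by (simp add: norm_vec_def L2_set_def sum_nonneg)
  also have "UNIV = {j. wt j = 1} \<union> {j. wt j \<noteq> 1}" by auto
  also have "(\<Sum>j\<in>{j. wt j = 1} \<union> {j. wt j \<noteq> 1}. (x $ j)\<^sup>2) = rho x + vert_sq x"
    unfolding rho_def vert_sq_def by (rule sum.union_disjoint) auto
  finally show ?thesis .
qed

lemma Ck_on_vert_sq: "Ck_on k UNIV vert_sq"
  unfolding vert_sq_def[abs_def] by (intro Ck_on_sum Ck_on_power Ck_on_nth open_UNIV)

text \<open>The exponent \<open>- N / 2\<close> of the density below makes \<open>rho powr (- N / 2) dx'\<close> invariant under
  scaling of \<open>x'\<close>, so all shells of unit length in the variable \<open>ln rho\<close> have the same mass. This
  takes the place of polar coordinates.\<close>

definition shell :: "real \<Rightarrow> real \<Rightarrow> (real^'n) set" where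
  "shell r s = {x. rho x > 0 \<and> s \<le> ln (rho x) \<and> ln (rho x) < s + 1 \<and> vert_sq x \<le> r}"

definition shell_density :: "real \<Rightarrow> real \<Rightarrow> real^'n \<Rightarrow> real" where
  "shell_density r s x = indicator (shell r s) x * rho x powr (- hdim / 2)"

lemma rho_measurable [measurable]: "rho \<in> borel_measurable borel"
  and vert_sq_measurable [measurable]: "vert_sq \<in> borel_measurable borel"
  using Ck_on_continuous[OF Ck_on_rho] Ck_on_continuous[OF Ck_on_vert_sq]
  by (auto intro: borel_measurable_continuous_onI)

lemma shell_measurable [measurable]: "shell r s \<in> sets borel"
  unfolding shell_def by measurable

lemma shell_density_measurable [measurable]: "shell_density r s \<in> borel_measurable borel"
  unfolding shell_density_def[abs_def] by measurable

lemma shell_density_nonneg: "shell_density r s x \<ge> 0"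
  by (simp add: shell_density_def)

lemma integrable_shell_density: "integrable lborel (shell_density r s)"
proof (rule Bochner_Integration.integrable_bound)
  let ?R = "sqrt (exp (s + 1) + r)"
  show "integrable lborel (\<lambda>x::real^'n. exp (- s * hdim / 2) * indicator (cball 0 ?R) x)"
    using emeasure_bounded_finite[OF bounded_cball, of "0::real^'n" ?R]
    by (intro integrable_mult_right integrable_real_indicator) auto
  have "shell_density r s x \<le> exp (- s * hdim / 2) * indicator (cball 0 ?R) x" for x
  proof (cases "x \<in> shell r s")
    case True
    then have r: "rho x > 0" "s \<le> ln (rho x)" "ln (rho x) < s + 1" "vert_sq x \<le> r"
      by (auto simp: shell_def)
    have "rho x \<le> exp (s + 1)" using r by (metis exp_le_cancel_iff exp_ln less_imp_le)
    then have "(norm x)\<^sup>2 \<le> exp (s + 1) + r" using r norm_eq_rho_vert_sq[of x] by simp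
    then have "norm x \<le> ?R" by (rule real_le_rsqrt)
    moreover have "rho x powr (- hdim / 2) \<le> exp (- s * hdim / 2)"
      using r mult_right_mono[OF r(2), of hdim] by (simp add: powr_def hdim_def mult.commute)
    ultimately show ?thesis using True by (simp add: shell_density_def)
  next
    case False
    then show ?thesis by (simp add: shell_density_def)
  qed
  then show "AE x in lborel. norm (shell_density r s x) \<le> norm (exp (- s * hdim / 2) * indicator (cball 0 ?R) x)"
    by (simp add: shell_density_nonneg)
qed simp

definition shell_mass :: "real \<Rightarrow> real" where
  "shell_mass r = (LINT x|lborel. shell_density r 0 x)"

text \<open>Scale only \<open>x'\<close>, by the factor \<open>exp (s / 2)\<close>, and leave the other coordinates fixed: the Jacobian
  \<open>exp (s N / 2)\<close> cancels against the density.\<close>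

lemma integral_shell_density: "(LINT x|lborel. shell_density r s x) = shell_mass r"
proof -
  define k where "k = exp (s / 2)"
  have k: "k > 0" by (simp add: k_def)
  define T where "T x = (\<chi> i. (if wt i = 1 then k else 1) * x $ i)" for x :: "real^'n"
  have rT: "rho (T x) = exp s * rho x" for x
    unfolding rho_def sum_distrib_left T_def
    by (intro sum.cong) (auto simp: k_def power_mult_distrib power2_eq_square exp_add[symmetric])
  have qT: "vert_sq (T x) = vert_sq x" for x
    unfolding vert_sq_def T_def by (intro sum.cong) auto
  have prod: "(\<Prod>i\<in>UNIV. \<bar>if wt i = 1 then k else 1\<bar>) = exp (s * hdim / 2)"
  proof -
    have "(\<Prod>i\<in>UNIV. \<bar>if wt i = 1 then k else 1\<bar>) = (\<Prod>i\<in>UNIV. if wt i = 1 then k else 1)"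
      using k by (intro prod.cong) auto
    also have "\<dots> = k ^ card {i. wt i = 1}" by (subst prod.If_cases) auto
    also have "\<dots> = exp (s * hdim / 2)" by (simp add: k_def hdim_def exp_of_nat_mult[symmetric] mult_ac)
    finally show ?thesis .
  qed
  have "shell_density r s (T x) = exp (- s * hdim / 2) * shell_density r 0 x" for x
  proof -
    have "T x \<in> shell r s \<longleftrightarrow> x \<in> shell r 0"
      by (auto simp: shell_def rT qT zero_less_mult_iff ln_mult)
    moreover have "rho (T x) powr (- hdim / 2) = exp (- s * hdim / 2) * rho x powr (- hdim / 2)"
      unfolding rT using rho_nonneg[of x] by (simp add: powr_mult) (simp add: powr_def)
    ultimately show ?thesis by (auto simp: shell_density_def indicator_def)
  qed
  then have "(LINT x|lborel. shell_density r s (T x)) = exp (- s * hdim / 2) * shell_mass r"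
    by (simp add: shell_mass_def)
  then show ?thesis
    using lborel_integral_diagonal[OF shell_density_measurable, of "\<lambda>i. if wt i = 1 then k else 1" r s] k
    unfolding prod T_def by (simp add: exp_minus)
qed

lemma shell_mass_pos:
  assumes "hdim > 0" "r > 0"
  shows "shell_mass r > 0"
proof -
  let ?O = "{x. 1 < rho x \<and> rho x < exp 1 \<and> vert_sq x < r}"
  have "continuous_on UNIV rho" "continuous_on UNIV vert_sq"
    using Ck_on_continuous[OF Ck_on_rho] Ck_on_continuous[OF Ck_on_vert_sq] by auto
  then have "open ?O"
    by (intro open_Collect_conj open_Collect_less) (auto intro: continuous_intros)
  have "{j. wt j = 1} \<noteq> {}"
  proof
    assume "{j. wt j = 1} = {}"
    then have "hdim = 0" unfolding hdim_def by (simp only: card.empty of_nat_0)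
    with assms(1) show False by simp
  qed
  then obtain j where j: "wt j = 1" by auto
  define x0 :: "real^'n" where "x0 = axis j (sqrt (3 / 2))"
  have "rho x0 = (\<Sum>i | wt i = 1. if i = j then 3 / 2 else 0)"
    unfolding rho_def x0_def by (intro sum.cong) (auto simp: axis_def)
  then have "rho x0 = 3 / 2" using j by simp
  moreover have "vert_sq x0 = 0" unfolding vert_sq_def x0_def using j by (intro sum.neutral) (auto simp: axis_def)
  moreover have "(3 / 2 :: real) < exp 1" using exp_ge_add_one_self[of 1] by simp
  ultimately have "x0 \<in> ?O" using assms by simp
  with \<open>open ?O\<close> obtain e where e: "e > 0" "ball x0 e \<subseteq> ?O" by (rule openE)
  have "0 < exp (- hdim / 2) * measure lborel (ball x0 e)"
    using content_ball_pos[OF e(1)] by (simp add: measure_completion)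
  also have "\<dots> = (LINT x|lborel. exp (- hdim / 2) * indicator (ball x0 e) x)" by simp
  also have "\<dots> \<le> (LINT x|lborel. shell_density r 0 x)"
  proof (rule integral_mono[OF _ integrable_shell_density])
    show "integrable lborel (\<lambda>x. exp (- hdim / 2) * indicator (ball x0 e) x)"
      using emeasure_bounded_finite[OF bounded_ball, of x0 e]
      by (intro integrable_mult_right integrable_real_indicator) auto
    fix x
    show "exp (- hdim / 2) * indicator (ball x0 e) x \<le> shell_density r 0 x"
    proof (cases "x \<in> ball x0 e")
      case True
      then have x: "1 < rho x" "rho x < exp 1" "vert_sq x < r" using e(2) by auto
      then have l: "0 < ln (rho x)" "ln (rho x) < 1" using ln_less_cancel_iff[of "rho x" "exp 1"] by auto
      then have "x \<in> shell r 0" using x by (auto simp: shell_def)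
      moreover have "exp (- hdim / 2) \<le> rho x powr (- hdim / 2)"
        using x l assms(1) by (simp add: powr_def)
      ultimately show ?thesis using True by (simp add: shell_density_def)
    qed (simp add: shell_density_nonneg)
  qed
  finally show ?thesis by (simp add: shell_mass_def)
qed

end

section \<open>Almost extremal functions\<close>

lemma Cauchy_power2_add_le:
  fixes a b t :: real
  assumes "t > 0"
  shows "(a - b)\<^sup>2 \<le> (1 + 1 / t) * a\<^sup>2 + (1 + t) * b\<^sup>2"
proof -
  have "0 \<le> (a / sqrt t + sqrt t * b)\<^sup>2" by simp
  also have "\<dots> = a\<^sup>2 / t + 2 * a * b + t * b\<^sup>2"
    using assms by (simp add: power2_sum power_divide power_mult_distrib)
  finally show ?thesis by (simp add: power2_diff algebra_simps)
qed

lemma power2_sum3_le: "(a + b + c)\<^sup>2 \<le> 3 * (a\<^sup>2 + b\<^sup>2 + c\<^sup>2)" for a b c :: real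
proof -
  have "3 * (a\<^sup>2 + b\<^sup>2 + c\<^sup>2) - (a + b + c)\<^sup>2 = (a - b)\<^sup>2 + (b - c)\<^sup>2 + (c - a)\<^sup>2"
    by (simp add: power2_eq_square algebra_simps)
  then show ?thesis by (smt (verit) zero_le_power2)
qed

lemma power2_sum2_le: "(a + b)\<^sup>2 \<le> 2 * (a\<^sup>2 + b\<^sup>2)" for a b :: real
proof -
  have "2 * (a\<^sup>2 + b\<^sup>2) - (a + b)\<^sup>2 = (a - b)\<^sup>2"
    by (simp add: power2_eq_square algebra_simps)
  then show ?thesis by (smt (verit) zero_le_power2)
qed

context horizontal_frame
begin

lemma sublap_mult:
  fixes v b :: "real^'n \<Rightarrow> real"
  assumes x: "x \<in> punctured" and v: "Ck_on 2 punctured v" and b: "Ck_on 2 punctured b"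
  shows "sublap (\<lambda>x. v x * b x) x = sublap v x * b x + v x * sublap b x
    - 2 * (\<Sum>j | wt j = 1. apply_field (X j) v x * apply_field (X j) b x)"
proof -
  have v2: "Ck_on (Suc (Suc 0)) punctured v" and b2: "Ck_on (Suc (Suc 0)) punctured b"
    using v b by (simp_all only: numeral_2_eq_2)
  have d: "v differentiable at y" "b differentiable at y" if "y \<in> punctured" for y using v2 b2 that by simp_all
  have dX: "apply_field (X j) v differentiable at y" "apply_field (X j) b differentiable at y" if "wt j = 1" "y \<in> punctured" for j y
    using Ck_on_apply_field[OF open_punctured v2 Ck_on_subset[OF Ck_on_X[OF that(1)]]]
      Ck_on_apply_field[OF open_punctured b2 Ck_on_subset[OF Ck_on_X[OF that(1)]]] that(2) by simp_all
  have XX: "apply_field (X j) (apply_field (X j) (\<lambda>x. v x * b x)) x =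
      apply_field (X j) (apply_field (X j) v) x * b x + v x * apply_field (X j) (apply_field (X j) b) x
      + 2 * (apply_field (X j) v x * apply_field (X j) b x)" if j: "wt j = 1" for j
  proof -
    let ?f = "\<lambda>y. v y * apply_field (X j) b y + apply_field (X j) v y * b y"
    have eq: "apply_field (X j) (\<lambda>x. v x * b x) y = ?f y" if "y \<in> punctured" for y
      by (rule apply_field_mult[OF d[OF that]])
    have p: "(\<lambda>y. v y * apply_field (X j) b y) differentiable at x"
      "(\<lambda>y. apply_field (X j) v y * b y) differentiable at x"
      using d[OF x] dX[OF j x] by (simp_all add: differentiable_mult)
    have "apply_field (X j) (apply_field (X j) (\<lambda>x. v x * b x)) x = apply_field (X j) ?f x"
      by (rule apply_field_cong[OF open_punctured x, symmetric])
        (use eq differentiable_add[OF p] in auto)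
    also have "\<dots> = (v x * apply_field (X j) (apply_field (X j) b) x + apply_field (X j) v x * apply_field (X j) b x)
       + (apply_field (X j) v x * apply_field (X j) b x + apply_field (X j) (apply_field (X j) v) x * b x)"
      by (simp only: apply_field_add[OF p] apply_field_mult[OF d(1)[OF x] dX(2)[OF j x]]
          apply_field_mult[OF dX(1)[OF j x] d(2)[OF x]])
    finally show ?thesis by simp
  qed
  show ?thesis
    unfolding sublap_def
    by (simp add: XX sum.distrib sum_distrib_left sum_distrib_right)
qed

text \<open>In the variable \<open>ln rho\<close> the horizontal sub-Laplacian has constant coefficients on profiles of
  this form, up to a factor \<open>1 / rho\<close>.\<close>

definition radial :: "real \<Rightarrow> (real \<Rightarrow> real) \<Rightarrow> real^'n \<Rightarrow> real" where
  "radial \<alpha> \<theta> x = rho x powr \<alpha> * \<theta> (ln (rho x))"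

lemma Ck_on_radial:
  assumes "Ck_on k UNIV \<theta>"
  shows "Ck_on k punctured (radial \<alpha> \<theta>)"
proof -
  have "Ck_on k punctured (\<lambda>x. ln (rho x))"
    by (rule Ck_on_compose_real[OF open_punctured Ck_on_ln Ck_on_subset[OF Ck_on_rho]]) (auto simp: punctured_def)
  from Ck_on_compose_real[OF open_punctured assms this] have "Ck_on k punctured (\<lambda>x. \<theta> (ln (rho x)))" by simp
  from Ck_on_mult[OF open_punctured Ck_on_rho_powr this] show ?thesis
    by (simp add: radial_def[abs_def])
qed

lemma radial_profile_has_derivative:
  fixes \<theta> :: "real \<Rightarrow> real"
  assumes "r > 0" "\<And>t. (\<theta> has_real_derivative \<theta>1 t) (at t)"
  shows "((\<lambda>r. r powr \<alpha> * \<theta> (ln r)) has_real_derivative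
    r powr (\<alpha> - 1) * (\<alpha> * \<theta> (ln r) + \<theta>1 (ln r))) (at r)"
proof -
  have "((\<lambda>r. \<theta> (ln r)) has_real_derivative \<theta>1 (ln r) * (1 / r)) (at r)"
    by (rule DERIV_chain2[OF assms(2)]) (use assms(1) in \<open>auto intro!: derivative_eq_intros\<close>)
  moreover have "((\<lambda>r. r powr \<alpha>) has_real_derivative \<alpha> * r powr (\<alpha> - 1)) (at r)"
    using assms(1) by (auto intro!: derivative_eq_intros)
  ultimately have "((\<lambda>r. r powr \<alpha> * \<theta> (ln r)) has_real_derivative
      \<alpha> * r powr (\<alpha> - 1) * \<theta> (ln r) + \<theta>1 (ln r) * (1 / r) * r powr \<alpha>) (at r)"
    by (intro DERIV_mult)
  moreover have "r powr \<alpha> = r * r powr (\<alpha> - 1)"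
    using assms(1) by (simp add: powr_mult_base)
  ultimately show ?thesis using assms(1) by (simp add: algebra_simps)
qed

lemma radial_differentiable:
  assumes "x \<in> punctured" "\<And>t. (\<theta> has_real_derivative \<theta>1 t) (at t)"
  shows "radial \<alpha> \<theta> differentiable at x"
proof -
  have "rho x > 0" using assms(1) by (simp add: punctured_def)
  from differentiable_compose_real[OF rho_differentiable radial_profile_has_derivative[OF this assms(2)]]
  show ?thesis by (simp add: radial_def[abs_def])
qed

lemma apply_field_X_radial:
  assumes j: "wt j = 1" and x: "x \<in> punctured" and \<theta>: "\<And>t. (\<theta> has_real_derivative \<theta>1 t) (at t)"
  shows "apply_field (X j) (radial \<alpha> \<theta>) x = 2 * x $ j * radial (\<alpha> - 1) (\<lambda>t. \<alpha> * \<theta> t + \<theta>1 t) x"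
proof -
  have "rho x > 0" using x by (simp add: punctured_def)
  from apply_field_compose_real[OF rho_differentiable radial_profile_has_derivative[OF this \<theta>], of "X j"]
  show ?thesis by (simp add: radial_def[abs_def] apply_field_X_rho[OF j])
qed

text \<open>For \<open>\<alpha> = - (N - 2\<delta> - 4) / 4\<close> the factor \<open>- \<alpha> (2N + 4\<alpha> - 4)\<close> of the undifferentiated profile is
  \<open>(N - 2\<delta> - 4) (N + 2\<delta>) / 4\<close>, the square root of the constant in the Rellich inequality.\<close>

lemma sublap_radial:
  assumes x: "x \<in> punctured" and \<theta>: "\<And>t. (\<theta> has_real_derivative \<theta>1 t) (at t)" "\<And>t. (\<theta>1 has_real_derivative \<theta>2 t) (at t)"
  shows "sublap (radial \<alpha> \<theta>) x =
    - radial (\<alpha> - 1) (\<lambda>t. 4 * \<theta>2 t + (2 * hdim + 8 * \<alpha> - 4) * \<theta>1 t + \<alpha> * (2 * hdim + 4 * \<alpha> - 4) * \<theta> t) x"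
proof -
  define \<eta> where "\<eta> t = \<alpha> * \<theta> t + \<theta>1 t" for t
  define \<eta>1 where "\<eta>1 t = \<alpha> * \<theta>1 t + \<theta>2 t" for t
  have \<eta>: "(\<eta> has_real_derivative \<eta>1 t) (at t)" for t
    unfolding \<eta>_def[abs_def] \<eta>1_def by (intro DERIV_add DERIV_cmult \<theta>)
  have r: "rho x > 0" using x by (simp add: punctured_def)
  note diff = radial_differentiable[OF _ \<eta>, of _ "\<alpha> - 1"]
  have XX: "apply_field (X j) (apply_field (X j) (radial \<alpha> \<theta>)) x =
      2 * radial (\<alpha> - 1) \<eta> x + 4 * (x $ j)\<^sup>2 * radial (\<alpha> - 2) (\<lambda>t. (\<alpha> - 1) * \<eta> t + \<eta>1 t) x"
    if j: "wt j = 1" for j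
  proof -
    have d2: "(\<lambda>y::real^'n. 2 * y $ j) differentiable at x"
      by (intro differentiable_mult differentiable_const nth_differentiable)
    have a2: "apply_field (X j) (\<lambda>y. 2 * y $ j) x = 2"
      by (subst apply_field_mult[OF differentiable_const nth_differentiable])
        (simp add: apply_field_X_nth[OF j j])
    have "apply_field (X j) (apply_field (X j) (radial \<alpha> \<theta>)) x =
        apply_field (X j) (\<lambda>y. 2 * y $ j * radial (\<alpha> - 1) \<eta> y) x"
      by (rule apply_field_cong[OF open_punctured x, symmetric])
        (use apply_field_X_radial[OF j _ \<theta>(1), of _ \<alpha>] differentiable_mult[OF d2 diff[OF x]]
          in \<open>auto simp: \<eta>_def[abs_def]\<close>)
    also have "\<dots> = 2 * x $ j * apply_field (X j) (radial (\<alpha> - 1) \<eta>) x + 2 * radial (\<alpha> - 1) \<eta> x"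
      by (simp only: apply_field_mult[OF d2 diff[OF x]] a2)
    also have "apply_field (X j) (radial (\<alpha> - 1) \<eta>) x = 2 * x $ j * radial (\<alpha> - 1 - 1) (\<lambda>t. (\<alpha> - 1) * \<eta> t + \<eta>1 t) x"
      by (rule apply_field_X_radial[OF j x \<eta>])
    finally show ?thesis by (simp add: power2_eq_square)
  qed
  have "sublap (radial \<alpha> \<theta>) x =
      - (\<Sum>j | wt j = 1. 2 * radial (\<alpha> - 1) \<eta> x + 4 * (x $ j)\<^sup>2 * radial (\<alpha> - 2) (\<lambda>t. (\<alpha> - 1) * \<eta> t + \<eta>1 t) x)"
    by (simp add: sublap_def XX)
  also have "\<dots> = - (hdim * (2 * radial (\<alpha> - 1) \<eta> x) + 4 * rho x * radial (\<alpha> - 2) (\<lambda>t. (\<alpha> - 1) * \<eta> t + \<eta>1 t) x)"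
    by (simp add: sum.distrib hdim_def rho_def sum_distrib_left sum_distrib_right)
  finally have eq: "sublap (radial \<alpha> \<theta>) x = \<dots>" .
  have rr: "rho x * radial (\<alpha> - 2) f x = radial (\<alpha> - 1) f x" for f
    using r powr_mult_base[of "rho x" "\<alpha> - 2"] by (simp add: radial_def mult.assoc[symmetric])
  show ?thesis
    unfolding eq mult.assoc rr by (simp add: radial_def \<eta>_def \<eta>1_def algebra_simps)
qed

lemma sum_shell_density:
  "(\<Sum>j<n. shell_density r (a + real j) x) =
    (if rho x > 0 \<and> vert_sq x \<le> r \<and> a \<le> ln (rho x) \<and> ln (rho x) < a + real n then rho x powr (- hdim / 2) else 0)"
  by (induction n) (auto simp: shell_density_def shell_def indicator_def)

text \<open>The cut-off \<open>b\<close> depends on the coordinates outside the first stratum only, but the fields need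
  not annihilate it. The bounds express that the resulting terms gain a factor of \<open>rho\<close> near the centre:
  the mixed term is controlled by \<open>|S|\<^sup>2 \<le> rho (\<Sum>j. (X\<^sub>j b)\<^sup>2)\<close>.\<close>

lemma cutoff_bounds:
  fixes c :: real
  defines "b \<equiv> \<lambda>x. smooth_step (2 - vert_sq x)"
  defines "S \<equiv> \<lambda>x. \<Sum>j | wt j = 1. x $ j * apply_field (X j) b x"
  obtains M where "M \<ge> 0" "\<And>x. rho x \<le> 1 \<Longrightarrow> (S x)\<^sup>2 \<le> M * rho x"
    "\<And>x. rho x \<le> 1 \<Longrightarrow> (c * b x + sublap b x)\<^sup>2 \<le> M"
    "\<And>x. vert_sq x > 2 \<Longrightarrow> b x = 0 \<and> S x = 0 \<and> sublap b x = 0" "\<And>k. Ck_on k UNIV b"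
proof -
  have Cb: "Ck_on k UNIV b" for k
    unfolding b_def
    by (rule Ck_on_compose_real[OF open_UNIV Ck_on_smooth_step]) (auto intro!: Ck_on_diff Ck_on_vert_sq)
  define K where "K = {x. rho x \<le> 1 \<and> vert_sq x \<le> 2}"
  have cont: "continuous_on UNIV rho" "continuous_on UNIV vert_sq"
    using Ck_on_continuous[OF Ck_on_rho] Ck_on_continuous[OF Ck_on_vert_sq] by auto
  have clo: "closed {x. vert_sq x \<le> 2}" by (intro closed_Collect_le cont continuous_on_const)
  have "closed K" unfolding K_def by (intro closed_Collect_conj closed_Collect_le cont continuous_on_const)
  moreover have "bounded K"
  proof (rule boundedI)
    fix x assume "x \<in> K"
    then have "(norm x)\<^sup>2 \<le> 3" by (auto simp: norm_eq_rho_vert_sq K_def)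
    then show "norm x \<le> sqrt 3" by (rule real_le_rsqrt)
  qed
  ultimately have K: "compact K" by (simp add: compact_eq_bounded_closed)
  have z: "b x = 0" if "x \<notin> {x. vert_sq x \<le> 2}" for x
    using that by (simp add: b_def smooth_step_0)
  have zero: "b x = 0 \<and> S x = 0 \<and> sublap b x = 0" if "vert_sq x > 2" for x
  proof -
    have x: "x \<notin> {x. vert_sq x \<le> 2}" using that by simp
    show ?thesis
      using sublap_eq_0(1)[OF clo z x] sublap_eq_0(3)[OF clo z x] z[OF x] by (simp add: S_def)
  qed
  let ?p = "\<lambda>x. \<Sum>j | wt j = 1. (apply_field (X j) b x)\<^sup>2"
  have "continuous_on UNIV (apply_field (X j) b)" if "wt j = 1" for j
    using Ck_on_continuous[OF Ck_on_X_apply[OF that Cb]] .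
  then have cp: "continuous_on UNIV ?p" by (intro continuous_on_sum continuous_on_power) auto
  have cL: "continuous_on UNIV (\<lambda>x. (c * b x + sublap b x)\<^sup>2)"
    using Ck_on_continuous[OF Cb] Ck_on_continuous[OF Ck_on_sublap[OF Cb]]
    by (intro continuous_on_power continuous_on_add continuous_on_mult continuous_on_const)
  obtain M1 where M1: "\<And>x. x \<in> K \<Longrightarrow> \<bar>?p x\<bar> \<le> M1"
    using compact_imp_bounded[OF compact_continuous_image[OF continuous_on_subset[OF cp] K]]
    unfolding bounded_iff by auto
  obtain M2 where M2: "\<And>x. x \<in> K \<Longrightarrow> \<bar>(c * b x + sublap b x)\<^sup>2\<bar> \<le> M2"
    using compact_imp_bounded[OF compact_continuous_image[OF continuous_on_subset[OF cL] K]]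
    unfolding bounded_iff by auto
  let ?M = "max 0 (max M1 M2)"
  show ?thesis
  proof (rule that[of ?M])
    fix x assume x: "rho x \<le> 1"
    show "(S x)\<^sup>2 \<le> ?M * rho x"
    proof (cases "vert_sq x > 2")
      case True then show ?thesis using zero[of x] rho_nonneg[of x] by simp
    next
      case False
      have "(S x)\<^sup>2 \<le> (\<Sum>j | wt j = 1. (x $ j)\<^sup>2) * ?p x"
        unfolding S_def by (rule Cauchy_Schwarz_ineq_sum)
      also have "\<dots> \<le> rho x * ?M"
        unfolding rho_def[symmetric] using M1[of x] x False
        by (intro mult_left_mono rho_nonneg) (auto simp: K_def)
      finally show ?thesis by (simp add: mult.commute)
    qed
    show "(c * b x + sublap b x)\<^sup>2 \<le> ?M"
      using zero[of x] M2[of x] x by (cases "vert_sq x > 2") (auto simp: K_def)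
  qed (use zero Cb in auto)
qed

text \<open>The trial functions are \<open>u = rho powr \<alpha> * \<theta> (ln rho) * b\<close>. Without cut-offs, \<open>rho powr \<alpha>\<close> would give
  equality in the Rellich inequality, but its moment diverges logarithmically at the centre. The
  profile \<open>\<theta>\<close> is \<open>1\<close> on an interval of length about \<open>m\<close> and has support in \<open>[- 2m, - m]\<close>. The leading
  moment therefore grows like \<open>m\<close> shell masses; terms with a derivative of \<open>\<theta>\<close> live on the two end
  shells, and terms with an extra factor \<open>rho \<le> exp (- m)\<close> contribute at most \<open>m exp (- m)\<close>. Hence
  the error is bounded by a constant \<open>C\<close> independent of \<open>m\<close>. The parameter \<open>t\<close> comes from Young's
  inequality and is chosen in terms of \<open>m\<close> afterwards.\<close>

lemma near_optimizers:
  fixes \<delta> c :: real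
  assumes hdim: "hdim > 0"
  defines "A \<equiv> (hdim - 2 * \<delta> - 4) * (hdim + 2 * \<delta>) / 4"
  obtains V C where "V > 0" "C \<ge> 0"
    "\<And>m::nat. m \<ge> 3 \<Longrightarrow> \<exists>u :: real^'n \<Rightarrow> real. admissible u \<and>
       (real m - 2) * V \<le> moment u (\<delta> + 2) \<and>
       moment u (\<delta> + 1) \<le> exp (- real m) * moment u (\<delta> + 2) \<and>
       (\<forall>t>0. moment (\<lambda>x. sublap u x + c *\<^sub>R u x) \<delta>
          \<le> (1 + 1 / t) * (A\<^sup>2 * moment u (\<delta> + 2)) + (1 + t) * C)"
proof -
  define \<alpha> where "\<alpha> = - (hdim - 2 * \<delta> - 4) / 4"
  define k where "k = 2 * hdim + 8 * \<alpha> - 4"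
  have A: "\<alpha> * (2 * hdim + 4 * \<alpha> - 4) = - A"
    by (simp add: A_def \<alpha>_def field_simps)
  obtain s1 s2 M1 where
    s1: "\<And>t. (smooth_step has_real_derivative s1 t) (at t)" and
    s2: "\<And>t. (s1 has_real_derivative s2 t) (at t)" and
    z1: "\<And>t. t \<le> 0 \<or> t \<ge> 1 \<Longrightarrow> s1 t = 0" and z2: "\<And>t. t \<le> 0 \<or> t \<ge> 1 \<Longrightarrow> s2 t = 0" and
    M1: "\<And>t. \<bar>s1 t\<bar> \<le> M1" "\<And>t. \<bar>s2 t\<bar> \<le> M1"
    using smooth_step_derivatives by blast
  define b where "b = (\<lambda>x. smooth_step (2 - vert_sq x))"
  define S where "S = (\<lambda>x. \<Sum>j | wt j = 1. x $ j * apply_field (X j) b x)"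
  obtain M where M: "M \<ge> 0" "\<And>x. rho x \<le> 1 \<Longrightarrow> (S x)\<^sup>2 \<le> M * rho x"
    "\<And>x. rho x \<le> 1 \<Longrightarrow> (c * b x + sublap b x)\<^sup>2 \<le> M"
    "\<And>x. vert_sq x > 2 \<Longrightarrow> b x = 0 \<and> S x = 0 \<and> sublap b x = 0" "\<And>k. Ck_on k UNIV b"
    using cutoff_bounds[of c] unfolding S_def b_def by blast
  have b1: "b x = 1" if "vert_sq x \<le> 1" for x using that by (simp add: b_def smooth_step_1)
  have bb: "(b x)\<^sup>2 \<le> 1" for x
    unfolding b_def by (rule power_le_one) (rule smooth_step_bounds)+
  define C1 where "C1 = 3 * (32 + 2 * k\<^sup>2 + 32 * M + 32 * M * \<alpha>\<^sup>2 + M)"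
  have C1: "C1 \<ge> 0" using M(1) by (simp add: C1_def)
  define C where "C = C1 * (8 * M1\<^sup>2 + 1) * (3 * shell_mass 2)"
  have V2: "shell_mass 2 > 0" and V1: "shell_mass 1 > 0" using shell_mass_pos[OF hdim] by auto
  show ?thesis
  proof (rule that[of "shell_mass 1" C])
    show "shell_mass 1 > 0" by (rule V1)
    show "C \<ge> 0" using C1 V2 by (simp add: C_def)
    fix m :: nat assume m: "m \<ge> 3"
    define \<theta> where "\<theta> t = smooth_step (t + 2 * real m) - smooth_step (t + real m + 1)" for t
    define \<theta>1 where "\<theta>1 t = s1 (t + 2 * real m) - s1 (t + real m + 1)" for t
    define \<theta>2 where "\<theta>2 t = s2 (t + 2 * real m) - s2 (t + real m + 1)" for t
    have \<theta>': "(\<theta> has_real_derivative \<theta>1 t) (at t)" "(\<theta>1 has_real_derivative \<theta>2 t) (at t)" for t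
      unfolding \<theta>_def[abs_def] \<theta>1_def[abs_def] \<theta>2_def
      using s1 s2 by (auto intro!: DERIV_diff simp: DERIV_shift[symmetric] add.assoc)
    have C\<theta>: "Ck_on k UNIV \<theta>" for k
    proof -
      have "Ck_on k UNIV (\<lambda>t. smooth_step (t + d))" for d
        using Ck_on_compose_real[OF open_UNIV Ck_on_smooth_step Ck_on_affine[of k d 1]] by (simp add: add.commute)
      from Ck_on_diff[OF open_UNIV this[of "2 * real m"] this[of "real m + 1"]]
      show ?thesis by (simp add: \<theta>_def[abs_def] add.assoc)
    qed
    have outer: "\<theta> t = 0 \<and> \<theta>1 t = 0 \<and> \<theta>2 t = 0" if "t \<le> - 2 * real m \<or> t \<ge> - real m" for t
      using that m by (auto simp: \<theta>_def \<theta>1_def \<theta>2_def smooth_step_0 smooth_step_1 z1 z2)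
    have inner: "\<theta> t = 1" if "- 2 * real m + 1 \<le> t" "t \<le> - real m - 1" for t
      using that by (simp add: \<theta>_def smooth_step_0 smooth_step_1)
    have \<theta>_le: "(\<theta> t)\<^sup>2 \<le> 1" for t
      using smooth_step_bounds[of "t + 2 * real m"] smooth_step_bounds[of "t + real m + 1"]
      by (simp add: \<theta>_def abs_square_le_1)
    have M1_sq: "(s1 t)\<^sup>2 \<le> M1\<^sup>2" "(s2 t)\<^sup>2 \<le> M1\<^sup>2" for t
      using M1[of t] by (auto intro: power2_le_iff_abs_le[THEN iffD2] order.trans[OF abs_ge_zero] simp: abs_le_square_iff[symmetric])
    have deriv_le: "(\<theta>1 t)\<^sup>2 + (\<theta>2 t)\<^sup>2 \<le> 8 * M1\<^sup>2" for t
      using power2_sum2_le[of "s1 (t + 2 * real m)" "- s1 (t + real m + 1)"]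
        power2_sum2_le[of "s2 (t + 2 * real m)" "- s2 (t + real m + 1)"]
        M1_sq[of "t + 2 * real m"] M1_sq[of "t + real m + 1"]
      unfolding \<theta>1_def \<theta>2_def by simp
    have deriv_0: "\<theta>1 t = 0 \<and> \<theta>2 t = 0" if "- 2 * real m + 1 \<le> t" "t \<le> - real m - 1" for t
      using that by (auto simp: \<theta>1_def \<theta>2_def z1 z2)
    define u where "u x = radial \<alpha> \<theta> x * b x" for x
    define K where "K = {x. exp (- 2 * real m) \<le> rho x \<and> rho x \<le> exp (- real m) \<and> vert_sq x \<le> 2}"
    have cont: "continuous_on UNIV rho" "continuous_on UNIV vert_sq"
      using Ck_on_continuous[OF Ck_on_rho] Ck_on_continuous[OF Ck_on_vert_sq] by auto
    have "closed K" unfolding K_def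
      by (intro closed_Collect_conj closed_Collect_le cont continuous_on_const)
    moreover have "bounded K"
    proof (rule boundedI)
      fix x assume x: "x \<in> K"
      have "exp (- real m) \<le> 1" by simp
      moreover have "rho x \<le> exp (- real m)" "vert_sq x \<le> 2" using x by (auto simp: K_def)
      ultimately have "(norm x)\<^sup>2 \<le> 3" unfolding norm_eq_rho_vert_sq by linarith
      then show "norm x \<le> sqrt 3" by (rule real_le_rsqrt)
    qed
    ultimately have K: "compact K" by (simp add: compact_eq_bounded_closed)
    have KU: "K \<subseteq> punctured"
    proof
      fix x assume "x \<in> K"
      then have "exp (- 2 * real m) \<le> rho x" by (simp add: K_def)
      with exp_gt_zero[of "- 2 * real m"] show "x \<in> punctured" unfolding punctured_def mem_Collect_eq by linarith
    qed
    have u0: "u x = 0" if "x \<notin> K" for x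
    proof -
      have "rho x < exp (- 2 * real m) \<or> exp (- real m) < rho x \<or> vert_sq x > 2"
        using that by (auto simp: K_def)
      then consider "rho x = 0" | "vert_sq x > 2" | "rho x > 0" "rho x < exp (- 2 * real m)" | "rho x > 0" "rho x > exp (- real m)"
        using rho_nonneg[of x] by (cases "rho x = 0") (auto simp: less_le)
      then show ?thesis
      proof cases
        case 1 then show ?thesis by (simp add: u_def radial_def)
      next
        case 2 then show ?thesis using M(4) by (simp add: u_def)
      next
        case 3
        then have "ln (rho x) \<le> - 2 * real m" by (metis exp_le_cancel_iff exp_ln less_imp_le)
        then show ?thesis using outer by (simp add: u_def radial_def)
      next
        case 4
        then have "ln (rho x) \<ge> - real m" by (metis exp_le_cancel_iff exp_ln less_imp_le)
        then show ?thesis using outer by (simp add: u_def radial_def)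
      qed
    qed
    have Cu: "Ck_on k UNIV u" for k
    proof (rule Ck_on_zero_extend[OF open_punctured compact_imp_closed[OF K] KU _ u0])
      show "Ck_on k punctured u" unfolding u_def[abs_def]
        by (intro Ck_on_mult Ck_on_radial C\<theta> Ck_on_subset[OF M(5)] open_punctured) simp
    qed
    have adm: "admissible u" unfolding admissible_def smooth_on_def
      using Cu K KU u0 by auto
    define w where "w x = rho x powr (- hdim / 2)" for x
    define T where "T x = \<theta> (ln (rho x)) * b x" for x
    \<comment> \<open>\<open>E\<close> collects the error terms in \<open>L u + c u = rho powr (\<alpha> - 1) * (A * T - E)\<close>.\<close>
    define E where "E x = (4 * \<theta>2 (ln (rho x)) + k * \<theta>1 (ln (rho x))) * b x
       + 4 * (\<alpha> * \<theta> (ln (rho x)) + \<theta>1 (ln (rho x))) * S x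
       + (- (rho x * \<theta> (ln (rho x)) * (c * b x + sublap b x)))" for x
    \<comment> \<open>The choice of \<open>\<alpha>\<close> turns every weight into the scale invariant density.\<close>
    have P: "rho x powr (2 * \<alpha> - \<delta> - 2) = w x" for x
      by (simp add: w_def \<alpha>_def field_simps)
    have u2: "(u x)\<^sup>2 * rho x powr (- (\<delta> + 2)) = w x * (T x)\<^sup>2"
      and u1: "(u x)\<^sup>2 * rho x powr (- (\<delta> + 1)) = rho x * (w x * (T x)\<^sup>2)"
      if x: "x \<in> punctured" for x
    proof -
      have r: "rho x > 0" using x by (simp add: punctured_def)
      have "rho x powr \<alpha> * rho x powr \<alpha> * rho x powr (- (\<delta> + 2)) = w x"
        unfolding P[symmetric] by (simp add: powr_add[symmetric] algebra_simps)
      then show *: "(u x)\<^sup>2 * rho x powr (- (\<delta> + 2)) = w x * (T x)\<^sup>2"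
        by (simp add: u_def radial_def T_def power2_eq_square mult_ac)
      have "rho x powr (- (\<delta> + 1)) = rho x * rho x powr (- (\<delta> + 2))"
        using r by (simp add: powr_mult_base algebra_simps)
      then show "(u x)\<^sup>2 * rho x powr (- (\<delta> + 1)) = rho x * (w x * (T x)\<^sup>2)"
        using * by simp
    qed
    have Lu: "(sublap u x + c *\<^sub>R u x)\<^sup>2 * rho x powr (- \<delta>) = w x * (A * T x - E x)\<^sup>2"
      if x: "x \<in> punctured" for x
    proof -
      have r: "rho x > 0" using x by (simp add: punctured_def)
      let ?t = "ln (rho x)"
      define p where "p = rho x powr (\<alpha> - 1)"
      have p\<alpha>: "rho x powr \<alpha> = rho x * p" using r by (simp add: p_def powr_mult_base)
      have "sublap u x = sublap (radial \<alpha> \<theta>) x * b x + radial \<alpha> \<theta> x * sublap b x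
          - 2 * (\<Sum>j | wt j = 1. apply_field (X j) (radial \<alpha> \<theta>) x * apply_field (X j) b x)"
        unfolding u_def[abs_def] by (rule sublap_mult[OF x Ck_on_radial[OF C\<theta>] Ck_on_subset[OF M(5)]]) simp
      also have "sublap (radial \<alpha> \<theta>) x = - (p * (4 * \<theta>2 ?t + k * \<theta>1 ?t - A * \<theta> ?t))"
        unfolding sublap_radial[OF x \<theta>'] A radial_def k_def p_def by simp
      also have "(\<Sum>j | wt j = 1. apply_field (X j) (radial \<alpha> \<theta>) x * apply_field (X j) b x) =
          2 * p * (\<alpha> * \<theta> ?t + \<theta>1 ?t) * S x"
        unfolding S_def sum_distrib_left
        by (intro sum.cong) (simp_all add: apply_field_X_radial[OF _ x \<theta>'(1)] radial_def p_def)
      finally have L: "sublap u x = - (p * (4 * \<theta>2 ?t + k * \<theta>1 ?t - A * \<theta> ?t)) * b x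
          + radial \<alpha> \<theta> x * sublap b x - 2 * (2 * p * (\<alpha> * \<theta> ?t + \<theta>1 ?t) * S x)" .
      have "sublap u x + c *\<^sub>R u x = p * (A * T x - E x)"
        unfolding L T_def E_def u_def radial_def p\<alpha> by (simp add: algebra_simps)
      moreover have "p * p * rho x powr (- \<delta>) = w x"
        unfolding P[symmetric] p_def by (simp add: powr_add[symmetric] algebra_simps)
      ultimately show ?thesis by (simp add: power_mult_distrib power2_eq_square[of p] mult_ac)
    qed
    have w0: "w x \<ge> 0" for x by (simp add: w_def)
    \<comment> \<open>A combination of shells that dominates the error; its integral stays bounded because \<open>m exp (- m) \<le> 1\<close>.\<close>
    define G where "G x = shell_density 2 (- 2 * real m) x + shell_density 2 (- real m - 1) x
        + exp (- real m) * (\<Sum>j<m. shell_density 2 (- 2 * real m + real j) x)" for x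
    have G0: "G x \<ge> 0" for x unfolding G_def
      by (intro add_nonneg_nonneg mult_nonneg_nonneg sum_nonneg shell_density_nonneg) simp
    have intG: "integrable lborel G" unfolding G_def
      by (intro Bochner_Integration.integrable_add integrable_mult_right Bochner_Integration.integrable_sum
          integrable_shell_density)
    have "(LINT x|lborel. G x) = 2 * shell_mass 2 + exp (- real m) * real m * shell_mass 2"
      unfolding G_def
      by (simp add: integrable_shell_density integral_shell_density Bochner_Integration.integrable_sum)
    also have "\<dots> \<le> 3 * shell_mass 2"
    proof -
      have "real m \<le> exp (real m)" using exp_ge_add_one_self[of "real m"] by linarith
      then have "exp (- real m) * real m \<le> 1" by (simp add: exp_minus field_simps)
      from mult_right_mono[OF this, of "shell_mass 2"] V2 show ?thesis by simp
    qed
    finally have IG: "(LINT x|lborel. G x) \<le> 3 * shell_mass 2" .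
    have EG: "w x * (E x)\<^sup>2 \<le> C1 * (8 * M1\<^sup>2 + 1) * G x" if x: "x \<in> punctured" for x
    proof -
      have r: "rho x > 0" using x by (simp add: punctured_def)
      let ?t = "ln (rho x)"
      \<comment> \<open>The error vanishes off the support of the profile and of the cut-off.\<close>
      consider "?t \<le> - 2 * real m \<or> ?t \<ge> - real m" | "vert_sq x > 2" | "- 2 * real m < ?t" "?t < - real m" "vert_sq x \<le> 2"
        by linarith
      then show ?thesis
      proof cases
        case 1
        then have "E x = 0" using outer[of ?t] by (simp add: E_def)
        then show ?thesis using G0[of x] C1 by simp
      next
        case 2
        then have "E x = 0" using M(4) by (simp add: E_def)
        then show ?thesis using G0[of x] C1 by simp
      next
        case 3
        have rm: "rho x \<le> exp (- real m)" using 3(2) r by (metis exp_le_cancel_iff exp_ln less_imp_le)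
        then have r1: "rho x \<le> 1" using order_trans by fastforce
        let ?a = "\<theta> ?t" and ?a1 = "\<theta>1 ?t" and ?a2 = "\<theta>2 ?t"
        have e1: "((4 * ?a2 + k * ?a1) * b x)\<^sup>2 \<le> 32 * ?a2\<^sup>2 + 2 * k\<^sup>2 * ?a1\<^sup>2"
        proof -
          have "((4 * ?a2 + k * ?a1) * b x)\<^sup>2 \<le> (4 * ?a2 + k * ?a1)\<^sup>2 * 1"
            unfolding power_mult_distrib by (rule mult_left_mono[OF bb]) simp
          also have "\<dots> \<le> 2 * ((4 * ?a2)\<^sup>2 + (k * ?a1)\<^sup>2)" unfolding mult_1_right by (rule power2_sum2_le)
          finally show ?thesis by (simp add: power_mult_distrib)
        qed
        have e2: "(4 * (\<alpha> * ?a + ?a1) * S x)\<^sup>2 \<le> 32 * M * \<alpha>\<^sup>2 * (rho x * ?a\<^sup>2) + 32 * M * ?a1\<^sup>2"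
        proof -
          have "(4 * (\<alpha> * ?a + ?a1) * S x)\<^sup>2 = 16 * (\<alpha> * ?a + ?a1)\<^sup>2 * (S x)\<^sup>2"
            unfolding power_mult_distrib by simp
          also have "\<dots> \<le> 16 * (2 * ((\<alpha> * ?a)\<^sup>2 + ?a1\<^sup>2)) * (M * rho x)"
            using M(2)[OF r1] by (intro mult_mono mult_left_mono power2_sum2_le) auto
          also have "\<dots> = 32 * M * \<alpha>\<^sup>2 * (rho x * ?a\<^sup>2) + 32 * M * ?a1\<^sup>2 * rho x"
            by (simp add: power_mult_distrib algebra_simps)
          also have "\<dots> \<le> 32 * M * \<alpha>\<^sup>2 * (rho x * ?a\<^sup>2) + 32 * M * ?a1\<^sup>2"
            using mult_left_mono[OF r1, of "32 * M * ?a1\<^sup>2"] M(1) by simp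
          finally show ?thesis .
        qed
        have e3: "(- (rho x * ?a * (c * b x + sublap b x)))\<^sup>2 \<le> M * (rho x * ?a\<^sup>2)"
        proof -
          have "(- (rho x * ?a * (c * b x + sublap b x)))\<^sup>2 = rho x * (rho x * ?a\<^sup>2) * (c * b x + sublap b x)\<^sup>2"
            unfolding power2_minus power_mult_distrib power2_eq_square[of "rho x"] by simp
          also have "\<dots> \<le> 1 * (rho x * ?a\<^sup>2) * M"
            using M(3)[OF r1] r1 r by (intro mult_mono) auto
          finally show ?thesis by (simp only: mult_1 mult.commute)
        qed
        have "(E x)\<^sup>2 \<le> 3 * ((32 * ?a2\<^sup>2 + 2 * k\<^sup>2 * ?a1\<^sup>2)
            + (32 * M * \<alpha>\<^sup>2 * (rho x * ?a\<^sup>2) + 32 * M * ?a1\<^sup>2) + M * (rho x * ?a\<^sup>2))"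
          unfolding E_def by (rule order_trans[OF power2_sum3_le]) (use e1 e2 e3 in simp)
        also have "\<dots> \<le> C1 * (?a1\<^sup>2 + ?a2\<^sup>2 + rho x * ?a\<^sup>2)"
        proof -
          have "C1 * (?a1\<^sup>2 + ?a2\<^sup>2 + rho x * ?a\<^sup>2) - 3 * ((32 * ?a2\<^sup>2 + 2 * k\<^sup>2 * ?a1\<^sup>2)
            + (32 * M * \<alpha>\<^sup>2 * (rho x * ?a\<^sup>2) + 32 * M * ?a1\<^sup>2) + M * (rho x * ?a\<^sup>2)) =
            3 * ((32 + 32 * M * \<alpha>\<^sup>2 + M) * ?a1\<^sup>2 + (2 * k\<^sup>2 + 32 * M + 32 * M * \<alpha>\<^sup>2 + M) * ?a2\<^sup>2
              + (32 + 2 * k\<^sup>2 + 32 * M) * (rho x * ?a\<^sup>2))"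
            by (simp add: C1_def algebra_simps)
          also have "\<dots> \<ge> 0" using M(1) r by simp
          finally show ?thesis by simp
        qed
        also have "\<dots> \<le> C1 * ((?a1\<^sup>2 + ?a2\<^sup>2) + exp (- real m))"
        proof -
          have "rho x * ?a\<^sup>2 \<le> exp (- real m) * 1"
            using rm r \<theta>_le by (intro mult_mono) auto
          then show ?thesis using C1 by (intro mult_left_mono) auto
        qed
        finally have E1: "w x * (E x)\<^sup>2 \<le> w x * (C1 * ((?a1\<^sup>2 + ?a2\<^sup>2) + exp (- real m)))"
          using w0 by (intro mult_left_mono)
        have "(?a1\<^sup>2 + ?a2\<^sup>2) * w x + exp (- real m) * w x \<le> (8 * M1\<^sup>2 + 1) * G x"
        proof -
          \<comment> \<open>On the support of the profile exactly one of the \<open>m\<close> shells contains the point.\<close>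
          have tot: "(\<Sum>j<m. shell_density 2 (- 2 * real m + real j) x) = w x"
            unfolding sum_shell_density w_def using 3 r by auto
          have "(?a1\<^sup>2 + ?a2\<^sup>2) * w x \<le> 8 * M1\<^sup>2 * (shell_density 2 (- 2 * real m) x + shell_density 2 (- real m - 1) x)"
          proof (cases "- 2 * real m + 1 \<le> ?t \<and> ?t \<le> - real m - 1")
            case True
            then show ?thesis using deriv_0[of ?t] shell_density_nonneg by simp
          next
            case False
            then have "x \<in> shell 2 (- 2 * real m) \<or> x \<in> shell 2 (- real m - 1)"
              using 3 r by (auto simp: shell_def)
            then have "w x \<le> shell_density 2 (- 2 * real m) x + shell_density 2 (- real m - 1) x"
              using w0[of x] by (auto simp: shell_density_def w_def indicator_def)
            then show ?thesis using deriv_le[of ?t] w0[of x] by (intro mult_mono) auto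
          qed
          moreover have "0 \<le> shell_density 2 (- 2 * real m) x + shell_density 2 (- real m - 1) x"
            "0 \<le> 8 * M1\<^sup>2 * (exp (- real m) * w x)"
            using shell_density_nonneg w0 by (auto intro: add_nonneg_nonneg)
          ultimately show ?thesis unfolding G_def tot by (simp add: algebra_simps)
        qed
        from mult_left_mono[OF this C1] E1 show ?thesis by (simp add: algebra_simps)
      qed
    qed
    have mom2: "moment u (\<delta> + 2) = (LINT x|lborel. (u x)\<^sup>2 * rho x powr (- (\<delta> + 2)))"
      and mom1: "moment u (\<delta> + 1) = (LINT x|lborel. (u x)\<^sup>2 * rho x powr (- (\<delta> + 1)))"
      and momL: "moment (\<lambda>x. sublap u x + c *\<^sub>R u x) \<delta>
        = (LINT x|lborel. (sublap u x + c *\<^sub>R u x)\<^sup>2 * rho x powr (- \<delta>))"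
      by (simp_all add: moment_def)
    have int: "integrable lborel (\<lambda>x. (u x)\<^sup>2 * rho x powr s)" for s
      using integrable_norm_weighted[OF K KU Ck_on_continuous[OF Cu[of 0]] u0, of s] by simp
    have intL: "integrable lborel (\<lambda>x. (sublap u x + c *\<^sub>R u x)\<^sup>2 * rho x powr s)" for s
    proof -
      have "integrable lborel (\<lambda>x. (norm (sublap u x + c *\<^sub>R u x))\<^sup>2 * rho x powr s)"
      proof (rule integrable_norm_weighted[OF K KU])
        show "continuous_on UNIV (\<lambda>x. sublap u x + c *\<^sub>R u x)"
          using Ck_on_continuous[OF Cu[of 0]] Ck_on_continuous[OF Ck_on_sublap[OF Cu[of "Suc (Suc 0)"]]]
          by (intro continuous_on_add continuous_on_scaleR continuous_on_const)
        show "sublap u x + c *\<^sub>R u x = 0" if "x \<notin> K" for x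
          using sublap_eq_0(3)[OF compact_imp_closed[OF K] u0 that] u0[OF that] by simp
      qed
      then show ?thesis by simp
    qed
    have low: "(real m - 2) * shell_mass 1 \<le> moment u (\<delta> + 2)"
    proof -
      have "(real m - 2) * shell_mass 1 = (LINT x|lborel. (\<Sum>j<m-2. shell_density 1 (- 2 * real m + 1 + real j) x))"
        using m by (subst Bochner_Integration.integral_sum)
          (auto simp: integrable_shell_density integral_shell_density of_nat_diff)
      also have "\<dots> \<le> moment u (\<delta> + 2)"
        unfolding mom2
      proof (rule integral_mono[OF _ int])
        show "integrable lborel (\<lambda>x. \<Sum>j<m-2. shell_density 1 (- 2 * real m + 1 + real j) x)"
          by (intro Bochner_Integration.integrable_sum integrable_shell_density)
        show "(\<Sum>j<m-2. shell_density 1 (- 2 * real m + 1 + real j) x) \<le> (u x)\<^sup>2 * rho x powr (- (\<delta> + 2))" for x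
        proof (cases "rho x > 0 \<and> vert_sq x \<le> 1 \<and> - 2 * real m + 1 \<le> ln (rho x) \<and> ln (rho x) < - 2 * real m + 1 + real (m - 2)")
          case True
          then have "T x = 1" using m inner[of "ln (rho x)"] b1[of x] by (simp add: T_def of_nat_diff)
          then show ?thesis unfolding sum_shell_density using True u2[of x] by (simp add: punctured_def w_def)
        next
          case False
          then show ?thesis unfolding sum_shell_density by (subst if_not_P) auto
        qed
      qed
      finally show ?thesis .
    qed
    have mid: "moment u (\<delta> + 1) \<le> exp (- real m) * moment u (\<delta> + 2)"
    proof -
      have "moment u (\<delta> + 1) \<le> (LINT x|lborel. exp (- real m) * ((u x)\<^sup>2 * rho x powr (- (\<delta> + 2))))"
        unfolding mom1
      proof (rule integral_mono[OF int integrable_mult_right[OF int]])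
        show "(u x)\<^sup>2 * rho x powr (- (\<delta> + 1)) \<le> exp (- real m) * ((u x)\<^sup>2 * rho x powr (- (\<delta> + 2)))" for x
        proof (cases "x \<in> K")
          case True
          then have x: "x \<in> punctured" "rho x \<le> exp (- real m)" using KU by (auto simp: K_def)
          show ?thesis unfolding u1[OF x(1)] u2[OF x(1)]
            using x(2) w0[of x] by (intro mult_right_mono) auto
        next
          case False
          then show ?thesis using u0 by simp
        qed
      qed
      then show ?thesis unfolding mom2 by simp
    qed
    have up: "moment (\<lambda>x. sublap u x + c *\<^sub>R u x) \<delta>
          \<le> (1 + 1 / t) * (A\<^sup>2 * moment u (\<delta> + 2)) + (1 + t) * C" if t: "t > 0" for t
    proof -
      let ?B = "C1 * (8 * M1\<^sup>2 + 1)"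
      have "moment (\<lambda>x. sublap u x + c *\<^sub>R u x) \<delta> \<le>
          (LINT x|lborel. (1 + 1 / t) * A\<^sup>2 * ((u x)\<^sup>2 * rho x powr (- (\<delta> + 2))) + (1 + t) * ?B * G x)"
        unfolding momL
      proof (rule integral_mono[OF intL Bochner_Integration.integrable_add[OF
              integrable_mult_right[OF int] integrable_mult_right[OF intG]]])
        show "(sublap u x + c *\<^sub>R u x)\<^sup>2 * rho x powr (- \<delta>)
            \<le> (1 + 1 / t) * A\<^sup>2 * ((u x)\<^sup>2 * rho x powr (- (\<delta> + 2))) + (1 + t) * ?B * G x" for x
        proof (cases "x \<in> punctured")
          case True
          have "w x * (A * T x - E x)\<^sup>2 \<le> w x * ((1 + 1 / t) * (A * T x)\<^sup>2 + (1 + t) * (E x)\<^sup>2)"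
            by (intro mult_left_mono Cauchy_power2_add_le t w0)
          also have "\<dots> = (1 + 1 / t) * A\<^sup>2 * (w x * (T x)\<^sup>2) + (1 + t) * (w x * (E x)\<^sup>2)"
            by (simp add: power_mult_distrib algebra_simps)
          also have "\<dots> \<le> (1 + 1 / t) * A\<^sup>2 * (w x * (T x)\<^sup>2) + (1 + t) * (?B * G x)"
            using EG[OF True] t by (intro add_left_mono mult_left_mono) auto
          finally show ?thesis unfolding Lu[OF True] u2[OF True] by (simp add: mult.assoc)
        next
          case False
          then have "rho x = 0" using rho_nonneg[of x] by (auto simp: punctured_def)
          then show ?thesis using G0[of x] t C1 by simp
        qed
      qed
      also have "\<dots> = (1 + 1 / t) * (A\<^sup>2 * moment u (\<delta> + 2)) + (1 + t) * (?B * (LINT x|lborel. G x))"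
        unfolding mom2 using int intG by simp
      also have "\<dots> \<le> (1 + 1 / t) * (A\<^sup>2 * moment u (\<delta> + 2)) + (1 + t) * C"
        unfolding C_def using IG t C1 by (intro add_left_mono mult_left_mono) auto
      finally show ?thesis .
    qed
    show "\<exists>u :: real^'n \<Rightarrow> real. admissible u \<and>
       (real m - 2) * shell_mass 1 \<le> moment u (\<delta> + 2) \<and>
       moment u (\<delta> + 1) \<le> exp (- real m) * moment u (\<delta> + 2) \<and>
       (\<forall>t>0. moment (\<lambda>x. sublap u x + c *\<^sub>R u x) \<delta>
          \<le> (1 + 1 / t) * (A\<^sup>2 * moment u (\<delta> + 2)) + (1 + t) * C)"
      using adm low mid up by blast
  qed
qed

lemma sublap_of_real:
  fixes u :: "real^'n \<Rightarrow> real"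
  assumes u: "Ck_on 2 UNIV u"
  shows "sublap (\<lambda>x. complex_of_real (u x)) x = complex_of_real (sublap u x)"
proof -
  have u2: "Ck_on (Suc (Suc 0)) UNIV u" using u by (simp only: numeral_2_eq_2)
  have du: "u differentiable at x" for x using u2 by simp
  have dX: "apply_field (X j) u differentiable at x" if "wt j = 1" for j x
    using Ck_on_X_apply[OF that u2] by simp
  have "apply_field (X j) (\<lambda>x. complex_of_real (u x)) = (\<lambda>x. complex_of_real (apply_field (X j) u x))" for j
    by (rule ext) (rule apply_field_linear_image[OF bounded_linear_of_real du])
  moreover have "apply_field (X j) (\<lambda>x. complex_of_real (apply_field (X j) u x)) x =
      complex_of_real (apply_field (X j) (apply_field (X j) u) x)" if "wt j = 1" for j
    by (rule apply_field_linear_image[OF bounded_linear_of_real dX[OF that]])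
  ultimately show ?thesis by (simp add: sublap_def)
qed

lemma moment_of_real: "moment (\<lambda>x. complex_of_real (u x)) s = moment u s"
  by (simp add: moment_def)

lemma admissible_of_real: "admissible u \<Longrightarrow> admissible (\<lambda>x. complex_of_real (u x))"
  by (auto simp: admissible_def smooth_on_def intro!: Ck_on_linear_image[OF bounded_linear_of_real])

lemma moment_nonneg: "moment g s \<ge> 0"
  by (simp add: moment_def)

text \<open>The functionals are abstract because the two parts of the theorem write the same weights in
  different ways; only their values on conjugated functions matter. For the limit, the quotient
  is at least \<open>1\<close> by the inequality itself, so only the left-hand side has to be bounded above along
  the trial functions; with \<open>t = sqrt m\<close> the error \<open>(1 + t) C\<close> is negligible against the leading
  moment, which is at least \<open>(m - 2) V\<close>.\<close>

proposition hardy_rellich_drift: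
  fixes \<gamma> \<delta> c :: real and a :: "'n \<Rightarrow> real" and lhs rhs :: "(real^'n \<Rightarrow> complex) \<Rightarrow> real"
  defines "c \<equiv> \<gamma>\<^sup>2 * (b_X wt a)\<^sup>2"
    and "A \<equiv> (hdim - 2 * \<delta> - 4) * (hdim + 2 * \<delta>) / 4"
    and "B \<equiv> (hdim - 2 * \<delta> - 2) * (hdim + 2 * \<delta> - 2) / 2"
  assumes A: "A \<ge> 0"
    and lhs: "\<And>g. admissible g \<Longrightarrow> lhs (\<lambda>x. half_char \<gamma> a x *\<^sub>R g x) = moment (\<lambda>x. sublap g x + c *\<^sub>R g x) \<delta>"
    and rhs: "\<And>g. admissible g \<Longrightarrow> rhs (\<lambda>x. half_char \<gamma> a x *\<^sub>R g x)
      = A\<^sup>2 * moment g (\<delta> + 2) + c * B * moment g (\<delta> + 1) + c\<^sup>2 * moment g \<delta>"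
  shows "\<forall>f\<in>test_functions punctured. lhs f \<ge> rhs f"
    and "hdim > 0 \<Longrightarrow> A \<noteq> 0 \<Longrightarrow> equality_in_limit (test_functions punctured) lhs rhs"
proof -
  have c0: "c \<ge> 0" by (simp add: c_def)
  have ineq: "A\<^sup>2 * moment g (\<delta> + 2) + c * B * moment g (\<delta> + 1) + c\<^sup>2 * moment g \<delta>
      \<le> moment (\<lambda>x. sublap g x + c *\<^sub>R g x) \<delta>" if g: "admissible g" for g :: "real^'n \<Rightarrow> complex"
  proof -
    obtain K where K: "compact K" "K \<subseteq> punctured" "\<And>x. x \<notin> K \<Longrightarrow> g x = 0" "\<And>k. Ck_on k UNIV g"
      using admissibleE[OF g] by blast
    have "(hdim - 2 * \<delta> - 4) * (hdim + 2 * \<delta>) \<ge> 0" using A by (simp add: A_def)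
    from rellich_integral[OF K(1,2) K(4) K(3) c0 this] show ?thesis
      unfolding moment_def A_def B_def by simp
  qed
  show "\<forall>f\<in>test_functions punctured. lhs f \<ge> rhs f"
  proof
    fix f assume "f \<in> test_functions punctured"
    then have "admissible f" by (simp add: test_functions_eq)
    then have g: "admissible (\<lambda>x. half_char (- \<gamma>) a x *\<^sub>R f x)" by (rule admissible_half_char)
    from ineq[OF g] lhs[OF g] rhs[OF g] show "rhs f \<le> lhs f"
      by (simp only: half_char_scaleR_inverse)
  qed
  assume hdim: "hdim > 0" and A0: "A \<noteq> 0"
  obtain V C where VC: "V > 0" "C \<ge> 0"
    "\<And>m::nat. m \<ge> 3 \<Longrightarrow> \<exists>u :: real^'n \<Rightarrow> real. admissible u \<and>
       (real m - 2) * V \<le> moment u (\<delta> + 2) \<and>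
       moment u (\<delta> + 1) \<le> exp (- real m) * moment u (\<delta> + 2) \<and>
       (\<forall>t>0. moment (\<lambda>x. sublap u x + c *\<^sub>R u x) \<delta>
          \<le> (1 + 1 / t) * (A\<^sup>2 * moment u (\<delta> + 2)) + (1 + t) * C)"
    using near_optimizers[OF hdim, of \<delta> c] unfolding A_def by blast
  have "\<forall>n::nat. \<exists>u :: real^'n \<Rightarrow> real. admissible u \<and>
       (real (n + 3) - 2) * V \<le> moment u (\<delta> + 2) \<and>
       moment u (\<delta> + 1) \<le> exp (- real (n + 3)) * moment u (\<delta> + 2) \<and>
       (\<forall>t>0. moment (\<lambda>x. sublap u x + c *\<^sub>R u x) \<delta>
          \<le> (1 + 1 / t) * (A\<^sup>2 * moment u (\<delta> + 2)) + (1 + t) * C)"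
    by (intro allI VC(3)) simp
  from choice[OF this] obtain u :: "nat \<Rightarrow> real^'n \<Rightarrow> real" where uu: "\<forall>n. admissible (u n) \<and>
       (real (n + 3) - 2) * V \<le> moment (u n) (\<delta> + 2) \<and>
       moment (u n) (\<delta> + 1) \<le> exp (- real (n + 3)) * moment (u n) (\<delta> + 2) \<and>
       (\<forall>t>0. moment (\<lambda>x. sublap (u n) x + c *\<^sub>R u n x) \<delta>
          \<le> (1 + 1 / t) * (A\<^sup>2 * moment (u n) (\<delta> + 2)) + (1 + t) * C)" ..
  note u = uu[THEN spec, THEN conjunct1] uu[THEN spec, THEN conjunct2, THEN conjunct1]
    uu[THEN spec, THEN conjunct2, THEN conjunct2, THEN conjunct1]
    uu[THEN spec, THEN conjunct2, THEN conjunct2, THEN conjunct2, rule_format]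
  define g where "g n x = complex_of_real (u n x)" for n x
  define F where "F n x = half_char \<gamma> a x *\<^sub>R g n x" for n x
  have g: "admissible (g n)" for n
    unfolding g_def[abs_def] by (rule admissible_of_real[OF u(1)])
  define L where "L n = moment (\<lambda>x. sublap (u n) x + c *\<^sub>R u n x) \<delta>" for n
  define R where "R n = A\<^sup>2 * moment (u n) (\<delta> + 2) + c * B * moment (u n) (\<delta> + 1) + c\<^sup>2 * moment (u n) \<delta>" for n
  have L_eq: "moment (\<lambda>x. sublap (g n) x + c *\<^sub>R g n x) \<delta> = L n" for n
  proof -
    have C2: "Ck_on 2 UNIV (u n)" using u(1)[of n] by (auto simp: admissible_def smooth_on_def)
    show ?thesis unfolding L_def moment_of_real[symmetric] g_def[abs_def]
      by (simp add: sublap_of_real[OF C2] scaleR_conv_of_real)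
  qed
  have lhsF: "lhs (F n) = L n" for n
    using lhs[OF g[of n]] L_eq[of n] by (simp add: F_def[abs_def])
  have rhsF: "rhs (F n) = R n" for n
    using rhs[OF g[of n]] by (simp add: F_def[abs_def] R_def g_def[abs_def] moment_of_real)
  have LR: "R n \<le> L n" for n
    using ineq[OF g[of n]] unfolding L_eq by (simp add: R_def g_def[abs_def] moment_of_real)
  let ?m = "\<lambda>n. real (n + 3)"
  define D where "D n = moment (u n) (\<delta> + 2)" for n
  have Dpos: "D n > 0" for n
  proof -
    have "0 < (?m n - 2) * V" using VC(1) by simp
    then show ?thesis using u(2)[of n] by (simp add: D_def)
  qed
  \<comment> \<open>\<open>\<epsilon>\<close> and \<open>W\<close> bound the right-hand and left-hand side relative to the leading moment; both tend to \<open>A\<^sup>2\<close>.\<close>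
  define \<epsilon> where "\<epsilon> n = A\<^sup>2 - c * \<bar>B\<bar> * exp (- ?m n)" for n
  have R_ge: "\<epsilon> n * D n \<le> R n" for n
  proof -
    have "\<bar>c * B * moment (u n) (\<delta> + 1)\<bar> = c * \<bar>B\<bar> * moment (u n) (\<delta> + 1)"
      using c0 by (simp add: abs_mult moment_nonneg)
    also have "\<dots> \<le> c * \<bar>B\<bar> * (exp (- ?m n) * D n)"
      unfolding D_def using c0 by (intro mult_left_mono u(3)) auto
    finally have 1: "- (c * \<bar>B\<bar> * (exp (- ?m n) * D n)) \<le> c * B * moment (u n) (\<delta> + 1)"
      by linarith
    have 2: "0 \<le> c\<^sup>2 * moment (u n) \<delta>" by (simp add: moment_nonneg)
    have "\<epsilon> n * D n = A\<^sup>2 * D n - c * \<bar>B\<bar> * (exp (- ?m n) * D n)"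
      by (simp add: \<epsilon>_def algebra_simps)
    then show ?thesis using 1 2 unfolding R_def D_def by linarith
  qed
  define W where "W n = (1 + 1 / sqrt (?m n)) * A\<^sup>2 + (1 + sqrt (?m n)) / (?m n - 2) * (C / V)" for n
  have L_le: "L n \<le> W n * D n" for n
  proof -
    have s: "sqrt (?m n) > 0" by simp
    have "C = C / ((?m n - 2) * V) * ((?m n - 2) * V)" using VC(1) by simp
    also have "\<dots> \<le> C / ((?m n - 2) * V) * D n"
      unfolding D_def using VC by (intro mult_left_mono u(2)) auto
    finally have "(1 + sqrt (?m n)) * C \<le> (1 + sqrt (?m n)) * (C / ((?m n - 2) * V) * D n)"
      using s by (intro mult_left_mono) auto
    also have "\<dots> = (1 + sqrt (?m n)) / (?m n - 2) * (C / V) * D n" by simp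
    finally show ?thesis using u(4)[OF s, of n] unfolding L_def W_def D_def
      by (simp add: algebra_simps)
  qed
  have l: "(\<lambda>n. exp (- ?m n)) \<longlonglongrightarrow> 0" "(\<lambda>n. 1 / sqrt (?m n)) \<longlonglongrightarrow> 0"
    "(\<lambda>n. (1 + sqrt (?m n)) / (?m n - 2)) \<longlonglongrightarrow> 0"
    by real_asymp+
  have lim: "\<epsilon> \<longlonglongrightarrow> A\<^sup>2 - c * \<bar>B\<bar> * 0"
    unfolding \<epsilon>_def[abs_def] by (intro tendsto_intros l(1))
  have lim2: "W \<longlonglongrightarrow> (1 + 0) * A\<^sup>2 + 0 * (C / V)"
    unfolding W_def[abs_def]
    by (intro tendsto_add tendsto_mult tendsto_const l(2,3))
  have lim': "(\<lambda>n. W n / \<epsilon> n) \<longlonglongrightarrow> 1"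
    using A0 tendsto_divide[OF lim2 lim] by simp
  have ev: "\<forall>\<^sub>F n in sequentially. \<epsilon> n > 0"
    using lim A0 by (intro order_tendstoD(1)) auto
  have "(\<lambda>n. L n / R n) \<longlonglongrightarrow> 1"
  proof (rule tendsto_sandwich[OF _ _ tendsto_const lim'])
    show "\<forall>\<^sub>F n in sequentially. 1 \<le> L n / R n"
      using ev
    proof eventually_elim
      case (elim n)
      have "0 < \<epsilon> n * D n" using elim Dpos by simp
      then have "R n > 0" using R_ge[of n] by linarith
      then show ?case using LR[of n] by simp
    qed
    show "\<forall>\<^sub>F n in sequentially. L n / R n \<le> W n / \<epsilon> n"
      using ev
    proof eventually_elim
      case (elim n)
      have p: "0 < \<epsilon> n * D n" using elim Dpos by simp
      have "0 \<le> L n" by (simp add: L_def moment_nonneg)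
      then have "L n / R n \<le> W n * D n / (\<epsilon> n * D n)"
        using p R_ge[of n] L_le[of n] by (intro frac_le) auto
      then show ?case using Dpos[of n] by simp
    qed
  qed
  moreover have "F n \<in> test_functions punctured" for n
    unfolding test_functions_eq F_def[abs_def] using admissible_half_char[OF g] by simp
  moreover have "F n \<noteq> (\<lambda>_. 0)" for n
  proof
    assume "F n = (\<lambda>_. 0)"
    then have "F n x = 0" for x by simp
    then have "g n x = 0" for x by (simp add: F_def less_imp_neq[OF half_char_pos, symmetric])
    then have "D n = 0" by (simp add: D_def g_def moment_def)
    then show False using Dpos[of n] by simp
  qed
  ultimately show "equality_in_limit (test_functions punctured) lhs rhs"
    unfolding equality_in_limit_def by (intro exI[of _ F]) (simp add: lhsF rhsF)
qed

end

lemma hnorm_measurable: "hnorm (wt :: 'n::finite \<Rightarrow> nat) \<in> borel_measurable borel"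
  unfolding hnorm_def[abs_def] L2_set_def by (intro borel_measurable_continuous_onI continuous_intros)

theorem theorem3p2:
  fixes G :: "(real^'n) monoid"
    and wt :: "'n \<Rightarrow> nat"
    and X :: "'n \<Rightarrow> real^'n \<Rightarrow> real^'n"
    and N :: nat
    and \<gamma> :: real
    and a :: "'n \<Rightarrow> real"
  assumes "stratified_group G wt X"
    and "N = card {k. wt k = 1}"
    and "N \<ge> 3"
  shows
    "(\<forall>\<delta>::real. - real N / 2 \<le> \<delta> \<and> \<delta> \<le> -1 \<longrightarrow>
       (let T = test_functions {x. hnorm wt x \<noteq> 0};
            lhs = (\<lambda>f. (L2_norm (mu_X wt \<gamma> a)
                    (\<lambda>x. drift_sublaplacian wt X \<gamma> a f x /\<^sub>R (hnorm wt x powr \<delta>)))\<^sup>2);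
            rhs = (\<lambda>f.
                ((real N - 2 * \<delta> - 4) * (real N + 2 * \<delta>) / 4)\<^sup>2
                  * (L2_norm (mu_X wt \<gamma> a) (\<lambda>x. f x /\<^sub>R (hnorm wt x powr (\<delta> + 2))))\<^sup>2
              + \<gamma>\<^sup>2 * (b_X wt a)\<^sup>2 * ((real N - 2 * \<delta> - 2) * (real N + 2 * \<delta> - 2) / 2)
                  * (L2_norm (mu_X wt \<gamma> a) (\<lambda>x. f x /\<^sub>R (hnorm wt x powr (\<delta> + 1))))\<^sup>2
              + \<gamma> ^ 4 * (b_X wt a) ^ 4
                  * (L2_norm (mu_X wt \<gamma> a) (\<lambda>x. f x /\<^sub>R (hnorm wt x powr \<delta>)))\<^sup>2)
        in (\<forall>f\<in>T. lhs f \<ge> rhs f) \<and>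
           ((real N + 2 * \<delta>) * (real N + 2 * \<delta> - 2) \<noteq> 0 \<longrightarrow> equality_in_limit T lhs rhs)))
     \<and>
     (N > 4 \<longrightarrow>
       (let T = test_functions {x. hnorm wt x \<noteq> 0};
            lhs = (\<lambda>f. (L2_norm (mu_X wt \<gamma> a) (drift_sublaplacian wt X \<gamma> a f))\<^sup>2);
            rhs = (\<lambda>f.
                (real N * (real N - 4) / 4)\<^sup>2
                  * (L2_norm (mu_X wt \<gamma> a) (\<lambda>x. f x /\<^sub>R (hnorm wt x)\<^sup>2))\<^sup>2
              + \<gamma>\<^sup>2 * (b_X wt a)\<^sup>2 * ((real N - 2)\<^sup>2 / 2)
                  * (L2_norm (mu_X wt \<gamma> a) (\<lambda>x. f x /\<^sub>R hnorm wt x))\<^sup>2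
              + \<gamma> ^ 4 * (b_X wt a) ^ 4 * (L2_norm (mu_X wt \<gamma> a) f)\<^sup>2)
        in (\<forall>f\<in>T. lhs f \<ge> rhs f) \<and> equality_in_limit T lhs rhs))"
proof -
  interpret horizontal_frame wt X
    by (rule stratified_group.horizontal_frame[OF assms(1)])
  have dim: "hdim = real N" by (simp add: hdim_def assms(2))
  let ?T = "test_functions {x. hnorm wt x \<noteq> 0}"
  have p4: "\<gamma> ^ 4 * (b_X wt a) ^ 4 = (\<gamma>\<^sup>2 * (b_X wt a)\<^sup>2)\<^sup>2"
    by (simp add: power_mult_distrib)
  note [measurable] = hnorm_measurable
  have weight: "(\<lambda>x. hnorm wt x powr t) \<in> borel_measurable borel" for t by measurable
  note norms = L2_norm_test_function[where \<gamma> = \<gamma> and a = a, OF _ weight refl]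
  have one: "1 = hnorm wt x powr 0" if "x \<in> punctured" for x using that by (simp add: punctured_eq)
  have id: "hnorm wt x = hnorm wt x powr 1" if "x \<in> punctured" for x
    by (simp add: hnorm_eq rho_nonneg)
  have sq: "(hnorm wt x)\<^sup>2 = hnorm wt x powr 2" if "x \<in> punctured" for x
    by (simp add: hnorm_eq rho_nonneg powr_numeral)
  have norm_one:
    "(L2_norm (mu_X wt \<gamma> a) (\<lambda>x. half_char \<gamma> a x *\<^sub>R g x))\<^sup>2 = moment g 0"
    "(L2_norm (mu_X wt \<gamma> a) (drift_sublaplacian wt X \<gamma> a (\<lambda>x. half_char \<gamma> a x *\<^sub>R g x)))\<^sup>2
      = moment (\<lambda>x. sublap g x + (\<gamma>\<^sup>2 * (b_X wt a)\<^sup>2) *\<^sub>R g x) 0"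
    if "admissible g" for g
    using L2_norm_test_function[OF that borel_measurable_const[of 1] one, of \<gamma> a] by simp_all
  have norm_id: "(L2_norm (mu_X wt \<gamma> a) (\<lambda>x. (half_char \<gamma> a x *\<^sub>R g x) /\<^sub>R hnorm wt x))\<^sup>2 = moment g 1"
    if "admissible g" for g
    by (rule L2_norm_test_function(1)[OF that hnorm_measurable id])
  have norm_sq: "(L2_norm (mu_X wt \<gamma> a) (\<lambda>x. (half_char \<gamma> a x *\<^sub>R g x) /\<^sub>R (hnorm wt x)\<^sup>2))\<^sup>2 = moment g 2"
    if "admissible g" for g
  proof (rule L2_norm_test_function(1)[OF that _ sq])
    show "(\<lambda>x. (hnorm wt x)\<^sup>2) \<in> borel_measurable borel" by measurable
  qed
  show ?thesis
  proof (intro conjI allI impI)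
    fix \<delta> :: real assume \<delta>: "- real N / 2 \<le> \<delta> \<and> \<delta> \<le> -1"
    have f1: "N - 2 * \<delta> - 4 > 0" and f2: "N + 2 * \<delta> \<ge> 0" using \<delta> assms(3) by linarith+
    have A: "(hdim - 2 * \<delta> - 4) * (hdim + 2 * \<delta>) / 4 \<ge> 0" unfolding dim using f1 f2 by simp
    let ?lhs = "\<lambda>f. (L2_norm (mu_X wt \<gamma> a)
                    (\<lambda>x. drift_sublaplacian wt X \<gamma> a f x /\<^sub>R (hnorm wt x powr \<delta>)))\<^sup>2"
    let ?rhs = "\<lambda>f. ((real N - 2 * \<delta> - 4) * (real N + 2 * \<delta>) / 4)\<^sup>2
                  * (L2_norm (mu_X wt \<gamma> a) (\<lambda>x. f x /\<^sub>R (hnorm wt x powr (\<delta> + 2))))\<^sup>2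
              + \<gamma>\<^sup>2 * (b_X wt a)\<^sup>2 * ((real N - 2 * \<delta> - 2) * (real N + 2 * \<delta> - 2) / 2)
                  * (L2_norm (mu_X wt \<gamma> a) (\<lambda>x. f x /\<^sub>R (hnorm wt x powr (\<delta> + 1))))\<^sup>2
              + \<gamma> ^ 4 * (b_X wt a) ^ 4
                  * (L2_norm (mu_X wt \<gamma> a) (\<lambda>x. f x /\<^sub>R (hnorm wt x powr \<delta>)))\<^sup>2"
    have L: "?lhs (\<lambda>x. half_char \<gamma> a x *\<^sub>R g x) = moment (\<lambda>x. sublap g x + (\<gamma>\<^sup>2 * (b_X wt a)\<^sup>2) *\<^sub>R g x) \<delta>"
      if "admissible g" for g
      by (rule norms(2)[OF that])
    have R: "?rhs (\<lambda>x. half_char \<gamma> a x *\<^sub>R g x) =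
        ((hdim - 2 * \<delta> - 4) * (hdim + 2 * \<delta>) / 4)\<^sup>2 * moment g (\<delta> + 2)
        + \<gamma>\<^sup>2 * (b_X wt a)\<^sup>2 * ((hdim - 2 * \<delta> - 2) * (hdim + 2 * \<delta> - 2) / 2) * moment g (\<delta> + 1)
        + (\<gamma>\<^sup>2 * (b_X wt a)\<^sup>2)\<^sup>2 * moment g \<delta>"
      if "admissible g" for g
      unfolding norms(1)[OF that] dim p4 by (rule refl)
    note HR = hardy_rellich_drift[where lhs = ?lhs and rhs = ?rhs and \<gamma> = \<gamma> and a = a and \<delta> = \<delta>, OF A L R, unfolded punctured_eq]
    have sharp: "equality_in_limit ?T ?lhs ?rhs" if "(real N + 2 * \<delta>) * (real N + 2 * \<delta> - 2) \<noteq> 0"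
    proof (rule HR(2))
      show "hdim > 0" using assms(3) by (simp add: dim)
      show "(hdim - 2 * \<delta> - 4) * (hdim + 2 * \<delta>) / 4 \<noteq> 0" unfolding dim using f1 that by simp
    qed
    show "let T = ?T; lhs = ?lhs; rhs = ?rhs
        in (\<forall>f\<in>T. lhs f \<ge> rhs f) \<and>
           ((real N + 2 * \<delta>) * (real N + 2 * \<delta> - 2) \<noteq> 0 \<longrightarrow> equality_in_limit T lhs rhs)"
      unfolding Let_def by (rule conjI[OF HR(1) impI[OF sharp]])
  next
    assume N4: "N > 4"
    have f: "real N * (real N - 4) / 4 > 0" using N4 by simp
    have A_eq: "(hdim - 2 * 0 - 4) * (hdim + 2 * 0) / 4 = real N * (real N - 4) / 4"
      and B_eq: "(hdim - 2 * 0 - 2) * (hdim + 2 * 0 - 2) / 2 = (real N - 2)\<^sup>2 / 2"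
      by (simp_all add: dim power2_eq_square)
    have A: "(hdim - 2 * 0 - 4) * (hdim + 2 * 0) / 4 \<ge> 0" unfolding A_eq using f by simp
    let ?lhs = "\<lambda>f. (L2_norm (mu_X wt \<gamma> a) (drift_sublaplacian wt X \<gamma> a f))\<^sup>2"
    let ?rhs = "\<lambda>f. (real N * (real N - 4) / 4)\<^sup>2
                  * (L2_norm (mu_X wt \<gamma> a) (\<lambda>x. f x /\<^sub>R (hnorm wt x)\<^sup>2))\<^sup>2
              + \<gamma>\<^sup>2 * (b_X wt a)\<^sup>2 * ((real N - 2)\<^sup>2 / 2)
                  * (L2_norm (mu_X wt \<gamma> a) (\<lambda>x. f x /\<^sub>R hnorm wt x))\<^sup>2
              + \<gamma> ^ 4 * (b_X wt a) ^ 4 * (L2_norm (mu_X wt \<gamma> a) f)\<^sup>2"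
    have L: "?lhs (\<lambda>x. half_char \<gamma> a x *\<^sub>R g x) = moment (\<lambda>x. sublap g x + (\<gamma>\<^sup>2 * (b_X wt a)\<^sup>2) *\<^sub>R g x) 0"
      if "admissible g" for g
      by (rule norm_one(2)[OF that])
    have R: "?rhs (\<lambda>x. half_char \<gamma> a x *\<^sub>R g x) =
        ((hdim - 2 * 0 - 4) * (hdim + 2 * 0) / 4)\<^sup>2 * moment g (0 + 2)
        + \<gamma>\<^sup>2 * (b_X wt a)\<^sup>2 * ((hdim - 2 * 0 - 2) * (hdim + 2 * 0 - 2) / 2) * moment g (0 + 1)
        + (\<gamma>\<^sup>2 * (b_X wt a)\<^sup>2)\<^sup>2 * moment g 0"
      if "admissible g" for g
      unfolding norm_one(1)[OF that] norm_id[OF that] norm_sq[OF that] A_eq B_eq p4 add_0 by (rule refl)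
    note HR = hardy_rellich_drift[where lhs = ?lhs and rhs = ?rhs and \<gamma> = \<gamma> and a = a and \<delta> = 0, OF A L R, unfolded punctured_eq]
    have sharp: "equality_in_limit ?T ?lhs ?rhs"
    proof (rule HR(2))
      show "hdim > 0" using assms(3) by (simp add: dim)
      show "(hdim - 2 * 0 - 4) * (hdim + 2 * 0) / 4 \<noteq> 0" unfolding A_eq using f by linarith
    qed
    show "let T = ?T; lhs = ?lhs; rhs = ?rhs
        in (\<forall>f\<in>T. lhs f \<ge> rhs f) \<and> equality_in_limit T lhs rhs"
      unfolding Let_def by (rule conjI[OF HR(1) sharp])
  qed
qed

end
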